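(* There exists an absolute constant $C>0$ such that the following holds. Let $m\ge2$ be an integer, let $G$ be an abelian group of torsion $m$, and let $X,Y$ be $G$-valued random variables. Then there exists a (finite) subgroup $H\le G$ such that $$d[X;U_H]\le C m^3 d[X;Y]\quad\text{and}\quad d[Y;U_H]\le C m^3 d[X;Y].$$ Moreover, if $X,Y$ take values in some symmetric set $S\subseteq G$ containing the origin, then $H$ can in addition be taken to be contained in $\ell S$ for some positive integer $\ell\le C(2+m\,d[X;Y])^{C m^3\log m}$.
   Context: An abelian group $G$ has torsion $m$ if $mg=0$ for all $g\in G$ ($m$ not necessarily minimal). A $G$-valued random variable is a discrete random variable taking finitely many values in $G$. The entropy is $\mathbf{H}[X]=\sum_x p_X(x)\log\frac1{p_X(x)}$, where $p_X(x)=\mathbf{P}(X=x)$, $\log$ is natural, and $0\log\frac10=0$. The entropic Ruzsa distance is $d[X;Y]=\mathbf{H}[\tilde X-\tilde Y]-\frac12\mathbf{H}[\tilde X]-\frac12\mathbf{H}[\tilde Y]$, where $\tilde X,\tilde Y$ are independent copies of $X,Y$ respectively ($X$ and $Y$ need not be independent or defined on the same space). $U_H$ is a random variable uniformly distributed on the finite subgroup $H$. A set $S$ is symmetric if $S=-S$; $\ell S=S+\cdots+S$ ($\ell$ copies). *)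

theory Defs
  imports "HOL-Probability.Information" "HOL-Algebra.Coset"
begin

text \<open>
  A \<open>G\<close>-valued random variable is a map \<open>X\<close> on the sample space of a probability space \<open>M\<close> with
  \<^term>\<open>simple_function M X\<close> (finitely many values, each level set an event) and
  \<^term>\<open>X ` space M \<subseteq> carrier G\<close>. Abelian groups are written multiplicatively, as in HOL-Algebra, so
  that \<open>x - y\<close> reads \<open>x \<otimes>\<^bsub>G\<^esub> inv\<^bsub>G\<^esub> y\<close> and \<open>m g = 0\<close> reads \<open>g [^]\<^bsub>G\<^esub> m = \<one>\<^bsub>G\<^esub>\<close>.
\<close>

definition group_valued_rv :: "'a monoid \<Rightarrow> 'b measure \<Rightarrow> ('b \<Rightarrow> 'a) \<Rightarrow> bool" where
  "group_valued_rv G M X \<longleftrightarrow> prob_space M \<and> simple_function M X \<and> X ` space M \<subseteq> carrier G"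

text \<open>The convention \<open>0 log (1/0) = 0\<close> is automatic, since the factor \<open>0\<close> annihilates.\<close>

definition shannon_entropy :: "'b measure \<Rightarrow> ('b \<Rightarrow> 'a) \<Rightarrow> real" where
  "shannon_entropy M X =
     (\<Sum>x\<in>X ` space M. \<P>(\<omega> in M. X \<omega> = x) * ln (1 / \<P>(\<omega> in M. X \<omega> = x)))"

lemma shannon_entropy_eq_entropy:
  assumes "prob_space M" "simple_function M X"
  shows "shannon_entropy M X = prob_space.entropy M (exp 1) (count_space (X ` space M)) X"
proof -
  interpret prob_space M by fact
  interpret information_space M "exp 1" by unfold_locales simp
  have "simple_distributed M X (\<lambda>x. measure M (X -` {x} \<inter> space M))"
    using assms(2) by (rule simple_distributedI) simp_all
  moreover have "{\<omega> \<in> space M. X \<omega> = x} = X -` {x} \<inter> space M" for x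
    by auto
  ultimately show ?thesis
    by (simp add: shannon_entropy_def entropy_simple_distributed log_def inverse_eq_divide [symmetric]
        ln_inverse sum_negf)
qed

text \<open>
  The independent copies of \<open>X\<close> and \<open>Y\<close> are realised on the product of their sample spaces.
\<close>

definition ruzsa_dist ::
    "'a monoid \<Rightarrow> 'b measure \<Rightarrow> ('b \<Rightarrow> 'a) \<Rightarrow> 'c measure \<Rightarrow> ('c \<Rightarrow> 'a) \<Rightarrow> real" where
  "ruzsa_dist G M X N Y =
     shannon_entropy (M \<Otimes>\<^sub>M N) (\<lambda>(u, v). X u \<otimes>\<^bsub>G\<^esub> inv\<^bsub>G\<^esub> (Y v))
       - shannon_entropy M X / 2 - shannon_entropy N Y / 2"

text \<open>\<open>d[X; U\<^sub>H]\<close>: the variable \<open>U\<^sub>H\<close> is the identity on \<open>H\<close> with its uniform probability measure.\<close>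

definition ruzsa_dist_subgroup ::
    "'a monoid \<Rightarrow> 'b measure \<Rightarrow> ('b \<Rightarrow> 'a) \<Rightarrow> 'a set \<Rightarrow> real" where
  "ruzsa_dist_subgroup G M X H = ruzsa_dist G M X (uniform_count_measure H) (\<lambda>h. h)"

primrec iterated_sumset :: "'a monoid \<Rightarrow> nat \<Rightarrow> 'a set \<Rightarrow> 'a set" where
  "iterated_sumset G 0 S = {\<one>\<^bsub>G\<^esub>}"
| "iterated_sumset G (Suc l) S = iterated_sumset G l S <#>\<^bsub>G\<^esub> S"

definition subgroup_near_both ::
    "real \<Rightarrow> nat \<Rightarrow> 'a monoid \<Rightarrow> 'b measure \<Rightarrow> ('b \<Rightarrow> 'a) \<Rightarrow> 'c measure \<Rightarrow> ('c \<Rightarrow> 'a) \<Rightarrow> 'a set \<Rightarrow> bool"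
  where
  "subgroup_near_both C m G M X N Y H \<longleftrightarrow>
     subgroup H G \<and> finite H \<and>
     ruzsa_dist_subgroup G M X H \<le> C * real m ^ 3 * ruzsa_dist G M X N Y \<and>
     ruzsa_dist_subgroup G N Y H \<le> C * real m ^ 3 * ruzsa_dist G M X N Y"

text \<open>
  The entropic Marton theorem with the given constant \<open>C\<close>, for all groups with elements in \<open>'a\<close> and
  all random variables on sample spaces with points in \<open>'b\<close> and \<open>'c\<close>. The first argument only
  carries these types. HOL cannot quantify over types inside a formula, so an assertion
  \<open>\<exists>C > 0. marton_with_constant TYPE('a \<times> 'b \<times> 'c) C\<close> with type variables would let \<open>C\<close> depend on the
  types. An absolute \<open>C\<close> is obtained by asserting that some \<open>C > 0\<close> works for the closed type
  \<open>nat \<times> nat \<times> nat\<close>, and that every such \<open>C\<close> works for arbitrary types.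
\<close>

definition marton_with_constant :: "('a \<times> 'b \<times> 'c) itself \<Rightarrow> real \<Rightarrow> bool" where
  "marton_with_constant (_ :: ('a \<times> 'b \<times> 'c) itself) C \<longleftrightarrow>
     (\<forall>m\<ge>2. \<forall>(G :: 'a monoid) (M :: 'b measure) (X :: 'b \<Rightarrow> 'a) (N :: 'c measure) (Y :: 'c \<Rightarrow> 'a).
        comm_group G \<and> (\<forall>g\<in>carrier G. g [^]\<^bsub>G\<^esub> m = \<one>\<^bsub>G\<^esub>) \<and>
        group_valued_rv G M X \<and> group_valued_rv G N Y \<longrightarrow>
          (\<exists>H. subgroup_near_both C m G M X N Y H) \<and>
          (\<forall>S. S \<subseteq> carrier G \<and> set_inv\<^bsub>G\<^esub> S = S \<and> \<one>\<^bsub>G\<^esub> \<in> S \<and>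
               X ` space M \<subseteq> S \<and> Y ` space N \<subseteq> S \<longrightarrow>
             (\<exists>H l. subgroup_near_both C m G M X N Y H \<and>
                l > 0 \<and> H \<subseteq> iterated_sumset G l S \<and>
                real l \<le> C * (2 + real m * ruzsa_dist G M X N Y) powr (C * real m ^ 3 * ln (real m)))))"

end

theory Submission
  imports Defs "HOL-Probability.Product_PMF" "HOL-Algebra.FiniteProduct"
begin

text \<open>
  The multidistance of a tuple \<open>X\<^sub>0, \<dots>, X\<^sub>m\<^sub>-\<^sub>1\<close> is the entropy of the sum of independent copies minus the
  average of the entropies. Write \<open>D\<close> for it and let \<open>\<eta>\<close> be a small multiple of \<open>m\<^sup>-\<^sup>3\<close>. The key point
  is that some tuple \<open>Y\<close> has multidistance plus \<open>\<eta> (d[X\<^sub>0; Y\<^sub>0] + \<dots> + d[X\<^sub>m\<^sub>-\<^sub>1; Y\<^sub>m\<^sub>-\<^sub>1])\<close> at most \<open>(1 - \<eta>) D\<close>.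
  Otherwise, take an \<open>m \<times> m\<close> array of independent \<open>Y\<^sub>i\<^sub>j\<close> distributed as \<open>X\<^sub>i\<close>. Since fibres of the
  \<open>X\<^sub>i\<close> over partial row sums are no better than \<open>X\<close>, the row sums and the column sums of the array are
  nearly independent given the total sum, and the same holds after permuting the entries so that
  antidiagonals become rows or columns. By torsion the three variables \<open>\<Sum> i Y\<^sub>i\<^sub>j\<close>, \<open>\<Sum> j Y\<^sub>i\<^sub>j\<close>,
  \<open>\<Sum> (- i - j) Y\<^sub>i\<^sub>j\<close> sum to zero, and they are functions of the row, column and antidiagonal sums.
  Hence they are pairwise nearly independent given the total sum, and the entropic
  Balog--Szemeredi--Gowers theorem yields a fibre of small self-distance, and the tuple of its
  independent copies is better than \<open>X\<close> after all.

  Each step replaces a sumset \<open>l S\<close> containing the supports by \<open>m\<^sup>3 l S\<close>, and about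
  \<open>m\<^sup>3 log (2 + m d[X; Y])\<close> steps make the multidistance tiny. A distribution of tiny self-distance is close to uniform on a coset of a
  subgroup: almost all of its translates are close in total variation to its difference distribution, and
  the near-periods of the latter form the subgroup.

  The whole argument lives in a finite subgroup, so it can be carried out inside one type of class
  \<^class>\<open>ab_group_add\<close> into which all finite abelian groups embed.
\<close>

section \<open>Entropy of finitely supported distributions\<close>

text \<open>Two losses fix the exponent of m in \<open>\<eta>\<close>. Near-minimality bounds each
  conditional mutual information by about m^2 \<eta> D, and replacing a fibre by m copies of it
  multiplies this by m; the distances from the X_i to the weighted sum add up to O(m^3 D) and are
  weighted by \<eta>. Both are small fractions of D once \<eta> is a small multiple of m^-3. A step
  is a decrement and not the choice of a minimiser, because a minimiser would give no control over
  the sumset that contains its support. The penalty by distances accumulates over the steps by the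
  triangle inequality, and this is what ties the final tuple to the initial distribution. A step
  multiplies the length of the sumset by m^3, so after about m^3 log (2 + m d[X;Y]) steps the length
  is m to a multiple of that number, which is the shape of the bound on l. The distance bounds have
  to be linear in d[X;Y] even when that is tiny. Hence the stage at the end, where D is below an
  absolute constant, must lose only a multiple of D.\<close>

definition pent :: "'a pmf \<Rightarrow> real" where
  "pent p = (\<Sum>x\<in>set_pmf p. pmf p x * - ln (pmf p x))"

definition ent :: "'a pmf \<Rightarrow> ('a \<Rightarrow> 'b) \<Rightarrow> real" where
  "ent P X = pent (map_pmf X P)"

lemma pmf_map_sum:
  assumes "finite (set_pmf P)"
  shows "pmf (map_pmf X P) x = (\<Sum>\<omega> | \<omega> \<in> set_pmf P \<and> X \<omega> = x. pmf P \<omega>)"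
proof -
  have "pmf (map_pmf X P) x = measure P (X -` {x} \<inter> set_pmf P)"
    by (simp add: pmf_map measure_Int_set_pmf)
  also have "X -` {x} \<inter> set_pmf P = {\<omega> \<in> set_pmf P. X \<omega> = x}"
    by auto
  finally show ?thesis
    using assms by (simp add: measure_measure_pmf_finite)
qed

lemma sum_map_pmf:
  assumes "finite (set_pmf P)"
  shows "(\<Sum>x\<in>set_pmf (map_pmf X P). pmf (map_pmf X P) x * f x) = (\<Sum>\<omega>\<in>set_pmf P. pmf P \<omega> * f (X \<omega>))"
proof -
  have "(\<Sum>\<omega>\<in>set_pmf P. pmf P \<omega> * f (X \<omega>)) =
      (\<Sum>x\<in>X ` set_pmf P. \<Sum>\<omega> | \<omega> \<in> set_pmf P \<and> X \<omega> = x. pmf P \<omega> * f (X \<omega>))"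
    using assms by (rule sum.image_gen)
  also have "\<dots> = (\<Sum>x\<in>X ` set_pmf P. pmf (map_pmf X P) x * f x)"
    using assms by (simp add: pmf_map_sum sum_distrib_right)
  finally show ?thesis by simp
qed

lemma ent_eq_sum:
  assumes "finite (set_pmf P)"
  shows "ent P X = (\<Sum>\<omega>\<in>set_pmf P. pmf P \<omega> * - ln (pmf (map_pmf X P) (X \<omega>)))"
  unfolding ent_def pent_def by (rule sum_map_pmf [OF assms])

lemma pmf_map_pos: "\<omega> \<in> set_pmf P \<Longrightarrow> pmf (map_pmf X P) (X \<omega>) > 0"
  by (simp add: pmf_positive)

text \<open>That \<open>X\<close> is a function of \<open>Y\<close> is expressed by equality of
  values on the support, so no such function has to be named. Each level set of \<open>Y\<close>
  then lies in a level set of \<open>X\<close>, whose probability is at least as large.\<close>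

lemma ent_mono:
  assumes fin: "finite (set_pmf P)"
    and det: "\<And>\<omega> \<omega>'. \<omega> \<in> set_pmf P \<Longrightarrow> \<omega>' \<in> set_pmf P \<Longrightarrow> Y \<omega> = Y \<omega>' \<Longrightarrow> X \<omega> = X \<omega>'"
  shows "ent P X \<le> ent P Y"
  unfolding ent_eq_sum [OF fin]
proof (intro sum_mono mult_left_mono)
  fix \<omega> assume w: "\<omega> \<in> set_pmf P"
  have "pmf (map_pmf Y P) (Y \<omega>) \<le> pmf (map_pmf X P) (X \<omega>)"
    unfolding pmf_map_sum [OF fin]
  proof (rule sum_mono2)
    show "{\<omega>' \<in> set_pmf P. Y \<omega>' = Y \<omega>} \<subseteq> {\<omega>' \<in> set_pmf P. X \<omega>' = X \<omega>}"
      using det w by blast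
  qed (use fin in auto)
  then show "- ln (pmf (map_pmf X P) (X \<omega>)) \<le> - ln (pmf (map_pmf Y P) (Y \<omega>))"
    using pmf_map_pos [OF w, of X] pmf_map_pos [OF w, of Y] by simp
qed simp

lemma ent_cong:
  assumes fin: "finite (set_pmf P)"
    and det: "\<And>\<omega> \<omega>'. \<omega> \<in> set_pmf P \<Longrightarrow> \<omega>' \<in> set_pmf P \<Longrightarrow> Y \<omega> = Y \<omega>' \<longleftrightarrow> X \<omega> = X \<omega>'"
  shows "ent P X = ent P Y"
  by (intro antisym ent_mono fin) (use det in blast)+

lemma ent_map: "ent (map_pmf f P) X = ent P (\<lambda>\<omega>. X (f \<omega>))"
  by (simp add: ent_def map_pmf_comp)

lemma ent_const [simp]: "ent P (\<lambda>_. c) = 0"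
  by (simp add: ent_def pent_def)

lemma sum_pmf_eq_1': "finite (set_pmf P) \<Longrightarrow> (\<Sum>\<omega>\<in>set_pmf P. pmf P \<omega>) = 1"
  by (simp add: sum_pmf_eq_1)

section \<open>Gibbs' inequality and submodularity\<close>

lemma gibbs_sum:
  fixes r :: "'a \<Rightarrow> real"
  assumes fin: "finite (set_pmf P)" and pos: "\<And>\<omega>. \<omega> \<in> set_pmf P \<Longrightarrow> r \<omega> > 0"
    and le: "(\<Sum>\<omega>\<in>set_pmf P. pmf P \<omega> * r \<omega>) \<le> 1"
  shows "(\<Sum>\<omega>\<in>set_pmf P. pmf P \<omega> * ln (r \<omega>)) \<le> 0"
proof -
  have "(\<Sum>\<omega>\<in>set_pmf P. pmf P \<omega> * ln (r \<omega>)) \<le> (\<Sum>\<omega>\<in>set_pmf P. pmf P \<omega> * (r \<omega> - 1))"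
    by (intro sum_mono mult_left_mono ln_le_minus_one pos) auto
  also have "\<dots> = (\<Sum>\<omega>\<in>set_pmf P. pmf P \<omega> * r \<omega>) - (\<Sum>\<omega>\<in>set_pmf P. pmf P \<omega>)"
    by (simp add: algebra_simps sum_subtractf)
  also have "\<dots> \<le> 0" using le fin by (simp add: sum_pmf_eq_1')
  finally show ?thesis .
qed

lemma pmf_map_fst_sum:
  assumes "finite (set_pmf R)"
  shows "pmf (map_pmf fst R) a = (\<Sum>b\<in>snd ` set_pmf R. pmf R (a, b))"
proof -
  have "pmf (map_pmf fst R) a = (\<Sum>\<omega> | \<omega> \<in> set_pmf R \<and> fst \<omega> = a. pmf R \<omega>)"
    by (rule pmf_map_sum [OF assms])
  also have "\<dots> = (\<Sum>\<omega>\<in>{a} \<times> snd ` set_pmf R. pmf R \<omega>)"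
    by (rule sum.mono_neutral_left) (use assms in \<open>force simp: set_pmf_iff\<close>)+
  also have "\<dots> = (\<Sum>b\<in>snd ` set_pmf R. pmf R (a, b))"
    by (subst sum.cartesian_product [symmetric, where A="{a}" and g="\<lambda>a b. pmf R (a,b)", simplified]) simp
  finally show ?thesis .
qed

text \<open>Gibbs' inequality for the ratio of p(x,z) p(y,z) / p(z) to p(x,y,z). The numerator is
  the distribution that makes X and Y conditionally independent given Z, so the ratio has mean at
  most 1. Most later entropy inequalities are instances of this one.\<close>

lemma ent_submod:
  assumes fin: "finite (set_pmf P)"
  shows "ent P (\<lambda>\<omega>. (X \<omega>, Y \<omega>, Z \<omega>)) + ent P Z \<le> ent P (\<lambda>\<omega>. (X \<omega>, Z \<omega>)) + ent P (\<lambda>\<omega>. (Y \<omega>, Z \<omega>))"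
proof -
  define xyz where "xyz \<omega> = pmf (map_pmf (\<lambda>\<omega>. (X \<omega>, Y \<omega>, Z \<omega>)) P) (X \<omega>, Y \<omega>, Z \<omega>)" for \<omega>
  define xz where "xz \<omega> = pmf (map_pmf (\<lambda>\<omega>. (X \<omega>, Z \<omega>)) P) (X \<omega>, Z \<omega>)" for \<omega>
  define yz where "yz \<omega> = pmf (map_pmf (\<lambda>\<omega>. (Y \<omega>, Z \<omega>)) P) (Y \<omega>, Z \<omega>)" for \<omega>
  define z where "z \<omega> = pmf (map_pmf Z P) (Z \<omega>)" for \<omega>
  have pos: "xyz \<omega> > 0" "xz \<omega> > 0" "yz \<omega> > 0" "z \<omega> > 0" if "\<omega> \<in> set_pmf P" for \<omega>
    unfolding xyz_def xz_def yz_def z_def using that by (auto intro!: pmf_positive)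
  let ?S = "set_pmf P"
  let ?f = "\<lambda>(x, y, z). pmf (map_pmf (\<lambda>\<omega>. (X \<omega>, Z \<omega>)) P) (x, z) * pmf (map_pmf (\<lambda>\<omega>. (Y \<omega>, Z \<omega>)) P) (y, z) / pmf (map_pmf Z P) z"
  have margY: "(\<Sum>y\<in>Y ` ?S. pmf (map_pmf (\<lambda>\<omega>. (Y \<omega>, Z \<omega>)) P) (y, z)) = pmf (map_pmf Z P) z" for z
  proof -
    have "pmf (map_pmf fst (map_pmf (\<lambda>\<omega>. (Z \<omega>, Y \<omega>)) P)) z = (\<Sum>b\<in>snd ` set_pmf (map_pmf (\<lambda>\<omega>. (Z \<omega>, Y \<omega>)) P). pmf (map_pmf (\<lambda>\<omega>. (Z \<omega>, Y \<omega>)) P) (z, b))"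
      by (rule pmf_map_fst_sum) (use fin in simp)
    moreover have "pmf (map_pmf (\<lambda>\<omega>. (Z \<omega>, Y \<omega>)) P) (z, b) = pmf (map_pmf (\<lambda>\<omega>. (Y \<omega>, Z \<omega>)) P) (b, z)" for b
      unfolding pmf_map_sum [OF fin] by (rule sum.cong) auto
    ultimately show ?thesis by (simp add: map_pmf_comp image_image)
  qed
  have margX: "(\<Sum>x\<in>X ` ?S. pmf (map_pmf (\<lambda>\<omega>. (X \<omega>, Z \<omega>)) P) (x, z)) = pmf (map_pmf Z P) z" for z
  proof -
    have "pmf (map_pmf fst (map_pmf (\<lambda>\<omega>. (Z \<omega>, X \<omega>)) P)) z = (\<Sum>b\<in>snd ` set_pmf (map_pmf (\<lambda>\<omega>. (Z \<omega>, X \<omega>)) P). pmf (map_pmf (\<lambda>\<omega>. (Z \<omega>, X \<omega>)) P) (z, b))"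
      by (rule pmf_map_fst_sum) (use fin in simp)
    moreover have "pmf (map_pmf (\<lambda>\<omega>. (Z \<omega>, X \<omega>)) P) (z, b) = pmf (map_pmf (\<lambda>\<omega>. (X \<omega>, Z \<omega>)) P) (b, z)" for b
      unfolding pmf_map_sum [OF fin] by (rule sum.cong) auto
    ultimately show ?thesis by (simp add: map_pmf_comp image_image)
  qed
  have "(\<Sum>\<omega>\<in>?S. pmf P \<omega> * (xz \<omega> * yz \<omega> / (xyz \<omega> * z \<omega>))) =
     (\<Sum>t\<in>set_pmf (map_pmf (\<lambda>\<omega>. (X \<omega>, Y \<omega>, Z \<omega>)) P). pmf (map_pmf (\<lambda>\<omega>. (X \<omega>, Y \<omega>, Z \<omega>)) P) t * (?f t / pmf (map_pmf (\<lambda>\<omega>. (X \<omega>, Y \<omega>, Z \<omega>)) P) t))"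
    unfolding sum_map_pmf [OF fin] xyz_def xz_def yz_def z_def by (intro sum.cong) auto
  also have "\<dots> = (\<Sum>t\<in>(\<lambda>\<omega>. (X \<omega>, Y \<omega>, Z \<omega>)) ` ?S. ?f t)"
    by (intro sum.cong) (auto simp: pmf_map_pos pmf_eq_0_set_pmf)
  \<comment> \<open>Passing from the support of the triple to the product of the three ranges only
    adds nonnegative terms, and makes the sum factor for fixed z.\<close>
  also have "\<dots> \<le> (\<Sum>t\<in>X ` ?S \<times> Y ` ?S \<times> Z ` ?S. ?f t)"
    by (rule sum_mono2) (use fin in \<open>auto intro!: divide_nonneg_nonneg\<close>)
  also have "\<dots> = (\<Sum>x\<in>X ` ?S. \<Sum>y\<in>Y ` ?S. \<Sum>z\<in>Z ` ?S. ?f (x, y, z))"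
    by (simp add: sum.cartesian_product case_prod_beta)
  also have "\<dots> = (\<Sum>z\<in>Z ` ?S. \<Sum>x\<in>X ` ?S. \<Sum>y\<in>Y ` ?S. ?f (x, y, z))"
    by (subst (2) sum.swap, subst sum.swap) simp
  also have "\<dots> = (\<Sum>z\<in>Z ` ?S. pmf (map_pmf Z P) z)"
  proof (rule sum.cong [OF refl])
    fix z assume "z \<in> Z ` ?S"
    then have nz: "pmf (map_pmf Z P) z \<noteq> 0" by (auto simp: pmf_eq_0_set_pmf)
    have "(\<Sum>x\<in>X ` ?S. \<Sum>y\<in>Y ` ?S. ?f (x, y, z)) = (\<Sum>x\<in>X ` ?S. pmf (map_pmf (\<lambda>\<omega>. (X \<omega>, Z \<omega>)) P) (x, z))"
      by (simp add: sum_distrib_left [symmetric] sum_divide_distrib [symmetric] margY nz)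
    then show "(\<Sum>x\<in>X ` ?S. \<Sum>y\<in>Y ` ?S. ?f (x, y, z)) = pmf (map_pmf Z P) z"
      by (simp add: margX)
  qed
  also have "\<dots> = 1"
    using sum_pmf_eq_1' [of "map_pmf Z P"] fin by simp
  finally have "(\<Sum>\<omega>\<in>?S. pmf P \<omega> * ln (xz \<omega> * yz \<omega> / (xyz \<omega> * z \<omega>))) \<le> 0"
    by (intro gibbs_sum fin) (auto simp: pos)
  also have "(\<Sum>\<omega>\<in>?S. pmf P \<omega> * ln (xz \<omega> * yz \<omega> / (xyz \<omega> * z \<omega>))) =
    (\<Sum>\<omega>\<in>?S. pmf P \<omega> * - ln (xyz \<omega>)) + (\<Sum>\<omega>\<in>?S. pmf P \<omega> * - ln (z \<omega>))
     - (\<Sum>\<omega>\<in>?S. pmf P \<omega> * - ln (xz \<omega>)) - (\<Sum>\<omega>\<in>?S. pmf P \<omega> * - ln (yz \<omega>))"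
    unfolding sum.distrib [symmetric] sum_subtractf [symmetric]
  proof (rule sum.cong [OF refl])
    fix \<omega> assume "\<omega> \<in> ?S"
    note p = pos [OF this]
    show "pmf P \<omega> * ln (xz \<omega> * yz \<omega> / (xyz \<omega> * z \<omega>)) = pmf P \<omega> * - ln (xyz \<omega>) + pmf P \<omega> * - ln (z \<omega>) - pmf P \<omega> * - ln (xz \<omega>) - pmf P \<omega> * - ln (yz \<omega>)"
      using p by (simp add: ln_div ln_mult algebra_simps)
  qed
  finally show ?thesis
    unfolding ent_eq_sum [OF fin] xyz_def xz_def yz_def z_def by simp
qed

lemma ent_subadd:
  assumes fin: "finite (set_pmf P)"
  shows "ent P (\<lambda>\<omega>. (X \<omega>, Y \<omega>)) \<le> ent P X + ent P Y"
proof -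
  have "ent P (\<lambda>\<omega>. (X \<omega>, Y \<omega>)) = ent P (\<lambda>\<omega>. (X \<omega>, Y \<omega>, ()))"
    "ent P (\<lambda>\<omega>. (X \<omega>, ())) = ent P X" "ent P (\<lambda>\<omega>. (Y \<omega>, ())) = ent P Y"
    by (intro ent_cong fin; auto)+
  with ent_submod [OF fin, of X Y "\<lambda>_. ()"] show ?thesis by simp
qed

lemma ent_indep:
  assumes fin: "finite (set_pmf P)"
    and ind: "map_pmf (\<lambda>\<omega>. (X \<omega>, Y \<omega>)) P = pair_pmf (map_pmf X P) (map_pmf Y P)"
  shows "ent P (\<lambda>\<omega>. (X \<omega>, Y \<omega>)) = ent P X + ent P Y"
proof -
  have "pmf P \<omega> * - ln (pmf (map_pmf (\<lambda>\<omega>. (X \<omega>, Y \<omega>)) P) (X \<omega>, Y \<omega>)) =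
     pmf P \<omega> * - ln (pmf (map_pmf X P) (X \<omega>)) + pmf P \<omega> * - ln (pmf (map_pmf Y P) (Y \<omega>))"
    if w: "\<omega> \<in> set_pmf P" for \<omega>
  proof -
    have "pmf (map_pmf (\<lambda>\<omega>. (X \<omega>, Y \<omega>)) P) (X \<omega>, Y \<omega>) =
        pmf (map_pmf X P) (X \<omega>) * pmf (map_pmf Y P) (Y \<omega>)"
      by (subst ind) (rule pmf_pair)
    moreover have "ln (pmf (map_pmf X P) (X \<omega>) * pmf (map_pmf Y P) (Y \<omega>)) =
        ln (pmf (map_pmf X P) (X \<omega>)) + ln (pmf (map_pmf Y P) (Y \<omega>))"
      by (rule ln_mult_pos) (use w in \<open>auto intro: pmf_map_pos\<close>)
    ultimately show ?thesis by (simp only:) (simp only: distrib_left minus_add_distrib)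
  qed
  then show ?thesis
    unfolding ent_eq_sum [OF fin] by (simp add: sum.distrib [symmetric])
qed

section \<open>Mixtures, the chain rule and conditional distributions\<close>

definition mix :: "'r pmf \<Rightarrow> ('r \<Rightarrow> 'w pmf) \<Rightarrow> ('r \<times> 'w) pmf" where
  "mix R K = bind_pmf R (\<lambda>r. map_pmf (Pair r) (K r))"

lemma set_mix: "set_pmf (mix R K) = Sigma (set_pmf R) (\<lambda>r. set_pmf (K r))"
  by (auto simp: mix_def)

lemma finite_mix: "finite (set_pmf R) \<Longrightarrow> (\<And>r. r \<in> set_pmf R \<Longrightarrow> finite (set_pmf (K r))) \<Longrightarrow> finite (set_pmf (mix R K))"
  by (auto simp: set_mix)

lemma map_fst_mix: "map_pmf fst (mix R K) = R"
  by (simp add: mix_def map_bind_pmf map_pmf_comp bind_return_pmf')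

lemma map_snd_mix: "map_pmf (\<lambda>\<omega>. f (fst \<omega>) (snd \<omega>)) (mix R K) = bind_pmf R (\<lambda>r. map_pmf (f r) (K r))"
  by (simp add: mix_def map_bind_pmf map_pmf_comp)

lemma pmf_bind_finite: "finite (set_pmf R) \<Longrightarrow> pmf (bind_pmf R K) x = (\<Sum>r\<in>set_pmf R. pmf R r * pmf (K r) x)"
  by (subst pmf_bind, subst integral_measure_pmf [where A="set_pmf R"]) (auto simp: set_pmf_iff)

lemma pmf_mix: 
  assumes fin: "finite (set_pmf R)"
  shows "pmf (mix R K) (r, w) = pmf R r * pmf (K r) w"
proof -
  have "pmf (mix R K) (r, w) = (\<Sum>s\<in>set_pmf R. pmf R s * pmf (map_pmf (Pair s) (K s)) (r, w))"
    unfolding mix_def by (rule pmf_bind_finite [OF fin])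
  also have "\<dots> = (\<Sum>s\<in>set_pmf R. if s = r then pmf R r * pmf (K r) w else 0)"
  proof (rule sum.cong [OF refl])
    fix s
    show "pmf R s * pmf (map_pmf (Pair s) (K s)) (r, w) = (if s = r then pmf R r * pmf (K r) w else 0)"
    proof (cases "s = r")
      case True
      then show ?thesis using pmf_map_inj' [of "Pair r" "K r" w] by (simp add: inj_on_def)
    next
      case False
      then have "pmf (map_pmf (Pair s) (K s)) (r, w) = 0" by (intro pmf_map_outside) auto
      with False show ?thesis by simp
    qed
  qed
  also have "\<dots> = pmf R r * pmf (K r) w"
    using fin by (simp add: set_pmf_iff)
  finally show ?thesis .
qed

lemma pent_mix:
  assumes "finite (set_pmf R)" "\<And>r. r \<in> set_pmf R \<Longrightarrow> finite (set_pmf (K r))"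
  shows "pent (mix R K) = pent R + (\<Sum>r\<in>set_pmf R. pmf R r * pent (K r))"
proof -
  have "pent (mix R K) = (\<Sum>r\<in>set_pmf R. \<Sum>w\<in>set_pmf (K r). pmf R r * pmf (K r) w * - ln (pmf R r * pmf (K r) w))"
    unfolding pent_def set_mix using assms by (simp add: sum.Sigma case_prod_beta pmf_mix [symmetric])
  also have "\<dots> = (\<Sum>r\<in>set_pmf R. pmf R r * - ln (pmf R r) + pmf R r * pent (K r))"
  proof (rule sum.cong [OF refl])
    fix r assume r: "r \<in> set_pmf R"
    have "(\<Sum>w\<in>set_pmf (K r). pmf R r * pmf (K r) w * - ln (pmf R r * pmf (K r) w)) =
      (\<Sum>w\<in>set_pmf (K r). pmf R r * - ln (pmf R r) * pmf (K r) w + pmf R r * (pmf (K r) w * - ln (pmf (K r) w)))"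
      by (rule sum.cong [OF refl]) (use r in \<open>simp add: ln_mult pmf_positive algebra_simps\<close>)
    also have "\<dots> = pmf R r * - ln (pmf R r) + pmf R r * pent (K r)"
      unfolding sum.distrib sum_distrib_left [symmetric] pent_def
      using assms(2) [OF r] by (simp add: sum_pmf_eq_1')
    finally show "(\<Sum>w\<in>set_pmf (K r). pmf R r * pmf (K r) w * - ln (pmf R r * pmf (K r) w)) = pmf R r * - ln (pmf R r) + pmf R r * pent (K r)" .
  qed
  finally show ?thesis by (simp only: sum.distrib pent_def)
qed

lemma ent_mix:
  assumes "finite (set_pmf R)" "\<And>r. r \<in> set_pmf R \<Longrightarrow> finite (set_pmf (K r))"
  shows "ent (mix R K) (\<lambda>\<omega>. (X (fst \<omega>) (snd \<omega>), fst \<omega>)) = pent R + (\<Sum>r\<in>set_pmf R. pmf R r * ent (K r) (X r))"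
proof -
  have fin: "finite (set_pmf (mix R K))" by (rule finite_mix) (use assms in auto)
  have "ent (mix R K) (\<lambda>\<omega>. (X (fst \<omega>) (snd \<omega>), fst \<omega>)) = ent (mix R K) (\<lambda>\<omega>. (fst \<omega>, X (fst \<omega>) (snd \<omega>)))"
    by (rule ent_cong [OF fin]) auto
  also have "\<dots> = pent (mix R (\<lambda>r. map_pmf (X r) (K r)))"
    by (simp add: ent_def mix_def map_bind_pmf map_pmf_comp)
  also have "\<dots> = pent R + (\<Sum>r\<in>set_pmf R. pmf R r * ent (K r) (X r))"
    unfolding ent_def by (rule pent_mix) (use assms in auto)
  finally show ?thesis .
qed

text \<open>Forgetting the index of the mixture: the joint entropy of value and index is at most the
  sum of theirs, and the entropy of the index cancels.\<close>

lemma pent_concave: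
  assumes "finite (set_pmf R)" "\<And>r. r \<in> set_pmf R \<Longrightarrow> finite (set_pmf (K r))"
  shows "(\<Sum>r\<in>set_pmf R. pmf R r * pent (K r)) \<le> pent (bind_pmf R K)"
proof -
  have fin: "finite (set_pmf (mix R K))" by (rule finite_mix) (use assms in auto)
  have "ent (mix R K) (\<lambda>\<omega>. (snd \<omega>, fst \<omega>)) \<le> ent (mix R K) snd + ent (mix R K) fst"
    by (rule ent_subadd [OF fin])
  moreover have "ent (mix R K) fst = pent R" by (simp add: ent_def map_fst_mix)
  moreover have "ent (mix R K) snd = pent (bind_pmf R K)"
    using map_snd_mix [where f="\<lambda>_ w. w" and R=R and K=K] by (simp add: ent_def)
  moreover have "ent (mix R K) (\<lambda>\<omega>. (snd \<omega>, fst \<omega>)) = pent R + (\<Sum>r\<in>set_pmf R. pmf R r * pent (K r))"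
    using ent_mix [OF assms, where X="\<lambda>_ w. w"] by (simp add: ent_def)
  ultimately show ?thesis by simp
qed

text \<open>Meaningful only for values of positive probability; hence sums over fibres run over the
  image of the support.\<close>

definition fibre :: "'w pmf \<Rightarrow> ('w \<Rightarrow> 'v) \<Rightarrow> 'v \<Rightarrow> 'w pmf" where
  "fibre P V v = cond_pmf P {\<omega>. V \<omega> = v}"

lemma set_fibre:
  assumes "v \<in> V ` set_pmf P"
  shows "set_pmf (fibre P V v) = {\<omega> \<in> set_pmf P. V \<omega> = v}"
  unfolding fibre_def by (subst set_cond_pmf) (use assms in auto)

lemma mix_fibre: "mix (map_pmf V P) (fibre P V) = map_pmf (\<lambda>\<omega>. (V \<omega>, \<omega>)) P"
proof -
  have "map_pmf (\<lambda>\<omega>. (V \<omega>, \<omega>)) P = map_pmf (\<lambda>\<omega>. (V \<omega>, \<omega>)) (bind_pmf (map_pmf V P) (\<lambda>v. cond_pmf P {\<omega>. v = V \<omega>}))"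
    by (subst bind_cond_pmf_cancel [where R="\<lambda>v \<omega>. v = V \<omega>"])
      (auto simp: pmf_map vimage_def eq_commute)
  also have "\<dots> = mix (map_pmf V P) (fibre P V)"
    unfolding mix_def map_bind_pmf
  proof (rule bind_pmf_cong [OF refl])
    fix v assume "v \<in> set_pmf (map_pmf V P)"
    then have "v \<in> V ` set_pmf P" by simp
    then have "\<And>\<omega>. \<omega> \<in> set_pmf (fibre P V v) \<Longrightarrow> V \<omega> = v" by (simp add: set_fibre)
    moreover have "cond_pmf P {\<omega>. v = V \<omega>} = fibre P V v"
      unfolding fibre_def by (simp add: eq_commute)
    ultimately show "map_pmf (\<lambda>\<omega>. (V \<omega>, \<omega>)) (cond_pmf P {\<omega>. v = V \<omega>}) = map_pmf (Pair v) (fibre P V v)"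
      by (auto intro: map_pmf_cong)
  qed
  finally show ?thesis ..
qed

section \<open>Independent sums and the Ruzsa distance\<close>

definition conv :: "'g::ab_group_add pmf \<Rightarrow> 'g pmf \<Rightarrow> 'g pmf" where
  "conv p q = map_pmf (\<lambda>\<omega>. fst \<omega> + snd \<omega>) (pair_pmf p q)"

definition neg :: "'g::ab_group_add pmf \<Rightarrow> 'g pmf" where
  "neg p = map_pmf uminus p"

lemma set_conv: "set_pmf (conv p q) = (\<lambda>(x, y). x + y) ` (set_pmf p \<times> set_pmf q)"
  by (simp add: conv_def case_prod_beta)

lemma finite_conv [simp]: "finite (set_pmf p) \<Longrightarrow> finite (set_pmf q) \<Longrightarrow> finite (set_pmf (conv p q))"
  by (simp add: set_conv)

lemma set_neg: "set_pmf (neg p) = uminus ` set_pmf p"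
  by (simp add: neg_def)

lemma finite_neg [simp]: "finite (set_pmf p) \<Longrightarrow> finite (set_pmf (neg p))"
  by (simp add: set_neg)

lemma neg_neg [simp]: "neg (neg p) = p"
  by (simp add: neg_def map_pmf_comp)

lemma conv_commute: "conv p q = conv q p"
  unfolding conv_def by (subst pair_commute_pmf) (simp add: map_pmf_comp case_prod_beta add.commute)

lemma conv_map_pair:
  "conv (map_pmf f p) (map_pmf g q) = map_pmf (\<lambda>\<omega>. f (fst \<omega>) + g (snd \<omega>)) (pair_pmf p q)"
  unfolding conv_def map_pair [symmetric] by (simp add: map_pmf_comp case_prod_beta)

lemma neg_conv: "neg (conv p q) = conv (neg p) (neg q)"
  unfolding neg_def conv_map_pair by (simp add: conv_def map_pmf_comp)

lemma conv_assoc: "conv (conv p q) r = conv p (conv q r)"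
proof -
  have "conv (conv p q) r = map_pmf (\<lambda>\<omega>. (fst (fst \<omega>) + snd (fst \<omega>)) + snd \<omega>) (pair_pmf (pair_pmf p q) r)"
    using conv_map_pair [of "\<lambda>\<omega>. fst \<omega> + snd \<omega>" "pair_pmf p q" "\<lambda>x. x" r] by (simp add: conv_def)
  also have "\<dots> = map_pmf (\<lambda>\<omega>. fst \<omega> + (fst (snd \<omega>) + snd (snd \<omega>))) (pair_pmf p (pair_pmf q r))"
    by (simp add: pair_pair_pmf map_pmf_comp case_prod_beta add.assoc)
  also have "\<dots> = conv p (conv q r)"
    using conv_map_pair [of "\<lambda>x. x" p "\<lambda>\<omega>. fst \<omega> + snd \<omega>" "pair_pmf q r"] by (simp add: conv_def)
  finally show ?thesis .
qed

lemma conv_return_0: "conv p (return_pmf 0) = p"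
  by (simp add: conv_def pair_return_pmf2 map_pmf_comp)

interpretation conv: comm_monoid_set conv "return_pmf 0 :: 'g::ab_group_add pmf"
proof
  show "conv (conv a b) c = conv a (conv b c)" for a b c :: "'g pmf" by (rule conv_assoc)
  show "conv a b = conv b a" for a b :: "'g pmf" by (rule conv_commute)
  show "conv a (return_pmf 0) = a" for a :: "'g pmf" by (rule conv_return_0)
qed

text \<open>The law of a sum of independent variables with laws \<open>p i\<close>. Treating
  \<open>conv\<close> as a commutative monoid supplies reindexing and splitting rules without any
  product space.\<close>

abbreviation sumlaw :: "('i \<Rightarrow> 'g::ab_group_add pmf) \<Rightarrow> 'i set \<Rightarrow> 'g pmf" where
  "sumlaw \<equiv> conv.F"

lemma finite_sumlaw [simp]:
  assumes "\<And>i. i \<in> I \<Longrightarrow> finite (set_pmf (p i))"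
  shows "finite (set_pmf (sumlaw p I))"
  using assms by (induction I rule: infinite_finite_induct) auto

lemma pent_map_inj: "inj_on f (set_pmf p) \<Longrightarrow> pent (map_pmf f p) = pent p"
  by (simp add: pent_def sum.reindex pmf_map_inj)

lemma pent_neg [simp]: "pent (neg p) = pent p"
  unfolding neg_def by (rule pent_map_inj) (simp add: inj_on_def)

lemma ent_pair:
  assumes "finite (set_pmf p)" "finite (set_pmf q)"
  shows "ent (pair_pmf p q) (\<lambda>\<omega>. (f (fst \<omega>), g (snd \<omega>))) = ent p f + ent q g"
proof -
  have *: "map_pmf (\<lambda>\<omega>. f (fst \<omega>)) (pair_pmf p q) = map_pmf f p" 
    "map_pmf (\<lambda>\<omega>. g (snd \<omega>)) (pair_pmf p q) = map_pmf g q"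
    by (simp_all add: map_pmf_comp [symmetric] map_fst_pair_pmf map_snd_pair_pmf)
  have "ent (pair_pmf p q) (\<lambda>\<omega>. (f (fst \<omega>), g (snd \<omega>))) =
      ent (pair_pmf p q) (\<lambda>\<omega>. f (fst \<omega>)) + ent (pair_pmf p q) (\<lambda>\<omega>. g (snd \<omega>))"
  proof (rule ent_indep)
    show "map_pmf (\<lambda>\<omega>. (f (fst \<omega>), g (snd \<omega>))) (pair_pmf p q) =
       pair_pmf (map_pmf (\<lambda>\<omega>. f (fst \<omega>)) (pair_pmf p q)) (map_pmf (\<lambda>\<omega>. g (snd \<omega>)) (pair_pmf p q))"
      unfolding * map_pair [symmetric] by (simp add: split_def)
  qed (use assms in simp)
  then show ?thesis by (simp add: ent_def *)
qed

lemma ent_fst: "ent (pair_pmf p q) (\<lambda>\<omega>. f (fst \<omega>)) = ent p f"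
  by (simp add: ent_def map_pmf_comp [symmetric] map_fst_pair_pmf)

lemma ent_snd: "ent (pair_pmf p q) (\<lambda>\<omega>. f (snd \<omega>)) = ent q f"
  by (simp add: ent_def map_pmf_comp [symmetric] map_snd_pair_pmf)

lemma ent_id: "ent p (\<lambda>x. x) = pent p"
  by (simp add: ent_def)

lemma ent_fst' [simp]: "ent (pair_pmf p q) fst = pent p"
  using ent_fst [of p q "\<lambda>x. x"] by (simp add: ent_id)

lemma ent_snd' [simp]: "ent (pair_pmf p q) snd = pent q"
  using ent_snd [of p q "\<lambda>x. x"] by (simp add: ent_id)

lemma pent_conv: "pent (conv p q) = ent (pair_pmf p q) (\<lambda>\<omega>. fst \<omega> + snd \<omega>)"
  by (simp add: ent_def conv_def)

text \<open>Given the second summand, the sum and the first summand determine each other.\<close>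

lemma pent_conv_ge:
  assumes fin: "finite (set_pmf p)" "finite (set_pmf q)"
  shows "pent p \<le> pent (conv p q)"
proof -
  let ?P = "pair_pmf p q"
  have F: "finite (set_pmf ?P)" using fin by simp
  have "ent ?P (\<lambda>\<omega>. (fst \<omega>, snd \<omega>)) = pent p + pent q"
    using ent_pair [OF fin, of "\<lambda>x. x" "\<lambda>x. x"] by (simp add: ent_id)
  moreover have "ent ?P (\<lambda>\<omega>. (fst \<omega>, snd \<omega>)) = ent ?P (\<lambda>\<omega>. (fst \<omega> + snd \<omega>, snd \<omega>))"
    by (rule ent_cong [OF F]) auto
  moreover have "\<dots> \<le> ent ?P (\<lambda>\<omega>. fst \<omega> + snd \<omega>) + ent ?P (\<lambda>\<omega>. snd \<omega>)"
    by (rule ent_subadd [OF F])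
  ultimately show ?thesis by (simp add: pent_conv)
qed

lemma pent_conv_ge': 
  assumes "finite (set_pmf p)" "finite (set_pmf q)"
  shows "pent q \<le> pent (conv p q)"
  using pent_conv_ge [OF assms(2,1)] by (simp add: conv_commute)

text \<open>Submodularity for Y and Z given the total U = X + Y + Z. The triple (Y, Z, U) determines
  all three independent variables, whereas (Y, U) is equivalent to (Y, X + Z) and (Z, U) to (Z, X +
  Y).\<close>

lemma kaimanovich_vershik_madiman:
  assumes fin: "finite (set_pmf p)" "finite (set_pmf q)" "finite (set_pmf r)"
  shows "pent (conv (conv p q) r) + pent p \<le> pent (conv p q) + pent (conv p r)"
proof -
  let ?P = "pair_pmf p (pair_pmf q r)"
  have F: "finite (set_pmf ?P)" using fin by simp
  have F2: "finite (set_pmf (pair_pmf q r))" using fin by simp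
  let ?X = "\<lambda>\<omega>. fst \<omega>" and ?Y = "\<lambda>\<omega>. fst (snd \<omega>)" and ?Z = "\<lambda>\<omega>. snd (snd \<omega>)"
  let ?U = "\<lambda>\<omega>. fst \<omega> + fst (snd \<omega>) + snd (snd \<omega>)"
  have "ent ?P (\<lambda>\<omega>. (?Y \<omega>, ?Z \<omega>, ?U \<omega>)) + ent ?P ?U \<le> ent ?P (\<lambda>\<omega>. (?Y \<omega>, ?U \<omega>)) + ent ?P (\<lambda>\<omega>. (?Z \<omega>, ?U \<omega>))"
    by (rule ent_submod [OF F])
  moreover have "ent ?P ?U = pent (conv (conv p q) r)"
  proof -
    have "conv (conv p q) r = conv (map_pmf (\<lambda>x. x) p) (map_pmf (\<lambda>\<omega>. fst \<omega> + snd \<omega>) (pair_pmf q r))"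
      by (subst conv_assoc) (simp add: conv_def [of q r])
    also have "\<dots> = map_pmf ?U ?P" unfolding conv_map_pair by (simp add: add.assoc)
    finally show ?thesis by (simp add: ent_def)
  qed
  moreover have "ent ?P (\<lambda>\<omega>. (?Y \<omega>, ?Z \<omega>, ?U \<omega>)) = pent p + (pent q + pent r)"
  proof -
    have "ent ?P (\<lambda>\<omega>. (?Y \<omega>, ?Z \<omega>, ?U \<omega>)) = ent ?P (\<lambda>\<omega>. (fst \<omega>, (\<lambda>\<omega>. (fst \<omega>, snd \<omega>)) (snd \<omega>)))"
      by (rule ent_cong [OF F]) auto
    also have "\<dots> = pent p + (pent q + pent r)"
      using ent_pair [OF fin(1) F2, of "\<lambda>x. x"  "\<lambda>\<omega>. (fst \<omega>, snd \<omega>)"] ent_pair [OF fin(2,3), of "\<lambda>x. x" "\<lambda>x. x"]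
      by (simp add: ent_id)
    finally show ?thesis .
  qed
  moreover have "ent ?P (\<lambda>\<omega>. (?Y \<omega>, ?U \<omega>)) \<le> pent q + pent (conv p r)"
  proof -
    have "ent ?P (\<lambda>\<omega>. (?Y \<omega>, ?U \<omega>)) = ent ?P (\<lambda>\<omega>. (?Y \<omega>, ?X \<omega> + ?Z \<omega>))"
      by (rule ent_cong [OF F]) (auto simp: algebra_simps)
    also have "\<dots> \<le> ent ?P ?Y + ent ?P (\<lambda>\<omega>. ?X \<omega> + ?Z \<omega>)" by (rule ent_subadd [OF F])
    also have "ent ?P ?Y = pent q"
      using ent_snd [of p "pair_pmf q r" fst] ent_fst [of q r "\<lambda>x. x"] by (simp add: ent_id)
    also have "map_pmf (\<lambda>\<omega>. ?X \<omega> + ?Z \<omega>) ?P = conv p r"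
      using conv_map_pair [of "\<lambda>x. x" p snd "pair_pmf q r"] by (simp add: map_snd_pair_pmf)
    then have "ent ?P (\<lambda>\<omega>. ?X \<omega> + ?Z \<omega>) = pent (conv p r)" by (simp add: ent_def)
    finally show ?thesis .
  qed
  moreover have "ent ?P (\<lambda>\<omega>. (?Z \<omega>, ?U \<omega>)) \<le> pent r + pent (conv p q)"
  proof -
    have "ent ?P (\<lambda>\<omega>. (?Z \<omega>, ?U \<omega>)) = ent ?P (\<lambda>\<omega>. (?Z \<omega>, ?X \<omega> + ?Y \<omega>))"
      by (rule ent_cong [OF F]) (auto simp: algebra_simps)
    also have "\<dots> \<le> ent ?P ?Z + ent ?P (\<lambda>\<omega>. ?X \<omega> + ?Y \<omega>)" by (rule ent_subadd [OF F])
    also have "ent ?P ?Z = pent r"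
      using ent_snd [of p "pair_pmf q r" snd] ent_snd [of q r "\<lambda>x. x"] by (simp add: ent_id)
    also have "map_pmf (\<lambda>\<omega>. ?X \<omega> + ?Y \<omega>) ?P = conv p q"
      using conv_map_pair [of "\<lambda>x. x" p fst "pair_pmf q r"] by (simp add: map_fst_pair_pmf)
    then have "ent ?P (\<lambda>\<omega>. ?X \<omega> + ?Y \<omega>) = pent (conv p q)" by (simp add: ent_def)
    finally show ?thesis .
  qed
  ultimately show ?thesis by simp
qed

text \<open>By \<open>kaimanovich_vershik_madiman\<close> each further summand costs at most what it
  costs when added to \<open>p\<close> alone.\<close>

lemma pent_conv_sumlaw_le:
  assumes fin: "finite I" "finite (set_pmf p)" "\<And>i. i \<in> I \<Longrightarrow> finite (set_pmf (q i))"
  shows "pent (conv p (sumlaw q I)) - pent p \<le> (\<Sum>i\<in>I. pent (conv p (q i)) - pent p)"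
  using fin(1,3)
proof (induction I)
  case empty
  then show ?case by (simp add: conv_return_0)
next
  case (insert i I)
  have "pent (conv (conv p (sumlaw q I)) (q i)) + pent p \<le> pent (conv p (sumlaw q I)) + pent (conv p (q i))"
    by (intro kaimanovich_vershik_madiman finite_sumlaw fin(2)) (use insert in auto)
  moreover have "conv p (sumlaw q (insert i I)) = conv (conv p (sumlaw q I)) (q i)"
    using insert by (simp add: conv.left_commute conv_commute)
  moreover have "pent (conv p (sumlaw q I)) - pent p \<le> (\<Sum>i\<in>I. pent (conv p (q i)) - pent p)"
    using insert by auto
  ultimately show ?case using insert by simp
qed

section \<open>Ruzsa distance and its triangle inequality\<close>

definition rdist :: "'g::ab_group_add pmf \<Rightarrow> 'g pmf \<Rightarrow> real" where
  "rdist p q = pent (conv p (neg q)) - pent p / 2 - pent q / 2"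

lemma rdist_commute: "rdist p q = rdist q p"
proof -
  have "pent (conv p (neg q)) = pent (neg (conv q (neg p)))"
    by (simp only: neg_conv neg_neg conv_commute)
  then show ?thesis by (simp add: rdist_def)
qed

lemma rdist_neg_neg: "rdist (neg p) (neg q) = rdist p q"
proof -
  have "pent (conv (neg p) q) = pent (neg (conv p (neg q)))"
    by (simp only: neg_conv neg_neg)
  then show ?thesis by (simp add: rdist_def)
qed

lemma rdist_nonneg:
  assumes "finite (set_pmf p)" "finite (set_pmf q)"
  shows "rdist p q \<ge> 0"
  using pent_conv_ge [of p "neg q"] pent_conv_ge' [of p "neg q"] assms by (simp add: rdist_def)

text \<open>The Ruzsa triangle inequality with dependent outer variables X and Z; only the middle
  variable Y is independent of them. \<open>pent_dilate_le\<close> needs this generality.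
  Submodularity is applied to (X - Y, Y - Z) and (X, Z), both of which determine X - Z.\<close>

lemma pent_diff_le:
  fixes s :: "('g::ab_group_add \<times> 'g) pmf"
  assumes fin: "finite (set_pmf s)" "finite (set_pmf p)"
  shows "pent (map_pmf (\<lambda>\<omega>. fst \<omega> - snd \<omega>) s) + pent p \<le>
    pent (conv (map_pmf fst s) (neg p)) + pent (conv p (neg (map_pmf snd s)))"
proof -
  let ?P = "pair_pmf s p"
  have F: "finite (set_pmf ?P)" using fin by simp
  let ?X = "\<lambda>\<omega>. fst (fst \<omega>)" and ?Z = "\<lambda>\<omega>. snd (fst \<omega>)" and ?Y = "\<lambda>\<omega>. snd \<omega>"
  have "ent ?P (\<lambda>\<omega>. ((?X \<omega> - ?Y \<omega>, ?Y \<omega> - ?Z \<omega>), (?X \<omega>, ?Z \<omega>), ?X \<omega> - ?Z \<omega>)) + ent ?P (\<lambda>\<omega>. ?X \<omega> - ?Z \<omega>)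
    \<le> ent ?P (\<lambda>\<omega>. ((?X \<omega> - ?Y \<omega>, ?Y \<omega> - ?Z \<omega>), ?X \<omega> - ?Z \<omega>)) + ent ?P (\<lambda>\<omega>. ((?X \<omega>, ?Z \<omega>), ?X \<omega> - ?Z \<omega>))"
    by (rule ent_submod [OF F])
  moreover have "ent ?P (\<lambda>\<omega>. ((?X \<omega> - ?Y \<omega>, ?Y \<omega> - ?Z \<omega>), (?X \<omega>, ?Z \<omega>), ?X \<omega> - ?Z \<omega>)) = ent ?P (\<lambda>\<omega>. (fst \<omega>, snd \<omega>))"
    by (rule ent_cong [OF F]) (auto simp: prod_eq_iff)
  moreover have "ent ?P (\<lambda>\<omega>. (fst \<omega>, snd \<omega>)) = pent s + pent p"
    using ent_pair [OF fin, of "\<lambda>x. x" "\<lambda>x. x"] by (simp add: ent_id)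
  moreover have "ent ?P (\<lambda>\<omega>. ?X \<omega> - ?Z \<omega>) = pent (map_pmf (\<lambda>\<omega>. fst \<omega> - snd \<omega>) s)"
    using ent_fst [of s p "\<lambda>\<omega>. fst \<omega> - snd \<omega>"] by (simp add: ent_def)
  moreover have "ent ?P (\<lambda>\<omega>. ((?X \<omega>, ?Z \<omega>), ?X \<omega> - ?Z \<omega>)) = ent ?P (\<lambda>\<omega>. fst \<omega>)"
    by (rule ent_cong [OF F]) (auto simp: prod_eq_iff)
  moreover have "ent ?P (\<lambda>\<omega>. fst \<omega>) = pent s"
    using ent_fst [of s p "\<lambda>x. x"] by (simp add: ent_id)
  moreover have "ent ?P (\<lambda>\<omega>. ((?X \<omega> - ?Y \<omega>, ?Y \<omega> - ?Z \<omega>), ?X \<omega> - ?Z \<omega>)) = ent ?P (\<lambda>\<omega>. (?X \<omega> - ?Y \<omega>, ?Y \<omega> - ?Z \<omega>))"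
  proof (rule ent_cong [OF F])
    fix \<omega> \<omega>' :: "('g \<times> 'g) \<times> 'g"
    have "?X \<omega> - ?Z \<omega> = (?X \<omega> - ?Y \<omega>) + (?Y \<omega> - ?Z \<omega>)" for \<omega> :: "('g \<times> 'g) \<times> 'g" by simp
    then show "((?X \<omega> - ?Y \<omega>, ?Y \<omega> - ?Z \<omega>) = (?X \<omega>' - ?Y \<omega>', ?Y \<omega>' - ?Z \<omega>')) =
      (((?X \<omega> - ?Y \<omega>, ?Y \<omega> - ?Z \<omega>), ?X \<omega> - ?Z \<omega>) = ((?X \<omega>' - ?Y \<omega>', ?Y \<omega>' - ?Z \<omega>'), ?X \<omega>' - ?Z \<omega>'))"
      by (metis prod.inject)
  qed
  moreover have "ent ?P (\<lambda>\<omega>. (?X \<omega> - ?Y \<omega>, ?Y \<omega> - ?Z \<omega>)) \<le> ent ?P (\<lambda>\<omega>. ?X \<omega> - ?Y \<omega>) + ent ?P (\<lambda>\<omega>. ?Y \<omega> - ?Z \<omega>)"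
    by (rule ent_subadd [OF F])
  moreover have "ent ?P (\<lambda>\<omega>. ?X \<omega> - ?Y \<omega>) = pent (conv (map_pmf fst s) (neg p))"
    by (simp add: neg_def conv_map_pair ent_def)
  moreover have "ent ?P (\<lambda>\<omega>. ?Y \<omega> - ?Z \<omega>) = pent (conv p (neg (map_pmf snd s)))"
  proof -
    have "conv (neg (map_pmf snd s)) p = map_pmf (\<lambda>\<omega>. ?Y \<omega> - ?Z \<omega>) ?P"
      using conv_map_pair [of "\<lambda>\<omega>. - snd \<omega>" s "\<lambda>x. x" p] by (simp add: neg_def map_pmf_comp)
    then show ?thesis by (simp add: ent_def conv_commute)
  qed
  ultimately show ?thesis by linarith
qed

lemma pent_conv_neg_triangle:
  assumes "finite (set_pmf p)" "finite (set_pmf q)" "finite (set_pmf r)"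
  shows "pent (conv p (neg r)) + pent q \<le> pent (conv p (neg q)) + pent (conv q (neg r))"
proof -
  have "conv p (neg r) = map_pmf (\<lambda>\<omega>. fst \<omega> - snd \<omega>) (pair_pmf p r)"
    using conv_map_pair [of "\<lambda>x. x" p uminus r] by (simp add: neg_def)
  with pent_diff_le [of "pair_pmf p r" q] assms show ?thesis
    by (simp add: map_fst_pair_pmf map_snd_pair_pmf)
qed

lemma rdist_triangle:
  assumes "finite (set_pmf p)" "finite (set_pmf q)" "finite (set_pmf r)"
  shows "rdist p r \<le> rdist p q + rdist q r"
  using pent_conv_neg_triangle [OF assms] by (simp add: rdist_def)

text \<open>A sum is controlled by differences: H(X' + X'') is at most H(X - X' - X''), and each of
  the two subtractions from X costs d[X;X].\<close>

lemma rdist_neg_self_le: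
  assumes "finite (set_pmf p)"
  shows "pent (conv p p) - pent p \<le> 2 * rdist p p"
proof -
  have "pent (conv (conv p (neg p)) (neg p)) + pent p \<le> pent (conv p (neg p)) + pent (conv p (neg p))"
    by (rule kaimanovich_vershik_madiman) (use assms in auto)
  moreover have "pent (conv p p) \<le> pent (conv (conv p (neg p)) (neg p))"
    using pent_conv_ge' [of p "neg (conv p p)"] assms unfolding neg_conv conv_assoc
    by (simp add: neg_conv [symmetric])
  ultimately show ?thesis by (simp add: rdist_def)
qed

section \<open>Multidistance\<close>

definition mdist :: "nat \<Rightarrow> (nat \<Rightarrow> 'g::ab_group_add pmf) \<Rightarrow> real" where
  "mdist m X = pent (sumlaw X {..<m}) - (\<Sum>i<m. pent (X i)) / real m"

lemma mdist_permute:
  assumes "bij_betw \<phi> {..<m} {..<m}"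
  shows "mdist m (\<lambda>i. X (\<phi> i)) = mdist m X"
  using conv.reindex_bij_betw [OF assms, of X] sum.reindex_bij_betw [OF assms, of "\<lambda>i. pent (X i)"]
  by (simp add: mdist_def)

lemma neg_sumlaw:
  fixes X :: "'i \<Rightarrow> 'g::ab_group_add pmf"
  shows "neg (sumlaw X A) = sumlaw (\<lambda>i. neg (X i)) A"
proof -
  have "neg (return_pmf 0) = (return_pmf 0 :: 'g pmf)" by (simp add: neg_def)
  then show ?thesis by (induction A rule: infinite_finite_induct) (auto simp: neg_conv)
qed

lemma pent_sumlaw_mono:
  assumes "finite B" "A \<subseteq> B" "\<And>i. i \<in> B \<Longrightarrow> finite (set_pmf (X i))"
  shows "pent (sumlaw X A) \<le> pent (sumlaw X B)"
proof -
  have "sumlaw X B = conv (sumlaw X (B - A)) (sumlaw X A)"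
    by (rule conv.subset_diff [OF assms(2,1)])
  then show ?thesis
    using assms(2,3) by (auto intro!: pent_conv_ge' finite_sumlaw)
qed

lemma bij_betw_shift_mod: "bij_betw (\<lambda>j. (j + 1) mod m) {..<m} {..<m::nat}"
proof (cases "m = 0")
  case False
  have "inj_on (\<lambda>j. (j + 1) mod m) {..<m}"
  proof (rule inj_onI)
    fix x y assume "x \<in> {..<m}" "y \<in> {..<m}" "(x + 1) mod m = (y + 1) mod m"
    then show "x = y" by (auto simp: mod_Suc split: if_splits)
  qed
  moreover have "(\<lambda>j. (j + 1) mod m) ` {..<m} \<subseteq> {..<m}" using False by auto
  ultimately show ?thesis
    unfolding bij_betw_def by (simp add: endo_inj_surj)
qed simp

text \<open>Finiteness is assumed for every index, also beyond \<open>m\<close>, so that the lemmas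
  carry no index condition for it.\<close>

locale tuple =
  fixes m :: nat and X :: "nat \<Rightarrow> 'g::ab_group_add pmf"
  assumes m: "m \<ge> 2" and fin: "\<And>i. finite (set_pmf (X i))"
begin

abbreviation "Q \<equiv> sumlaw X {..<m}"
abbreviation "D \<equiv> mdist m X"

lemma fin_Q [simp]: "finite (set_pmf Q)"
  using fin by simp

lemma pent_le_Q: "i < m \<Longrightarrow> pent (X i) \<le> pent Q"
  using pent_sumlaw_mono [of "{..<m}" "{i}" X] fin by simp

lemma pent_pair_le_Q:
  assumes "i < m" "j < m" "i \<noteq> j"
  shows "pent (conv (X i) (X j)) \<le> pent Q"
  using pent_sumlaw_mono [of "{..<m}" "{i, j}" X] fin assms by simp

text \<open>The excesses H(Q) - H(X_i) are nonnegative; most estimates below distribute their total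
  m D.\<close>

lemma sum_diff_Q: "(\<Sum>i<m. pent Q - pent (X i)) = m * D"
  using m by (simp add: sum_subtractf mdist_def field_simps)

lemma D_nonneg: "D \<ge> 0"
proof -
  have "(\<Sum>i<m. pent Q - pent (X i)) \<ge> 0"
    by (rule sum_nonneg) (simp add: pent_le_Q)
  then show ?thesis using m by (simp add: sum_diff_Q zero_le_mult_iff)
qed

lemma Q_diff_le:
  assumes "i < m"
  shows "pent Q - pent (X i) \<le> m * D"
proof -
  have "pent Q - pent (X i) \<le> (\<Sum>i<m. pent Q - pent (X i))"
    by (rule member_le_sum [where f="\<lambda>i. pent Q - pent (X i)"]) (use assms pent_le_Q in auto)
  then show ?thesis by (simp add: sum_diff_Q)
qed

text \<open>The sign turns the difference into X_i + X_j, a partial sum of Q when the indices are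
  distinct.\<close>

lemma rdist_neg_le:
  assumes "i < m" "j < m" "i \<noteq> j"
  shows "rdist (X i) (neg (X j)) \<le> m * D"
  using pent_pair_le_Q [OF assms] Q_diff_le [of i] Q_diff_le [of j] assms by (simp add: rdist_def)

lemma sum_shift: "(\<Sum>j<m. f ((j + 1) mod m)) = (\<Sum>j<m. (f j :: real))"
  by (rule sum.reindex_bij_betw [OF bij_betw_shift_mod])

lemma shift: "j < m \<Longrightarrow> (j + 1) mod m < m" "j < m \<Longrightarrow> j \<noteq> (j + 1) mod m"
  using m by (auto simp: mod_Suc)

text \<open>X_j is compared with itself through -X_k for the cyclic neighbour k = j + 1, which
  differs from j because m is at least 2. Each excess H(Q) - H(X_i) is then used exactly
  twice.\<close>

lemma sum_rdist_self_le: "(\<Sum>j<m. rdist (X j) (X j)) \<le> 2 * m * D"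
proof -
  have "(\<Sum>j<m. rdist (X j) (X j)) \<le> (\<Sum>j<m. (pent Q - pent (X j)) + (pent Q - pent (X ((j + 1) mod m))))"
  proof (rule sum_mono)
    fix j assume "j \<in> {..<m}"
    then have j: "j < m" by simp
    let ?k = "(j + 1) mod m"
    have "rdist (X j) (X j) \<le> rdist (X j) (neg (X ?k)) + rdist (neg (X ?k)) (X j)"
      by (rule rdist_triangle) (use fin in auto)
    also have "\<dots> = 2 * rdist (X j) (neg (X ?k))" by (simp add: rdist_commute)
    also have "\<dots> \<le> (pent Q - pent (X j)) + (pent Q - pent (X ?k))"
      using pent_pair_le_Q [OF j shift [OF j]] by (simp add: rdist_def)
    finally show "rdist (X j) (X j) \<le> (pent Q - pent (X j)) + (pent Q - pent (X ?k))" .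
  qed
  also have "\<dots> = (\<Sum>j<m. pent Q - pent (X j)) + (\<Sum>j<m. pent Q - pent (X ((j + 1) mod m)))"
    by (rule sum.distrib)
  also have "\<dots> = 2 * m * D"
    by (simp only: sum_shift [of "\<lambda>j. pent Q - pent (X j)"] sum_diff_Q)
  finally show ?thesis .
qed

text \<open>The summands of the second Q are added one at a time. Adding X_l to Q costs no more than
  adding it to the summand X_k of Q, k = l + 1 modulo m, and X_k + X_l is again a partial sum of
  Q.\<close>

lemma pent_Q_Q: "pent (conv Q Q) - pent Q \<le> m * D"
proof -
  have "pent (conv Q Q) - pent Q \<le> (\<Sum>l<m. pent (conv Q (X l)) - pent Q)"
    by (rule pent_conv_sumlaw_le) (use fin in auto)
  also have "\<dots> \<le> (\<Sum>l<m. pent Q - pent (X ((l + 1) mod m)))"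
  proof (rule sum_mono)
    fix l assume "l \<in> {..<m}"
    then have l: "l < m" by simp
    let ?k = "(l + 1) mod m"
    have Q: "Q = conv (X ?k) (sumlaw X ({..<m} - {?k}))"
      by (rule conv.remove) (use shift [OF l] in auto)
    have "pent (conv (conv (X ?k) (sumlaw X ({..<m} - {?k}))) (X l)) + pent (X ?k)
       \<le> pent (conv (X ?k) (sumlaw X ({..<m} - {?k}))) + pent (conv (X ?k) (X l))"
      by (rule kaimanovich_vershik_madiman) (use fin in auto)
    then have "pent (conv Q (X l)) + pent (X ?k) \<le> pent Q + pent (conv (X ?k) (X l))"
      unfolding Q [symmetric] by simp
    moreover have "pent (conv (X ?k) (X l)) \<le> pent Q"
      by (rule pent_pair_le_Q) (use shift [OF l] l in auto)
    ultimately show "pent (conv Q (X l)) - pent Q \<le> pent Q - pent (X ?k)" by simp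
  qed
  also have "\<dots> = m * D"
    by (simp only: sum_shift [of "\<lambda>j. pent Q - pent (X j)"] sum_diff_Q)
  finally show ?thesis .
qed

end

section \<open>Sums of identically distributed variables and integer dilates\<close>

lemma pent_sumlaw_iid_le:
  assumes "finite (set_pmf p)"
  shows "pent (sumlaw (\<lambda>_. p) {..<Suc n}) - pent p \<le> n * (pent (conv p p) - pent p)"
proof -
  have "sumlaw (\<lambda>_. p) {..<Suc n} = conv p (sumlaw (\<lambda>_. p) {..<n})"
    by (simp add: lessThan_Suc)
  with pent_conv_sumlaw_le [of "{..<n}" p "\<lambda>_. p"] assms show ?thesis by simp
qed

text \<open>Comparing with an extra independent copy turns the sum into X_0 - X_1 - ... - X_m, where
  each subtraction costs d[p;p]; this avoids the factor 2 of
  \<open>rdist_neg_self_le\<close>.\<close>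

lemma mdist_iid_le:
  assumes "finite (set_pmf p)" "m > 0"
  shows "pent (sumlaw (\<lambda>_. p) {..<m}) - pent p \<le> m * rdist p p" "mdist m (\<lambda>_. p) \<le> m * rdist p p"
proof -
  have "pent (conv p (sumlaw (\<lambda>_. neg p) {..<m})) - pent p \<le> m * rdist p p"
    using pent_conv_sumlaw_le [of "{..<m}" p "\<lambda>_. neg p"] assms by (simp add: rdist_def)
  moreover have "pent (sumlaw (\<lambda>_. p) {..<m}) = pent (sumlaw (\<lambda>_. neg p) {..<m})"
    by (simp only: neg_sumlaw [of "\<lambda>_. p", symmetric] pent_neg)
  moreover have "\<dots> \<le> pent (conv p (sumlaw (\<lambda>_. neg p) {..<m}))"
    by (rule pent_conv_ge') (use assms in auto)
  ultimately show "pent (sumlaw (\<lambda>_. p) {..<m}) - pent p \<le> m * rdist p p" by simp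
  then show "mdist m (\<lambda>_. p) \<le> m * rdist p p" using assms by (simp add: mdist_def)
qed

primrec smul :: "nat \<Rightarrow> 'g::ab_group_add \<Rightarrow> 'g" where
  "smul 0 x = 0"
| "smul (Suc n) x = x + smul n x"

lemma smul_add: "smul n (x + y) = smul n x + smul n y"
  by (induction n) (auto simp: algebra_simps)

lemma smul_0_right [simp]: "smul n 0 = 0"
  by (induction n) auto

lemma smul_sum: "smul n (sum f A) = (\<Sum>a\<in>A. smul n (f a))"
  by (induction A rule: infinite_finite_induct) (auto simp: smul_add)

lemma smul_add_left: "smul (a + b) x = smul a x + smul b x"
  by (induction a) (auto simp: algebra_simps)

lemma smul_mult_left: "smul (a * b) x = smul a (smul b x)"
  by (induction a) (auto simp: smul_add_left)

lemma smul_mod: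
  assumes "smul m x = 0"
  shows "smul (a mod m) x = smul a x"
proof -
  have "smul a x = smul ((a div m) * m + a mod m) x" by simp
  also have "\<dots> = smul (a mod m) x" by (simp only: smul_add_left smul_mult_left assms smul_0_right add_0)
  finally show ?thesis ..
qed

text \<open>X - (a + 1) Y is the difference of the dependent variables X - Y and a Y, so
  \<open>pent_diff_le\<close> through an independent copy of X peels off one Y at a time. The loss
  is linear in a.\<close>

lemma pent_dilate_le:
  assumes "finite (set_pmf p)" "finite (set_pmf q)"
  shows "pent (conv p (neg (map_pmf (smul a) q))) - pent p
     \<le> a * (pent (conv (conv p (neg p)) (neg q)) - pent p)"
proof (induction a)
  case 0
  then show ?case by (simp add: neg_def conv_return_0)
next
  case (Suc a)
  let ?s = "map_pmf (\<lambda>\<omega>. (fst \<omega> - snd \<omega>, smul a (snd \<omega>))) (pair_pmf p q)"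
  have "pent (map_pmf (\<lambda>\<omega>. fst \<omega> - snd \<omega>) ?s) + pent p \<le>
    pent (conv (map_pmf fst ?s) (neg p)) + pent (conv p (neg (map_pmf snd ?s)))"
    by (rule pent_diff_le) (use assms in auto)
  moreover have "map_pmf (\<lambda>\<omega>. fst \<omega> - snd \<omega>) ?s = conv p (neg (map_pmf (smul (Suc a)) q))"
    using conv_map_pair [of "\<lambda>x. x" p "\<lambda>y. - smul (Suc a) y" q]
    by (simp add: neg_def map_pmf_comp algebra_simps)
  moreover have "map_pmf fst ?s = conv p (neg q)"
    using conv_map_pair [of "\<lambda>x. x" p uminus q] by (simp add: neg_def map_pmf_comp)
  moreover have "map_pmf snd ?s = map_pmf (smul a) q"
    by (simp add: map_pmf_comp map_pmf_comp [of "smul a" snd, symmetric] map_snd_pair_pmf)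
  moreover have "conv (conv p (neg q)) (neg p) = conv (conv p (neg p)) (neg q)"
    by (simp add: conv.assoc conv.left_commute conv.commute)
  ultimately show ?case using Suc by (simp del: smul.simps add: algebra_simps)
qed

context tuple
begin

text \<open>The law of the sum of the j Q_j for independent copies Q_j of Q. \<open>Z2_law\<close>
  identifies it with the law of \<open>Z2\<close>, where Q_j is the sum of column j.\<close>

abbreviation "Zlaw \<equiv> sumlaw (\<lambda>j. map_pmf (smul j) Q) {..<m}"

text \<open>Two uses of \<open>kaimanovich_vershik_madiman\<close>: first X_i and Q are subtracted
  from X_i separately; then the cost of subtracting X_i from Q is compared with that of subtracting
  it from the summand X_i of Q.\<close>

lemma pent_diff_diff_le:
  assumes i: "i < m"
  shows "pent (conv (conv (X i) (neg (X i))) (neg Q)) - pent (X i)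
    \<le> 2 * rdist (X i) (X i) + (pent Q - pent (X i))"
proof -
  have "pent (conv (conv (X i) (neg (X i))) (neg Q)) + pent (X i)
     \<le> pent (conv (X i) (neg (X i))) + pent (conv (X i) (neg Q))"
    by (rule kaimanovich_vershik_madiman) (use fin in auto)
  moreover have "pent (conv (X i) (neg Q)) = pent (conv Q (neg (X i)))"
    using pent_neg [of "conv (X i) (neg Q)"] by (simp add: neg_conv conv_commute)
  moreover have Q: "Q = conv (X i) (sumlaw X ({..<m} - {i}))"
    by (rule conv.remove) (use i in auto)
  have "pent (conv (conv (X i) (sumlaw X ({..<m} - {i}))) (neg (X i))) + pent (X i)
      \<le> pent (conv (X i) (sumlaw X ({..<m} - {i}))) + pent (conv (X i) (neg (X i)))"
    by (rule kaimanovich_vershik_madiman) (use fin in auto)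
  then have "pent (conv Q (neg (X i))) + pent (X i) \<le> pent Q + pent (conv (X i) (neg (X i)))"
    unfolding Q [symmetric] by simp
  ultimately show ?thesis by (simp add: rdist_def)
qed

text \<open>The weights contribute 0 + ... + (m - 1), at most m^2 / 2, and the bounds of
  \<open>pent_diff_diff_le\<close> add up to at most 4 m D + m D.\<close>

lemma sum_rdist_Zlaw_le: "(\<Sum>i<m. rdist (X i) Zlaw) \<le> 5 / 2 * m ^ 3 * D"
proof -
  let ?E = "\<lambda>i. 2 * rdist (X i) (X i) + (pent Q - pent (X i))"
  have E0: "?E i \<ge> 0" if "i < m" for i
    using pent_le_Q [OF that] rdist_nonneg [OF fin fin, of i i] by simp
  have half: "(\<Sum>j<m. real j) \<le> m\<^sup>2 / 2"
    by (induction m) (auto simp: power2_eq_square field_simps)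
  have "rdist (X i) Zlaw \<le> m\<^sup>2 / 2 * ?E i" if i: "i < m" for i
  proof -
    have "pent (conv (X i) (neg Zlaw)) - pent (X i) \<le> (\<Sum>j<m. pent (conv (X i) (neg (map_pmf (smul j) Q))) - pent (X i))"
      unfolding neg_sumlaw by (rule pent_conv_sumlaw_le) (use fin in auto)
    also have "\<dots> \<le> (\<Sum>j<m. j * ?E i)"
    proof (rule sum_mono)
      fix j
      have "pent (conv (X i) (neg (map_pmf (smul j) Q))) - pent (X i) \<le> j * (pent (conv (conv (X i) (neg (X i))) (neg Q)) - pent (X i))"
        by (rule pent_dilate_le) (use fin in auto)
      also have "\<dots> \<le> j * ?E i"
        by (intro mult_left_mono pent_diff_diff_le i) auto
      finally show "pent (conv (X i) (neg (map_pmf (smul j) Q))) - pent (X i) \<le> j * ?E i" .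
    qed
    also have "\<dots> = (\<Sum>j<m. real j) * ?E i" by (simp add: sum_distrib_right)
    also have "\<dots> \<le> m\<^sup>2 / 2 * ?E i" by (intro mult_right_mono half E0 i)
    finally have "pent (conv (X i) (neg Zlaw)) - pent (X i) \<le> m\<^sup>2 / 2 * ?E i" .
    \<comment> \<open>The term of weight 1 is Q itself, present because m is at least 2. This turns
      the one-sided difference into a Ruzsa distance.\<close>
    moreover have "pent (X i) \<le> pent Zlaw"
    proof -
      have "pent (sumlaw (\<lambda>j. map_pmf (smul j) Q) {1}) \<le> pent Zlaw"
        by (rule pent_sumlaw_mono) (use m fin in auto)
      moreover have "smul (Suc 0) = (\<lambda>x :: 'g. x)" by auto
      ultimately show ?thesis using pent_le_Q [OF i] by simp
    qed
    ultimately show ?thesis by (simp add: rdist_def)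
  qed
  then have "(\<Sum>i<m. rdist (X i) Zlaw) \<le> (\<Sum>i<m. m\<^sup>2 / 2 * ?E i)" by (intro sum_mono) auto
  also have "\<dots> = m\<^sup>2 / 2 * (2 * (\<Sum>i<m. rdist (X i) (X i)) + m * D)"
    unfolding sum_diff_Q [symmetric] sum_distrib_left [of "m\<^sup>2 / 2", symmetric] sum.distrib sum_distrib_left [of 2, symmetric] ..
  also have "\<dots> \<le> m\<^sup>2 / 2 * (5 * m * D)"
    using sum_rdist_self_le by (intro mult_left_mono) auto
  also have "\<dots> = 5 / 2 * m ^ 3 * D" by (simp add: power2_eq_square power3_eq_cube)
  finally show ?thesis .
qed

end

section \<open>Product distributions and fibres\<close>

definition depends_on :: "(('k \<Rightarrow> 'a) \<Rightarrow> 'b) \<Rightarrow> 'k set \<Rightarrow> bool" where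
  "depends_on F B \<longleftrightarrow> (\<forall>\<omega> \<omega>'. (\<forall>b\<in>B. \<omega> b = \<omega>' b) \<longrightarrow> F \<omega> = F \<omega>')"

lemma finite_Pi_pmf [simp]:
  assumes "finite A" "\<And>a. a \<in> A \<Longrightarrow> finite (set_pmf (p a))"
  shows "finite (set_pmf (Pi_pmf A d p))"
  using assms by (auto simp: set_Pi_pmf intro!: finite_PiE_dflt)

text \<open>The index set is split into its part in \<open>B\<close> and the rest. A point of either
  smaller product has the default value \<open>d\<close> elsewhere, so gluing changes neither the
  coordinates of the first part seen by \<open>F\<close> nor those of the second part seen by
  \<open>G\<close>.\<close>

lemma indep_Pi_pmf:
  assumes A: "finite A" and F: "depends_on F B" and G: "depends_on G C" and BC: "B \<inter> C = {}"
  shows "map_pmf (\<lambda>\<omega>. (F \<omega>, G \<omega>)) (Pi_pmf A d p) =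
    pair_pmf (map_pmf F (Pi_pmf A d p)) (map_pmf G (Pi_pmf A d p))"
proof -
  define B' C' where "B' = A \<inter> B" and "C' = A - B"
  define merge where "merge f g x = (if x \<in> B' then f x else g x)" for f g :: "'a \<Rightarrow> 'b" and x
  have fin: "finite B'" "finite C'" using A by (auto simp: B'_def C'_def)
  have "B' \<union> C' = A" "B' \<inter> C' = {}" by (auto simp: B'_def C'_def)
  then have P: "Pi_pmf A d p = map_pmf (\<lambda>\<omega>. merge (fst \<omega>) (snd \<omega>)) (pair_pmf (Pi_pmf B' d p) (Pi_pmf C' d p))"
    using Pi_pmf_union [OF fin, of d p] by (simp add: merge_def [abs_def] case_prod_unfold)
  have *: "F (merge f g) = F f \<and> G (merge f g) = G g"
    if "(f, g) \<in> set_pmf (pair_pmf (Pi_pmf B' d p) (Pi_pmf C' d p))" for f g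
  proof -
    have f: "f x = d" if "x \<notin> B'" for x
      using that \<open>(f, g) \<in> _\<close> set_Pi_pmf_subset [OF fin(1), of d p] by auto
    have g: "g x = d" if "x \<notin> C'" for x
      using that \<open>(f, g) \<in> _\<close> set_Pi_pmf_subset [OF fin(2), of d p] by auto
    have "\<forall>b\<in>B. merge f g b = f b"
      by (auto simp: merge_def f g B'_def C'_def)
    moreover have "\<forall>c\<in>C. merge f g c = g c"
      using BC by (auto simp: merge_def B'_def)
    ultimately show ?thesis using F G unfolding depends_on_def by blast
  qed
  have "map_pmf (\<lambda>\<omega>. (F \<omega>, G \<omega>)) (Pi_pmf A d p) = map_pmf (\<lambda>(f, g). (F f, G g)) (pair_pmf (Pi_pmf B' d p) (Pi_pmf C' d p))"
    unfolding P map_pmf_comp by (rule map_pmf_cong) (use * in auto)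
  moreover have "map_pmf F (Pi_pmf A d p) = map_pmf F (map_pmf fst (pair_pmf (Pi_pmf B' d p) (Pi_pmf C' d p)))"
    unfolding P map_pmf_comp by (rule map_pmf_cong) (use * in auto)
  moreover have "map_pmf G (Pi_pmf A d p) = map_pmf G (map_pmf snd (pair_pmf (Pi_pmf B' d p) (Pi_pmf C' d p)))"
    unfolding P map_pmf_comp by (rule map_pmf_cong) (use * in auto)
  ultimately show ?thesis
    by (simp only: map_pair map_fst_pair_pmf map_snd_pair_pmf)
qed

lemma ent_indep_Pi_pmf:
  assumes "finite A" "\<And>a. a \<in> A \<Longrightarrow> finite (set_pmf (p a))"
    "depends_on F B" "depends_on G C" "B \<inter> C = {}"
  shows "ent (Pi_pmf A d p) (\<lambda>\<omega>. (F \<omega>, G \<omega>)) = ent (Pi_pmf A d p) F + ent (Pi_pmf A d p) G"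
  by (intro ent_indep indep_Pi_pmf [where B=B and C=C] finite_Pi_pmf assms)

text \<open>
  Outside \<open>I\<close> the tuple is the constant \<open>d\<close>, so that for finite \<open>I\<close> it takes finitely many values.
\<close>

definition tup :: "'i set \<Rightarrow> 'b \<Rightarrow> ('i \<Rightarrow> 'w \<Rightarrow> 'b) \<Rightarrow> 'w \<Rightarrow> 'i \<Rightarrow> 'b" where
  "tup I d f \<omega> = (\<lambda>i. if i \<in> I then f i \<omega> else d)"

lemma tup_eq_iff: "tup I d f \<omega> = tup I d f \<omega>' \<longleftrightarrow> (\<forall>i\<in>I. f i \<omega> = f i \<omega>')"
  by (auto simp: tup_def fun_eq_iff)

lemma depends_on_tup:
  assumes "\<And>i. i \<in> I \<Longrightarrow> depends_on (f i) (B i)"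
  shows "depends_on (tup I d f) (\<Union>i\<in>I. B i)"
  using assms unfolding depends_on_def by (auto simp: tup_def fun_eq_iff)

lemma depends_on_sum:
  assumes "\<And>i. i \<in> I \<Longrightarrow> depends_on (f i) (B i)"
  shows "depends_on (\<lambda>\<omega>. \<Sum>i\<in>I. f i \<omega>) (\<Union>i\<in>I. B i)"
  using assms unfolding depends_on_def by (auto intro!: sum.cong)

lemma tup_law:
  assumes A: "finite A" and I: "finite I"
    and dep: "\<And>i. i \<in> I \<Longrightarrow> depends_on (f i) (B i)" and disj: "disjoint_family_on B I"
  shows "map_pmf (tup I d' f) (Pi_pmf A d p) = Pi_pmf I d' (\<lambda>i. map_pmf (f i) (Pi_pmf A d p))"
  using I dep disj
proof (induction I)
  case empty
  then show ?case by (simp add: tup_def)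
next
  case (insert x I)
  let ?P = "Pi_pmf A d p"
  have IH: "map_pmf (tup I d' f) ?P = Pi_pmf I d' (\<lambda>i. map_pmf (f i) ?P)"
    using insert by (auto simp: disjoint_family_on_def)
  have "Pi_pmf (insert x I) d' (\<lambda>i. map_pmf (f i) ?P) =
      map_pmf (\<lambda>(y, g). g(x := y)) (pair_pmf (map_pmf (f x) ?P) (map_pmf (tup I d' f) ?P))"
    unfolding IH by (rule Pi_pmf_insert) (use insert in auto)
  also have "pair_pmf (map_pmf (f x) ?P) (map_pmf (tup I d' f) ?P) = map_pmf (\<lambda>\<omega>. (f x \<omega>, tup I d' f \<omega>)) ?P"
  proof (rule indep_Pi_pmf [symmetric, OF A])
    show "depends_on (f x) (B x)" using insert by auto
    show "depends_on (tup I d' f) (\<Union>i\<in>I. B i)" using insert by (intro depends_on_tup) auto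
    show "B x \<inter> (\<Union>i\<in>I. B i) = {}" using insert by (fastforce simp: disjoint_family_on_def)
  qed
  also have "map_pmf (\<lambda>(y, g). g(x := y)) \<dots> = map_pmf (tup (insert x I) d' f) ?P"
    unfolding map_pmf_comp by (rule map_pmf_cong) (auto simp: tup_def fun_eq_iff)
  finally show ?case ..
qed

lemma sum_law:
  fixes f :: "'i \<Rightarrow> ('k \<Rightarrow> 'a) \<Rightarrow> 'g::ab_group_add"
  assumes A: "finite A" and I: "finite I"
    and dep: "\<And>i. i \<in> I \<Longrightarrow> depends_on (f i) (B i)" and disj: "disjoint_family_on B I"
  shows "map_pmf (\<lambda>\<omega>. \<Sum>i\<in>I. f i \<omega>) (Pi_pmf A d p) = sumlaw (\<lambda>i. map_pmf (f i) (Pi_pmf A d p)) I"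
  using I dep disj
proof (induction I)
  case (insert x I)
  let ?P = "Pi_pmf A d p"
  have IH: "map_pmf (\<lambda>\<omega>. \<Sum>i\<in>I. f i \<omega>) ?P = sumlaw (\<lambda>i. map_pmf (f i) ?P) I"
    using insert by (auto simp: disjoint_family_on_def)
  have "pair_pmf (map_pmf (f x) ?P) (map_pmf (\<lambda>\<omega>. \<Sum>i\<in>I. f i \<omega>) ?P) = map_pmf (\<lambda>\<omega>. (f x \<omega>, \<Sum>i\<in>I. f i \<omega>)) ?P"
  proof (rule indep_Pi_pmf [symmetric, OF A])
    show "depends_on (f x) (B x)" using insert by auto
    show "depends_on (\<lambda>\<omega>. \<Sum>i\<in>I. f i \<omega>) (\<Union>i\<in>I. B i)" using insert by (intro depends_on_sum) auto
    show "B x \<inter> (\<Union>i\<in>I. B i) = {}" using insert by (fastforce simp: disjoint_family_on_def)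
  qed
  then have "conv (map_pmf (f x) ?P) (map_pmf (\<lambda>\<omega>. \<Sum>i\<in>I. f i \<omega>) ?P) = map_pmf (\<lambda>\<omega>. f x \<omega> + (\<Sum>i\<in>I. f i \<omega>)) ?P"
    by (simp add: conv_def map_pmf_comp)
  then show ?case using insert IH by simp
qed simp

lemma ent_tup:
  assumes A: "finite A" "\<And>a. a \<in> A \<Longrightarrow> finite (set_pmf (p a))" and I: "finite I"
    and dep: "\<And>i. i \<in> I \<Longrightarrow> depends_on (f i) (B i)" and disj: "disjoint_family_on B I"
  shows "ent (Pi_pmf A d p) (tup I d' f) = (\<Sum>i\<in>I. ent (Pi_pmf A d p) (f i))"
  using I dep disj
proof (induction I)
  case empty
  have "tup {} d' f = (\<lambda>\<omega>. \<lambda>i. d')" by (auto simp: tup_def)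
  then show ?case by simp
next
  case (insert x I)
  let ?P = "Pi_pmf A d p"
  have F: "finite (set_pmf ?P)" using A by simp
  have "ent ?P (tup (insert x I) d' f) = ent ?P (\<lambda>\<omega>. (f x \<omega>, tup I d' f \<omega>))"
    by (rule ent_cong [OF F]) (auto simp: tup_eq_iff)
  also have "\<dots> = ent ?P (f x) + ent ?P (tup I d' f)"
  proof (rule ent_indep_Pi_pmf [OF A])
    show "depends_on (f x) (B x)" using insert by auto
    show "depends_on (tup I d' f) (\<Union>i\<in>I. B i)" using insert by (intro depends_on_tup) auto
    show "B x \<inter> (\<Union>i\<in>I. B i) = {}" using insert by (fastforce simp: disjoint_family_on_def)
  qed auto
  also have "ent ?P (tup I d' f) = (\<Sum>i\<in>I. ent ?P (f i))"
    using insert by (auto simp: disjoint_family_on_def)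
  finally show ?case using insert by simp
qed

section \<open>Averages over fibres\<close>

lemma sum_fibre_ent:
  assumes fin: "finite (set_pmf P)"
  shows "(\<Sum>v\<in>V ` set_pmf P. pmf (map_pmf V P) v * ent (fibre P V v) A) = ent P (\<lambda>\<omega>. (A \<omega>, V \<omega>)) - ent P V"
proof -
  have "ent (mix (map_pmf V P) (fibre P V)) (\<lambda>\<omega>. (A (snd \<omega>), fst \<omega>)) =
     pent (map_pmf V P) + (\<Sum>v\<in>set_pmf (map_pmf V P). pmf (map_pmf V P) v * ent (fibre P V v) A)"
    by (rule ent_mix) (use fin in \<open>auto simp: set_fibre\<close>)
  then show ?thesis by (simp add: mix_fibre ent_map) (simp add: ent_def)
qed

lemma bind_fibre: "bind_pmf (map_pmf V P) (\<lambda>v. map_pmf A (fibre P V v)) = map_pmf A P"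
  using map_snd_mix [of "\<lambda>_. A" "map_pmf V P" "fibre P V"] by (simp add: mix_fibre map_pmf_comp)

lemma bind_conv: "bind_pmf R (\<lambda>v. conv q (neg (K v))) = conv q (neg (bind_pmf R K))"
  unfolding conv_def neg_def pair_pmf_def map_bind_pmf bind_map_pmf bind_assoc_pmf bind_return_pmf map_return_pmf
  by (subst bind_commute_pmf) simp

text \<open>The excess over d[q;A] is half the mutual information of A and V: the entropy of the
  difference is concave in the law of A, and the entropies of the fibres fall short of H(A) by
  exactly that information on average.\<close>

lemma sum_fibre_rdist:
  fixes A :: "'w \<Rightarrow> 'g::ab_group_add"
  assumes fin: "finite (set_pmf P)" "finite (set_pmf q)"
  shows "(\<Sum>v\<in>V ` set_pmf P. pmf (map_pmf V P) v * rdist q (map_pmf A (fibre P V v)))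
     \<le> rdist q (map_pmf A P) + (ent P A + ent P V - ent P (\<lambda>\<omega>. (A \<omega>, V \<omega>))) / 2"
proof -
  let ?R = "map_pmf V P" and ?K = "\<lambda>v. map_pmf A (fibre P V v)"
  have 1: "(\<Sum>v\<in>V ` set_pmf P. pmf ?R v * pent (conv q (neg (?K v)))) \<le> pent (conv q (neg (map_pmf A P)))"
    using pent_concave [of ?R "\<lambda>v. conv q (neg (?K v))"] fin
    unfolding bind_conv bind_fibre by (auto simp: set_fibre)
  have 2: "(\<Sum>v\<in>V ` set_pmf P. pmf ?R v * pent (?K v)) = ent P (\<lambda>\<omega>. (A \<omega>, V \<omega>)) - ent P V"
    using sum_fibre_ent [OF fin(1), of V A] by (simp add: ent_def)
  have 3: "(\<Sum>v\<in>V ` set_pmf P. pmf ?R v * pent q) = pent q"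
    using sum_pmf_eq_1' [of ?R] fin by (simp add: sum_distrib_right [symmetric])
  have "(\<Sum>v\<in>V ` set_pmf P. pmf ?R v * rdist q (?K v)) =
    (\<Sum>v\<in>V ` set_pmf P. pmf ?R v * pent (conv q (neg (?K v)))) - (\<Sum>v\<in>V ` set_pmf P. pmf ?R v * pent q) / 2
     - (\<Sum>v\<in>V ` set_pmf P. pmf ?R v * pent (?K v)) / 2"
    by (simp add: rdist_def sum_subtractf sum.distrib sum_divide_distrib algebra_simps)
  then show ?thesis using 1 unfolding 2 3 by (simp add: rdist_def ent_def field_simps)
qed

text \<open>
  The near-minimality hypothesis is applied to the fibres of the \<open>a i\<close> over the values of
  \<open>a i + b i\<close>, and averaged over these values.
\<close>

lemma fibre_tuple_le:
  fixes a b q :: "nat \<Rightarrow> 'g::ab_group_add pmf"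
  assumes fin: "\<And>i. i < m \<Longrightarrow> finite (set_pmf (a i))" "\<And>i. i < m \<Longrightarrow> finite (set_pmf (b i))"
      "\<And>i. i < m \<Longrightarrow> finite (set_pmf (q i))"
    and L: "\<And>i. i < m \<Longrightarrow> set_pmf (a i) \<subseteq> L" and \<eta>: "\<eta> \<ge> 0"
    and least: "\<And>Y. (\<And>i. i < m \<Longrightarrow> finite (set_pmf (Y i)) \<and> set_pmf (Y i) \<subseteq> L) \<Longrightarrow>
      k \<le> mdist m Y + \<eta> * (\<Sum>i<m. rdist (q i) (Y i))"
  defines "P \<equiv> Pi_pmf {..<m} (0, 0) (\<lambda>i. pair_pmf (a i) (b i))"
    and "S \<equiv> tup {..<m} 0 (\<lambda>i \<omega>. fst (\<omega> i) + snd (\<omega> i))"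
  shows "k \<le> ent P (\<lambda>\<omega>. (\<Sum>i<m. fst (\<omega> i), S \<omega>)) - ent P S
    - (\<Sum>i<m. pent (a i) + pent (b i) - pent (conv (a i) (b i))) / m
    + \<eta> * (\<Sum>i<m. rdist (q i) (a i) + (pent (conv (a i) (b i)) - pent (b i)) / 2)"
proof -
  define s :: "'g \<times> 'g \<Rightarrow> 'g" where "s z = fst z + snd z" for z
  define R where "R i = map_pmf s (pair_pmf (a i) (b i))" for i
  define K where "K i v = map_pmf fst (fibre (pair_pmf (a i) (b i)) s v)" for i v
  have R: "R i = conv (a i) (b i)" for i by (simp add: R_def conv_def s_def [abs_def])
  have finR: "finite (set_pmf (R i))" if "i < m" for i using fin that by (simp add: R)
  have setR: "set_pmf (R i) = s ` (set_pmf (a i) \<times> set_pmf (b i))" for i by (simp add: R_def)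
  have finK: "finite (set_pmf (K i v))" and KL: "set_pmf (K i v) \<subseteq> L"
    if "i < m" "v \<in> set_pmf (R i)" for i v
    using that fin[OF that(1)] L [OF that(1)] set_fibre [of v s "pair_pmf (a i) (b i)"]
    unfolding K_def setR by auto
  \<comment> \<open>All pairs are conditioned on their sums at once: \<open>VR\<close> is the law of
    the vector of sums, and \<open>VK v\<close> that of the vector of first components given the
    sums \<open>v\<close>.\<close>
  define VR where "VR = Pi_pmf {..<m} 0 R"
  define VK where "VK v = Pi_pmf {..<m} 0 (\<lambda>i. K i (v i))" for v
  have finVR: "finite (set_pmf VR)" unfolding VR_def by (rule finite_Pi_pmf) (auto simp: finR)
  have VR_mem: "v i \<in> set_pmf (R i)" if "v \<in> set_pmf VR" "i < m" for v i
    using that by (simp add: VR_def set_Pi_pmf PiE_dflt_def)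
  have VR_out: "v i = 0" if "v \<in> set_pmf VR" "\<not> i < m" for v i
    using that by (simp add: VR_def set_Pi_pmf PiE_dflt_def)
  have finVK: "finite (set_pmf (VK v))" if "v \<in> set_pmf VR" for v
    unfolding VK_def by (rule finite_Pi_pmf) (auto intro: finK VR_mem that)
  have sumVK: "map_pmf (\<lambda>\<omega>. \<Sum>i<m. \<omega> i) (VK v) = sumlaw (\<lambda>i. K i (v i)) {..<m}" for v
    unfolding VK_def
    by (subst sum_law [where B="\<lambda>i. {i}"])
      (auto simp: depends_on_def disjoint_family_on_def Pi_pmf_component intro!: conv.cong)
  define g :: "'g \<times> 'g \<Rightarrow> 'g \<times> 'g" where "g z = (s z, fst z)" for z
  have gpair: "map_pmf g (pair_pmf (a i) (b i)) = bind_pmf (R i) (\<lambda>v. map_pmf (Pair v) (K i v))" for i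
  proof -
    have "map_pmf g (pair_pmf (a i) (b i)) = map_pmf (\<lambda>z. (fst z, fst (snd z))) (mix (R i) (fibre (pair_pmf (a i) (b i)) s))"
      unfolding R_def mix_fibre by (simp add: map_pmf_comp g_def [abs_def])
    also have "\<dots> = bind_pmf (R i) (\<lambda>v. map_pmf (Pair v) (K i v))"
      unfolding mix_def K_def by (simp add: map_bind_pmf map_pmf_comp)
    finally show ?thesis .
  qed
  have inner: "Pi_pmf {..<m} (0, 0) (\<lambda>i. map_pmf (Pair (v i)) (K i (v i))) =
      map_pmf (tup {..<m} (0, 0) (\<lambda>i \<omega>. (v i, \<omega> i))) (VK v)" for v
    unfolding VK_def
    by (subst tup_law [where B="\<lambda>i. {i}"])
      (auto simp: depends_on_def disjoint_family_on_def Pi_pmf_component map_pmf_comp [of "Pair _" "\<lambda>\<omega>. \<omega> _", symmetric] intro!: Pi_pmf_cong)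
  \<comment> \<open>Sampling the pairs amounts to sampling the sums and then the fibres, and
    independence across the index holds in both stages.\<close>
  have law: "map_pmf (\<lambda>h. g \<circ> h) P = bind_pmf VR (\<lambda>v. map_pmf (tup {..<m} (0, 0) (\<lambda>i \<omega>. (v i, \<omega> i))) (VK v))"
  proof -
    have "map_pmf (\<lambda>h. g \<circ> h) P = Pi_pmf {..<m} (0, 0) (\<lambda>i. map_pmf g (pair_pmf (a i) (b i)))"
      unfolding P_def by (rule Pi_pmf_map [symmetric]) (auto simp: g_def s_def)
    also have "\<dots> = bind_pmf VR (\<lambda>v. Pi_pmf {..<m} (0, 0) (\<lambda>i. map_pmf (Pair (v i)) (K i (v i))))"
      unfolding gpair VR_def by (rule Pi_pmf_bind) simp
    finally show ?thesis by (simp add: inner)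
  qed
  have key: "map_pmf (\<lambda>\<omega>. (\<Sum>i<m. fst (\<omega> i), S \<omega>)) P = map_pmf (\<lambda>z. (\<Sum>i<m. snd z i, fst z)) (mix VR VK)"
  proof -
    have "map_pmf (\<lambda>\<omega>. (\<Sum>i<m. fst (\<omega> i), S \<omega>)) P =
       map_pmf (\<lambda>h. (\<Sum>i<m. snd (h i), tup {..<m} 0 (\<lambda>i h. fst (h i)) h)) (map_pmf (\<lambda>h. g \<circ> h) P)"
      by (simp add: map_pmf_comp g_def s_def S_def tup_def comp_def cong: if_cong)
    also have "\<dots> = bind_pmf VR (\<lambda>v. map_pmf (\<lambda>\<omega>. (\<Sum>i<m. \<omega> i, v)) (VK v))"
      unfolding law map_bind_pmf map_pmf_comp
      by (intro bind_pmf_cong map_pmf_cong refl) (auto simp: tup_def fun_eq_iff VR_out)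
    also have "\<dots> = map_pmf (\<lambda>z. (\<Sum>i<m. snd z i, fst z)) (mix VR VK)"
      unfolding mix_def map_bind_pmf map_pmf_comp by simp
    finally show ?thesis .
  qed
  have entS: "ent P S = pent VR"
  proof -
    have "map_pmf S P = map_pmf snd (map_pmf (\<lambda>\<omega>. (\<Sum>i<m. fst (\<omega> i), S \<omega>)) P)"
      by (simp add: map_pmf_comp)
    also have "\<dots> = VR" unfolding key by (simp add: map_pmf_comp map_fst_mix)
    finally show ?thesis by (simp add: ent_def)
  qed
  have "ent P (\<lambda>\<omega>. (\<Sum>i<m. fst (\<omega> i), S \<omega>)) = ent (mix VR VK) (\<lambda>z. (\<Sum>i<m. snd z i, fst z))"
    unfolding ent_def key ..
  also have "\<dots> = pent VR + (\<Sum>v\<in>set_pmf VR. pmf VR v * ent (VK v) (\<lambda>\<omega>. \<Sum>i<m. \<omega> i))"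
    by (rule ent_mix) (auto simp: finVR finVK)
  finally have entC: "ent P (\<lambda>\<omega>. (\<Sum>i<m. fst (\<omega> i), S \<omega>)) - ent P S =
     (\<Sum>v\<in>set_pmf VR. pmf VR v * pent (sumlaw (\<lambda>i. K i (v i)) {..<m}))"
    by (simp add: ent_def sumVK entS [unfolded ent_def])
  have marg: "(\<Sum>v\<in>set_pmf VR. pmf VR v * (\<Sum>i<m. f i (v i))) = (\<Sum>i<m. \<Sum>u\<in>set_pmf (R i). pmf (R i) u * f i u)" for f
  proof -
    have "(\<Sum>v\<in>set_pmf VR. pmf VR v * (\<Sum>i<m. f i (v i))) = (\<Sum>i<m. \<Sum>v\<in>set_pmf VR. pmf VR v * f i (v i))"
      unfolding sum_distrib_left by (rule sum.swap)
    also have "\<dots> = (\<Sum>i<m. \<Sum>u\<in>set_pmf (R i). pmf (R i) u * f i u)"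
    proof (rule sum.cong [OF refl])
      fix i assume "i \<in> {..<m}"
      then have "map_pmf (\<lambda>v. v i) VR = R i" unfolding VR_def by (simp add: Pi_pmf_component)
      with sum_map_pmf [OF finVR, of "\<lambda>v. v i" "f i"]
      show "(\<Sum>v\<in>set_pmf VR. pmf VR v * f i (v i)) = (\<Sum>u\<in>set_pmf (R i). pmf (R i) u * f i u)" by simp
    qed
    finally show ?thesis .
  qed
  \<comment> \<open>H(a | a + b) = H(a) + H(b) - H(a + b), since a and a + b together determine
    b.\<close>
  have m1: "(\<Sum>u\<in>set_pmf (R i). pmf (R i) u * pent (K i u)) = pent (a i) + pent (b i) - pent (conv (a i) (b i))" if i: "i < m" for i
  proof -
    let ?Q = "pair_pmf (a i) (b i)"
    have F: "finite (set_pmf ?Q)" using fin i by simp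
    have "(\<Sum>u\<in>set_pmf (R i). pmf (R i) u * pent (K i u)) = ent ?Q (\<lambda>\<omega>. (fst \<omega>, s \<omega>)) - ent ?Q s"
      using sum_fibre_ent [OF F, of s fst] by (simp add: R_def K_def ent_def)
    also have "ent ?Q (\<lambda>\<omega>. (fst \<omega>, s \<omega>)) = ent ?Q (\<lambda>\<omega>. (fst \<omega>, snd \<omega>))"
      by (rule ent_cong [OF F]) (auto simp: s_def)
    also have "\<dots> = pent (a i) + pent (b i)"
      using ent_pair [of "a i" "b i" "\<lambda>x. x" "\<lambda>x. x"] fin i by (simp add: ent_id)
    also have "ent ?Q s = pent (conv (a i) (b i))" by (simp add: ent_def R [symmetric] R_def)
    finally show ?thesis .
  qed
  \<comment> \<open>I(a : a + b) = H(a + b) - H(b), which enters with weight 1/2 by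
    \<open>sum_fibre_rdist\<close>.\<close>
  have m2: "(\<Sum>u\<in>set_pmf (R i). pmf (R i) u * rdist (q i) (K i u)) \<le> rdist (q i) (a i) + (pent (conv (a i) (b i)) - pent (b i)) / 2"
    if i: "i < m" for i
  proof -
    let ?Q = "pair_pmf (a i) (b i)"
    have F: "finite (set_pmf ?Q)" using fin i by simp
    have "(\<Sum>u\<in>set_pmf (R i). pmf (R i) u * rdist (q i) (K i u)) \<le>
        rdist (q i) (map_pmf fst ?Q) + (ent ?Q fst + ent ?Q s - ent ?Q (\<lambda>\<omega>. (fst \<omega>, s \<omega>))) / 2"
      using sum_fibre_rdist [OF F fin(3) [OF i], of s fst] by (simp add: R_def K_def)
    also have "ent ?Q (\<lambda>\<omega>. (fst \<omega>, s \<omega>)) = ent ?Q (\<lambda>\<omega>. (fst \<omega>, snd \<omega>))"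
      by (rule ent_cong [OF F]) (auto simp: s_def)
    also have "\<dots> = pent (a i) + pent (b i)"
      using ent_pair [of "a i" "b i" "\<lambda>x. x" "\<lambda>x. x"] fin i by (simp add: ent_id)
    also have "ent ?Q s = pent (conv (a i) (b i))" by (simp add: ent_def R [symmetric] R_def)
    finally show ?thesis by (simp add: map_fst_pair_pmf)
  qed
  have "k = (\<Sum>v\<in>set_pmf VR. pmf VR v * k)"
    using sum_pmf_eq_1' [OF finVR] by (simp add: sum_distrib_right [symmetric])
  also have "\<dots> \<le> (\<Sum>v\<in>set_pmf VR. pmf VR v * (mdist m (\<lambda>i. K i (v i)) + \<eta> * (\<Sum>i<m. rdist (q i) (K i (v i)))))"
    by (intro sum_mono mult_left_mono least conjI) (auto intro!: finK KL [THEN subsetD] VR_mem)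
  also have "\<dots> = (\<Sum>v\<in>set_pmf VR. pmf VR v * pent (sumlaw (\<lambda>i. K i (v i)) {..<m}))
      - (\<Sum>v\<in>set_pmf VR. pmf VR v * (\<Sum>i<m. pent (K i (v i)))) / m
      + \<eta> * (\<Sum>v\<in>set_pmf VR. pmf VR v * (\<Sum>i<m. rdist (q i) (K i (v i))))"
    by (simp add: mdist_def ring_distribs sum.distrib sum_subtractf sum_divide_distrib [symmetric] sum_distrib_left [of \<eta> _ "set_pmf VR"] mult.left_commute)
  also have "\<dots> = ent P (\<lambda>\<omega>. (\<Sum>i<m. fst (\<omega> i), S \<omega>)) - ent P S
      - (\<Sum>i<m. \<Sum>u\<in>set_pmf (R i). pmf (R i) u * pent (K i u)) / m
      + \<eta> * (\<Sum>i<m. \<Sum>u\<in>set_pmf (R i). pmf (R i) u * rdist (q i) (K i u))"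
    unfolding entC marg [of "\<lambda>i u. pent (K i u)"] marg [of "\<lambda>i u. rdist (q i) (K i u)"] ..
  also have "(\<Sum>i<m. \<Sum>u\<in>set_pmf (R i). pmf (R i) u * pent (K i u)) = (\<Sum>i<m. pent (a i) + pent (b i) - pent (conv (a i) (b i)))"
    by (intro sum.cong m1) auto
  finally have "k \<le> ent P (\<lambda>\<omega>. (\<Sum>i<m. fst (\<omega> i), S \<omega>)) - ent P S
      - (\<Sum>i<m. pent (a i) + pent (b i) - pent (conv (a i) (b i))) / m
      + \<eta> * (\<Sum>i<m. \<Sum>u\<in>set_pmf (R i). pmf (R i) u * rdist (q i) (K i u))" .
  moreover have "\<eta> * (\<Sum>i<m. \<Sum>u\<in>set_pmf (R i). pmf (R i) u * rdist (q i) (K i u)) \<le>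
     \<eta> * (\<Sum>i<m. rdist (q i) (a i) + (pent (conv (a i) (b i)) - pent (b i)) / 2)"
    by (intro mult_left_mono sum_mono m2 \<eta>) auto
  ultimately show ?thesis by linarith
qed

section \<open>Arrays of independent variables\<close>

definition cmi :: "'w pmf \<Rightarrow> ('w \<Rightarrow> 'a) \<Rightarrow> ('w \<Rightarrow> 'b) \<Rightarrow> ('w \<Rightarrow> 'c) \<Rightarrow> real" where
  "cmi P F G W = ent P (\<lambda>\<omega>. (F \<omega>, W \<omega>)) + ent P (\<lambda>\<omega>. (G \<omega>, W \<omega>))
     - ent P (\<lambda>\<omega>. (F \<omega>, G \<omega>, W \<omega>)) - ent P W"

lemma cmi_commute: "finite (set_pmf P) \<Longrightarrow> cmi P F G W = cmi P G F W"
  unfolding cmi_def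
  by (subst ent_cong [of P "\<lambda>\<omega>. (G \<omega>, F \<omega>, W \<omega>)" "\<lambda>\<omega>. (F \<omega>, G \<omega>, W \<omega>)"]) auto

text \<open>Data processing, obtained from \<open>ent_submod\<close> with the pair of
  \<open>F'\<close> and \<open>W\<close> in the conditioning slot.\<close>

lemma cmi_mono_left:
  assumes fin: "finite (set_pmf P)"
    and det: "\<And>\<omega> \<omega>'. \<omega> \<in> set_pmf P \<Longrightarrow> \<omega>' \<in> set_pmf P \<Longrightarrow> F \<omega> = F \<omega>' \<Longrightarrow> F' \<omega> = F' \<omega>'"
  shows "cmi P F' G W \<le> cmi P F G W"
proof -
  have "ent P (\<lambda>\<omega>. (F \<omega>, G \<omega>, (F' \<omega>, W \<omega>))) + ent P (\<lambda>\<omega>. (F' \<omega>, W \<omega>))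
    \<le> ent P (\<lambda>\<omega>. (F \<omega>, (F' \<omega>, W \<omega>))) + ent P (\<lambda>\<omega>. (G \<omega>, (F' \<omega>, W \<omega>)))"
    by (rule ent_submod [OF fin])
  moreover have "ent P (\<lambda>\<omega>. (F \<omega>, G \<omega>, (F' \<omega>, W \<omega>))) = ent P (\<lambda>\<omega>. (F \<omega>, G \<omega>, W \<omega>))"
    by (rule ent_cong [OF fin]) (use det in blast)
  moreover have "ent P (\<lambda>\<omega>. (F \<omega>, (F' \<omega>, W \<omega>))) = ent P (\<lambda>\<omega>. (F \<omega>, W \<omega>))"
    by (rule ent_cong [OF fin]) (use det in blast)
  moreover have "ent P (\<lambda>\<omega>. (G \<omega>, (F' \<omega>, W \<omega>))) = ent P (\<lambda>\<omega>. (F' \<omega>, G \<omega>, W \<omega>))"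
    by (rule ent_cong [OF fin]) auto
  ultimately show ?thesis by (simp add: cmi_def)
qed

lemma cmi_mono:
  assumes fin: "finite (set_pmf P)"
    and "\<And>\<omega> \<omega>'. F \<omega> = F \<omega>' \<Longrightarrow> F' \<omega> = F' \<omega>'" "\<And>\<omega> \<omega>'. G \<omega> = G \<omega>' \<Longrightarrow> G' \<omega> = G' \<omega>'"
  shows "cmi P F' G' W \<le> cmi P F G W"
proof -
  have "cmi P F' G' W \<le> cmi P F G' W"
    by (rule cmi_mono_left [OF fin]) (use assms(2) in blast)
  also have "\<dots> = cmi P G' F W" by (rule cmi_commute [OF fin])
  also have "\<dots> \<le> cmi P G F W"
    by (rule cmi_mono_left [OF fin]) (use assms(3) in blast)
  also have "\<dots> = cmi P F G W" by (rule cmi_commute [OF fin])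
  finally show ?thesis .
qed

section \<open>Column sums and partial row sums of an array\<close>

locale matrix =
  fixes m :: nat and p :: "nat \<times> nat \<Rightarrow> 'g::ab_group_add pmf"
  assumes fin [simp]: "\<And>k. finite (set_pmf (p k))"
begin

abbreviation "P \<equiv> Pi_pmf ({..<m} \<times> {..<m}) 0 p"

definition col :: "nat \<Rightarrow> (nat \<times> nat \<Rightarrow> 'g) \<Rightarrow> 'g" where
  "col j \<omega> = (\<Sum>i<m. \<omega> (i, j))"

definition tail :: "nat \<Rightarrow> nat \<Rightarrow> (nat \<times> nat \<Rightarrow> 'g) \<Rightarrow> 'g" where
  "tail j i \<omega> = (\<Sum>j'\<in>{j..<m}. \<omega> (i, j'))"

abbreviation "cols n \<equiv> tup {..<n} 0 col"
abbreviation "tails j \<equiv> tup {..<m} 0 (tail j)"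

definition total :: "(nat \<times> nat \<Rightarrow> 'g) \<Rightarrow> 'g" where
  "total \<omega> = (\<Sum>i<m. \<Sum>j<m. \<omega> (i, j))"

lemma finP [simp]: "finite (set_pmf P)"
  by simp

lemma depends_col: "depends_on (col j) ({..<m} \<times> {j})"
  by (auto simp: depends_on_def col_def intro!: sum.cong)

lemma depends_tail: "depends_on (tail j i) ({i} \<times> {j..<m})"
  by (auto simp: depends_on_def tail_def intro!: sum.cong)

lemma depends_tails: "depends_on (tails j) ({..<m} \<times> {j..<m})"
  using depends_on_tup [of "{..<m}" "tail j" "\<lambda>i. {i} \<times> {j..<m}" 0] depends_tail
  by (auto simp: depends_on_def)

text \<open>Chain rule over the columns. Replacing the earlier column sums by all entries
  \<open>Y\<close> of those columns only lowers the conditional entropy of column \<open>n\<close>.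
  Given \<open>Y\<close>, the row sums amount to the tails from \<open>n\<close> on, and these
  involve only entries independent of \<open>Y\<close>.\<close>

lemma sum_chain_le:
  "n \<le> m \<Longrightarrow> (\<Sum>j<n. ent P (\<lambda>\<omega>. (col j \<omega>, tails j \<omega>)) - ent P (tails j)) + ent P (tails 0)
     \<le> ent P (\<lambda>\<omega>. (cols n \<omega>, tails 0 \<omega>))"
proof (induction n)
  case 0
  have "ent P (tails 0) \<le> ent P (\<lambda>\<omega>. (cols 0 \<omega>, tails 0 \<omega>))"
    by (rule ent_mono) auto
  then show ?case by simp
next
  case (Suc n)
  define Y where "Y = tup ({..<m} \<times> {..<n}) 0 (\<lambda>k \<omega>. \<omega> k :: 'g)"
  have dY: "depends_on Y ({..<m} \<times> {..<n})"
    by (auto simp: depends_on_def Y_def tup_eq_iff)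
  have Y_eq: "Y \<omega> = Y \<omega>' \<longleftrightarrow> (\<forall>i<m. \<forall>j<n. \<omega> (i, j) = \<omega>' (i, j))" for \<omega> \<omega>'
    by (auto simp: Y_def tup_eq_iff)
  have colY: "cols n \<omega> = cols n \<omega>'" if "Y \<omega> = Y \<omega>'" for \<omega> \<omega>'
    using that by (auto simp: Y_eq tup_eq_iff col_def intro!: sum.cong)
  have tail_split: "tail 0 i \<omega> = (\<Sum>j<n. \<omega> (i, j)) + tail n i \<omega>" for i \<omega>
  proof -
    have "{0..<m} = {..<n} \<union> {n..<m}" using Suc.prems by auto
    then show ?thesis unfolding tail_def by (simp add: sum.union_disjoint ivl_disj_int)
  qed
  have tailY: "tails 0 \<omega> = tails 0 \<omega>' \<longleftrightarrow> tails n \<omega> = tails n \<omega>'" if "Y \<omega> = Y \<omega>'" for \<omega> \<omega>'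
  proof -
    have "(\<Sum>j<n. \<omega> (i, j)) = (\<Sum>j<n. \<omega>' (i, j))" if "i < m" for i
      using \<open>Y \<omega> = Y \<omega>'\<close> that by (auto simp: Y_eq intro!: sum.cong)
    then show ?thesis by (auto simp: tup_eq_iff tail_split)
  qed
  have "ent P (\<lambda>\<omega>. (col n \<omega>, Y \<omega>, (cols n \<omega>, tails 0 \<omega>))) + ent P (\<lambda>\<omega>. (cols n \<omega>, tails 0 \<omega>))
    \<le> ent P (\<lambda>\<omega>. (col n \<omega>, (cols n \<omega>, tails 0 \<omega>))) + ent P (\<lambda>\<omega>. (Y \<omega>, (cols n \<omega>, tails 0 \<omega>)))"
    by (rule ent_submod) simp
  moreover have "ent P (\<lambda>\<omega>. (col n \<omega>, Y \<omega>, (cols n \<omega>, tails 0 \<omega>))) = ent P (\<lambda>\<omega>. (Y \<omega>, (col n \<omega>, tails n \<omega>)))"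
    by (rule ent_cong) (auto dest: colY tailY)
  moreover have "\<dots> = ent P Y + ent P (\<lambda>\<omega>. (col n \<omega>, tails n \<omega>))"
  proof (rule ent_indep_Pi_pmf [OF _ _ dY])
    show "depends_on (\<lambda>\<omega>. (col n \<omega>, tails n \<omega>)) ({..<m} \<times> {n..<m})"
      using depends_col [of n] depends_tails [of n] Suc.prems unfolding depends_on_def by auto
  qed auto
  moreover have "ent P (\<lambda>\<omega>. (Y \<omega>, (cols n \<omega>, tails 0 \<omega>))) = ent P (\<lambda>\<omega>. (Y \<omega>, tails n \<omega>))"
    by (rule ent_cong) (auto dest: colY tailY)
  moreover have "\<dots> = ent P Y + ent P (tails n)"
    by (rule ent_indep_Pi_pmf [OF _ _ dY depends_tails]) auto
  moreover have "ent P (\<lambda>\<omega>. (col n \<omega>, (cols n \<omega>, tails 0 \<omega>))) = ent P (\<lambda>\<omega>. (cols (Suc n) \<omega>, tails 0 \<omega>))"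
    by (rule ent_cong) (auto simp: tup_eq_iff less_Suc_eq)
  ultimately show ?case using Suc by simp
qed

text \<open>The columns are independent, so the entropy of \<open>cols m\<close> is a sum. Only m -
  1 columns enter the chain: the last one is determined by the other columns and the row
  sums.\<close>

lemma mutual_info_le:
  assumes "m > 0"
  shows "ent P (cols m) + ent P (tails 0) - ent P (\<lambda>\<omega>. (cols m \<omega>, tails 0 \<omega>)) - ent P total
   \<le> (\<Sum>j<m. ent P (col j)) - ent P total
      - (\<Sum>j<m-1. ent P (\<lambda>\<omega>. (col j \<omega>, tails j \<omega>)) - ent P (tails j))"
proof -
  have "ent P (cols m) = (\<Sum>j<m. ent P (col j))"
    by (rule ent_tup [OF _ _ _ depends_col]) (auto simp: disjoint_family_on_def)
  moreover have "ent P (\<lambda>\<omega>. (cols (m-1) \<omega>, tails 0 \<omega>)) \<le> ent P (\<lambda>\<omega>. (cols m \<omega>, tails 0 \<omega>))"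
    by (rule ent_mono) (auto simp: tup_eq_iff)
  ultimately show ?thesis using sum_chain_le [of "m - 1"] by simp
qed

lemma component_law: "i < m \<Longrightarrow> j < m \<Longrightarrow> map_pmf (\<lambda>\<omega>. \<omega> (i, j)) P = p (i, j)"
  by (subst Pi_pmf_component) auto

lemma col_law: "j < m \<Longrightarrow> map_pmf (col j) P = sumlaw (\<lambda>i. p (i, j)) {..<m}"
  unfolding col_def [abs_def]
  by (subst sum_law [where B="\<lambda>i. {(i, j)}"])
    (auto simp: depends_on_def disjoint_family_on_def component_law intro!: conv.cong)

lemma tail_law: "i < m \<Longrightarrow> map_pmf (tail j i) P = sumlaw (\<lambda>j'. p (i, j')) {j..<m}"
  unfolding tail_def [abs_def]
  by (subst sum_law [where B="\<lambda>j'. {(i, j')}"])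
    (auto simp: depends_on_def disjoint_family_on_def component_law intro!: conv.cong)

lemma total_eq: "total \<omega> = (\<Sum>i<m. tail 0 i \<omega>)" "total \<omega> = (\<Sum>j<m. col j \<omega>)"
  unfolding total_def tail_def col_def by (simp add: atLeast0LessThan) (rule sum.swap)

lemma col_tails_law:
  assumes j: "j < m"
  defines "b \<equiv> \<lambda>i. sumlaw (\<lambda>j'. p (i, j')) {Suc j..<m}"
  shows "map_pmf (tup {..<m} (0, 0) (\<lambda>i \<omega>. (\<omega> (i, j), tail (Suc j) i \<omega>))) P = Pi_pmf {..<m} (0, 0) (\<lambda>i. pair_pmf (p (i, j)) (b i))"
proof -
  have "map_pmf (tup {..<m} (0, 0) (\<lambda>i \<omega>. (\<omega> (i, j), tail (Suc j) i \<omega>))) P =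
     Pi_pmf {..<m} (0, 0) (\<lambda>i. map_pmf (\<lambda>\<omega>. (\<omega> (i, j), tail (Suc j) i \<omega>)) P)"
    by (rule tup_law [where B="\<lambda>i. {i} \<times> UNIV"])
      (auto simp: depends_on_def disjoint_family_on_def tail_def)
  also have "\<dots> = Pi_pmf {..<m} (0, 0) (\<lambda>i. pair_pmf (p (i, j)) (b i))"
  proof (rule Pi_pmf_cong [OF refl refl])
    fix i assume "i \<in> {..<m}"
    then have i: "i < m" by simp
    have "map_pmf (\<lambda>\<omega>. (\<omega> (i, j), tail (Suc j) i \<omega>)) P = pair_pmf (map_pmf (\<lambda>\<omega>. \<omega> (i, j)) P) (map_pmf (tail (Suc j) i) P)"
      by (rule indep_Pi_pmf [where B="{(i, j)}" and C="{i} \<times> {Suc j..<m}"]) (auto simp: depends_on_def tail_def intro!: sum.cong)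
    then show "map_pmf (\<lambda>\<omega>. (\<omega> (i, j), tail (Suc j) i \<omega>)) P = pair_pmf (p (i, j)) (b i)"
      using i j by (simp add: component_law tail_law b_def)
  qed
  finally show ?thesis .
qed

text \<open>The pairs of an entry in column \<open>j\<close> and the rest of its row are independent
  across rows. This puts the entropy of column \<open>j\<close> given the tails into the form of
  \<open>fibre_tuple_le\<close>, with the entries as \<open>a\<close> and the tails from
  \<open>Suc j\<close> as \<open>b\<close>.\<close>

lemma ent_col_tails:
  assumes j: "j < m"
  defines "P' \<equiv> Pi_pmf {..<m} (0, 0) (\<lambda>i. pair_pmf (p (i, j)) (sumlaw (\<lambda>j'. p (i, j')) {Suc j..<m}))"
    and "S \<equiv> tup {..<m} 0 (\<lambda>i \<omega>. fst (\<omega> i) + snd (\<omega> i))"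
  shows "ent P (\<lambda>\<omega>. (col j \<omega>, tails j \<omega>)) = ent P' (\<lambda>\<omega>. (\<Sum>i<m. fst (\<omega> i), S \<omega>))"
    "ent P (tails j) = ent P' S"
proof -
  have "tail j i \<omega> = \<omega> (i, j) + tail (Suc j) i \<omega>" for i \<omega>
    using j by (simp add: tail_def sum.atLeast_Suc_lessThan)
  then have *: "S (tup {..<m} (0, 0) (\<lambda>i \<omega>. (\<omega> (i, j), tail (Suc j) i \<omega>)) \<omega>) = tails j \<omega>" for \<omega>
    by (auto simp: S_def tup_def)
  have **: "(\<Sum>i<m. fst (tup {..<m} (0, 0) (\<lambda>i \<omega>. (\<omega> (i, j), tail (Suc j) i \<omega>)) \<omega> i)) = col j \<omega>" for \<omega>
    by (simp add: tup_def col_def)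
  show "ent P (\<lambda>\<omega>. (col j \<omega>, tails j \<omega>)) = ent P' (\<lambda>\<omega>. (\<Sum>i<m. fst (\<omega> i), S \<omega>))" "ent P (tails j) = ent P' S"
    unfolding P'_def col_tails_law [OF j, symmetric] ent_map * ** by simp_all
qed

definition tlaw :: "nat \<Rightarrow> nat \<Rightarrow> 'g pmf" where
  "tlaw i j = sumlaw (\<lambda>j'. p (i, j')) {j..<m}"

lemma finite_tlaw [simp]: "finite (set_pmf (tlaw i j))"
  by (simp add: tlaw_def)

lemma tlaw_Suc: "j < m \<Longrightarrow> tlaw i j = conv (p (i, j)) (tlaw i (Suc j))"
proof -
  assume "j < m"
  then have "{j..<m} = insert j {Suc j..<m}" by auto
  then show ?thesis by (simp add: tlaw_def)
qed

lemma total_law: "map_pmf total P = sumlaw (\<lambda>i. tlaw i 0) {..<m}"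
  unfolding total_eq(1) [abs_def]
  by (subst sum_law [where B="\<lambda>i. {i} \<times> {0..<m}"])
    (auto simp: depends_tail disjoint_family_on_def tail_law tlaw_def intro!: conv.cong)

text \<open>The row sum contains the last entry as a summand, so
  \<open>kaimanovich_vershik_madiman\<close> applies with the negated last entry as common
  summand.\<close>

lemma rdist_tlaw_le:
  assumes "m > 0"
  shows "rdist (p (i, m - 1)) (tlaw i 0) \<le> rdist (p (i, m - 1)) (p (i, m - 1)) + (pent (tlaw i 0) - pent (p (i, m - 1))) / 2"
proof -
  let ?a = "p (i, m - 1)" and ?r = "sumlaw (\<lambda>j'. p (i, j')) ({0..<m} - {m - 1})"
  have t: "tlaw i 0 = conv ?a ?r"
    unfolding tlaw_def by (rule conv.remove) (use assms in auto)
  have "pent (conv (conv (neg ?a) ?a) (neg ?r)) + pent (neg ?a) \<le> pent (conv (neg ?a) ?a) + pent (conv (neg ?a) (neg ?r))"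
    by (rule kaimanovich_vershik_madiman) auto
  moreover have "conv (neg ?a) (neg ?r) = neg (tlaw i 0)" by (simp only: t neg_conv)
  moreover have "conv (conv (neg ?a) ?a) (neg ?r) = conv ?a (neg (tlaw i 0))"
    by (simp only: t neg_conv conv.assoc conv.left_commute)
  moreover have "conv (neg ?a) ?a = conv ?a (neg ?a)" by (rule conv_commute)
  ultimately show ?thesis by (simp add: rdist_def field_simps)
qed

text \<open>For each column but the last, near-minimality is applied to the fibres of its entries
  over the tails; for the last it is applied to the tuple of row sums. The m inequalities telescope
  along the rows and combine with \<open>mutual_info_le\<close>, which leaves m times the defect in
  minimality plus the penalty.\<close>

lemma cmi_le:
  assumes m: "m \<ge> 2" and finX: "\<And>i. finite (set_pmf (X i))" and \<eta>: "\<eta> \<ge> 0"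
    and perm: "\<And>j. j < m \<Longrightarrow> \<exists>\<phi>. bij_betw \<phi> {..<m} {..<m} \<and> (\<forall>i<m. p (i, j) = X (\<phi> i))"
    and L: "\<And>i j. i < m \<Longrightarrow> j < m \<Longrightarrow> set_pmf (p (i, j)) \<subseteq> L" "\<And>i. i < m \<Longrightarrow> set_pmf (tlaw i 0) \<subseteq> L"
    and least: "\<And>Y. (\<And>i. i < m \<Longrightarrow> finite (set_pmf (Y i)) \<and> set_pmf (Y i) \<subseteq> L) \<Longrightarrow>
      k \<le> mdist m Y + \<eta> * (\<Sum>i<m. rdist (X i) (Y i))"
  shows "cmi P (cols m) (tails 0) total \<le> m * (mdist m X - k)
     + \<eta> * (m * (\<Sum>i<m. rdist (X i) (X i)) + (\<Sum>i<m. pent (tlaw i 0) - pent (p (i, m - 1))))"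
proof -
  \<comment> \<open>Column \<open>j\<close> lists the \<open>X i\<close> in another order.
    Reordering \<open>Y\<close> accordingly preserves its multidistance and the sum of distances, so
    every column may serve as reference tuple.\<close>
  have least': "k \<le> mdist m Y + \<eta> * (\<Sum>i<m. rdist (p (i, j)) (Y i))"
    if j: "j < m" and Y: "\<And>i. i < m \<Longrightarrow> finite (set_pmf (Y i)) \<and> set_pmf (Y i) \<subseteq> L" for Y j
  proof -
    obtain \<phi> where \<phi>: "bij_betw \<phi> {..<m} {..<m}" "\<And>i. i < m \<Longrightarrow> p (i, j) = X (\<phi> i)"
      using perm [OF j] by auto
    define \<psi> where "\<psi> = the_inv_into {..<m} \<phi>"
    have \<psi>: "bij_betw \<psi> {..<m} {..<m}" unfolding \<psi>_def by (rule bij_betw_the_inv_into [OF \<phi>(1)])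
    have inv: "\<psi> (\<phi> i) = i" if "i < m" for i
      unfolding \<psi>_def using \<phi>(1) that by (intro the_inv_into_f_f) (auto simp: bij_betw_def)
    have "k \<le> mdist m (\<lambda>i. Y (\<psi> i)) + \<eta> * (\<Sum>i<m. rdist (X i) (Y (\<psi> i)))"
      by (rule least) (use Y bij_betwE [OF \<psi>] in auto)
    also have "(\<Sum>i<m. rdist (X i) (Y (\<psi> i))) = (\<Sum>i<m. rdist (X (\<phi> i)) (Y (\<psi> (\<phi> i))))"
      by (rule sum.reindex_bij_betw [OF \<phi>(1), symmetric])
    also have "\<dots> = (\<Sum>i<m. rdist (p (i, j)) (Y i))"
      by (rule sum.cong) (auto simp: \<phi> inv)
    finally show ?thesis by (simp add: mdist_permute [OF \<psi>])
  qed
  have mdp: "mdist m (\<lambda>i. p (i, j)) = mdist m X \<and> (\<Sum>i<m. rdist (p (i, j)) (p (i, j))) = (\<Sum>i<m. rdist (X i) (X i))" if j: "j < m" for j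
  proof -
    obtain \<phi> where \<phi>: "bij_betw \<phi> {..<m} {..<m}" "\<And>i. i < m \<Longrightarrow> p (i, j) = X (\<phi> i)"
      using perm [OF j] by auto
    have "mdist m (\<lambda>i. p (i, j)) = mdist m (\<lambda>i. X (\<phi> i))"
      using conv.cong [of "{..<m}" "{..<m}" "\<lambda>i. p (i, j)" "\<lambda>i. X (\<phi> i)"] by (simp add: \<phi> mdist_def)
    moreover have "(\<Sum>i<m. rdist (p (i, j)) (p (i, j))) = (\<Sum>i<m. rdist (X (\<phi> i)) (X (\<phi> i)))"
      by (simp add: \<phi>)
    ultimately show ?thesis
      using mdist_permute [OF \<phi>(1)] sum.reindex_bij_betw [OF \<phi>(1), of "\<lambda>i. rdist (X i) (X i)"] by simp
  qed
  define G where "G j = ent P (\<lambda>\<omega>. (col j \<omega>, tails j \<omega>)) - ent P (tails j)" for j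
  define A where "A j = (\<Sum>i<m. pent (p (i, j)) + (pent (tlaw i (Suc j)) - pent (tlaw i j)))" for j
  define B where "B j = (\<Sum>i<m. rdist (p (i, j)) (p (i, j)) + (pent (tlaw i j) - pent (tlaw i (Suc j))) / 2)" for j
  have step: "k \<le> G j - A j / m + \<eta> * B j" if j: "j < m" for j
  proof -
    have "k \<le> ent (Pi_pmf {..<m} (0, 0) (\<lambda>i. pair_pmf (p (i, j)) (tlaw i (Suc j)))) (\<lambda>\<omega>. (\<Sum>i<m. fst (\<omega> i), tup {..<m} 0 (\<lambda>i \<omega>. fst (\<omega> i) + snd (\<omega> i)) \<omega>))
       - ent (Pi_pmf {..<m} (0, 0) (\<lambda>i. pair_pmf (p (i, j)) (tlaw i (Suc j)))) (tup {..<m} 0 (\<lambda>i \<omega>. fst (\<omega> i) + snd (\<omega> i)))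
    - (\<Sum>i<m. pent (p (i, j)) + pent (tlaw i (Suc j)) - pent (conv (p (i, j)) (tlaw i (Suc j)))) / m
    + \<eta> * (\<Sum>i<m. rdist (p (i, j)) (p (i, j)) + (pent (conv (p (i, j)) (tlaw i (Suc j))) - pent (tlaw i (Suc j))) / 2)"
      by (rule fibre_tuple_le [where L=L]) (auto simp: \<eta> L j least' [OF j] intro: L(1) [OF _ j, THEN subsetD])
    then show ?thesis
      unfolding G_def A_def B_def ent_col_tails [OF j] tlaw_Suc [OF j, symmetric] by (simp add: tlaw_def add_diff_eq)
  qed
  \<comment> \<open>Full row sums take the place of the fibres of the last column. Their sum is
    \<open>total\<close>, which supplies the entropy subtracted in
    \<open>mutual_info_le\<close>.\<close>
  have "k \<le> mdist m (\<lambda>i. tlaw i 0) + \<eta> * (\<Sum>i<m. rdist (p (i, m - 1)) (tlaw i 0))"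
    by (rule least') (use m L in auto)
  also have "\<dots> \<le> mdist m (\<lambda>i. tlaw i 0) + \<eta> * (\<Sum>i<m. rdist (p (i, m - 1)) (p (i, m - 1)) + (pent (tlaw i 0) - pent (p (i, m - 1))) / 2)"
    by (intro add_left_mono mult_left_mono sum_mono rdist_tlaw_le \<eta>) (use m in auto)
  also have "mdist m (\<lambda>i. tlaw i 0) = ent P total - (\<Sum>i<m. pent (tlaw i 0)) / m"
    by (simp add: mdist_def ent_def total_law)
  finally have last: "k \<le> ent P total - (\<Sum>i<m. pent (tlaw i 0)) / m
      + \<eta> * (\<Sum>i<m. rdist (p (i, m - 1)) (p (i, m - 1)) + (pent (tlaw i 0) - pent (p (i, m - 1))) / 2)" .
  obtain n where n: "m = Suc n" using m by (cases m) auto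
  have nm: "n < m" by (simp add: n)
  have tn: "tlaw i n = p (i, n)" for i 
  proof -
    have "{n..<m} = {n}" using n by auto
    then show ?thesis by (simp add: tlaw_def)
  qed
  have "n * k \<le> (\<Sum>j<n. G j - A j / m + \<eta> * B j)"
    using sum_mono [of "{..<n}" "\<lambda>_. k" "\<lambda>j. G j - A j / m + \<eta> * B j"] step n by simp
  also have "\<dots> = (\<Sum>j<n. G j) - (\<Sum>j<n. A j) / m + \<eta> * (\<Sum>j<n. B j)"
    by (simp add: sum.distrib sum_subtractf sum_divide_distrib sum_distrib_left)
  \<comment> \<open>Along each row the entropies of the tails telescope from the full row sum to the
    last entry; likewise for \<open>B\<close> below.\<close>
  also have "(\<Sum>j<n. A j) = (\<Sum>j<n. \<Sum>i<m. pent (p (i, j))) + (\<Sum>i<m. pent (p (i, n)) - pent (tlaw i 0))"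
  proof -
    have "(\<Sum>j<n. \<Sum>i<m. pent (tlaw i (Suc j)) - pent (tlaw i j)) = (\<Sum>i<m. \<Sum>j<n. pent (tlaw i (Suc j)) - pent (tlaw i j))"
      by (rule sum.swap)
    also have "\<dots> = (\<Sum>i<m. pent (p (i, n)) - pent (tlaw i 0))"
    proof (rule sum.cong [OF refl])
      show "(\<Sum>j<n. pent (tlaw i (Suc j)) - pent (tlaw i j)) = pent (p (i, n)) - pent (tlaw i 0)" for i
        using sum_lessThan_telescope [of "\<lambda>j. pent (tlaw i j)" n] by (simp add: tn)
    qed
    finally show ?thesis unfolding A_def sum.distrib by simp
  qed
  also have "(\<Sum>j<n. B j) = (\<Sum>j<n. \<Sum>i<m. rdist (p (i, j)) (p (i, j))) + (\<Sum>i<m. pent (tlaw i 0) - pent (p (i, n))) / 2"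
  proof -
    have "(\<Sum>j<n. \<Sum>i<m. (pent (tlaw i j) - pent (tlaw i (Suc j))) / 2) = (\<Sum>i<m. \<Sum>j<n. (pent (tlaw i j) - pent (tlaw i (Suc j))) / 2)"
      by (rule sum.swap)
    also have "\<dots> = (\<Sum>i<m. (pent (tlaw i 0) - pent (p (i, n))) / 2)"
    proof (rule sum.cong [OF refl])
      show "(\<Sum>j<n. (pent (tlaw i j) - pent (tlaw i (Suc j))) / 2) = (pent (tlaw i 0) - pent (p (i, n))) / 2" for i
        using sum_lessThan_telescope' [of "\<lambda>j. pent (tlaw i j) / 2" n] by (simp add: tn diff_divide_distrib)
    qed
    finally show ?thesis unfolding B_def sum.distrib sum_divide_distrib by simp
  qed
  also have "(\<Sum>j<n. \<Sum>i<m. rdist (p (i, j)) (p (i, j))) = n * (\<Sum>i<m. rdist (X i) (X i))"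
    using mdp n by simp
  finally have first: "n * k \<le> (\<Sum>j<n. G j) - ((\<Sum>j<n. \<Sum>i<m. pent (p (i, j))) + (\<Sum>i<m. pent (p (i, n)) - pent (tlaw i 0))) / m
     + \<eta> * (n * (\<Sum>i<m. rdist (X i) (X i)) + (\<Sum>i<m. pent (tlaw i 0) - pent (p (i, n))) / 2)" .
  have cols: "(\<Sum>j<m. ent P (col j)) = m * mdist m X + (\<Sum>j<m. \<Sum>i<m. pent (p (i, j))) / m"
  proof -
    have "ent P (col j) = mdist m X + (\<Sum>i<m. pent (p (i, j))) / m" if "j < m" for j
      using mdp [OF that] by (simp add: ent_def col_law [OF that] mdist_def)
    then show ?thesis by (simp add: sum.distrib sum_divide_distrib)
  qed
  \<comment> \<open>\<open>total\<close> is a function of the column sums and also of the row sums,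
    so it drops out of the joint entropies.\<close>
  have "cmi P (cols m) (tails 0) total = ent P (cols m) + ent P (tails 0) - ent P (\<lambda>\<omega>. (cols m \<omega>, tails 0 \<omega>)) - ent P total"
  proof -
    have tc: "total \<omega> = total \<omega>'" if "cols m \<omega> = cols m \<omega>'" for \<omega> \<omega>'
      using that by (auto simp: tup_eq_iff total_eq(2))
    have tt: "total \<omega> = total \<omega>'" if "tails 0 \<omega> = tails 0 \<omega>'" for \<omega> \<omega>'
      using that by (auto simp: tup_eq_iff total_eq(1))
    have "ent P (\<lambda>\<omega>. (cols m \<omega>, total \<omega>)) = ent P (cols m)" by (rule ent_cong) (auto dest: tc)
    moreover have "ent P (\<lambda>\<omega>. (tails 0 \<omega>, total \<omega>)) = ent P (tails 0)" by (rule ent_cong) (auto dest: tt)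
    moreover have "ent P (\<lambda>\<omega>. (cols m \<omega>, tails 0 \<omega>, total \<omega>)) = ent P (\<lambda>\<omega>. (cols m \<omega>, tails 0 \<omega>))"
      by (rule ent_cong) (auto dest: tt)
    ultimately show ?thesis by (simp add: cmi_def)
  qed
  also have "\<dots> \<le> m * mdist m X + (\<Sum>j<m. \<Sum>i<m. pent (p (i, j))) / m - ent P total - (\<Sum>j<n. G j)"
    using mutual_info_le cols n by (simp add: G_def)
  also have "(\<Sum>j<m. \<Sum>i<m. pent (p (i, j))) = (\<Sum>j<n. \<Sum>i<m. pent (p (i, j))) + (\<Sum>i<m. pent (p (i, n)))"
    by (simp add: n)
  finally have "cmi P (cols m) (tails 0) total \<le> m * mdist m X + ((\<Sum>j<n. \<Sum>i<m. pent (p (i, j))) + (\<Sum>i<m. pent (p (i, n)))) / m - ent P total - (\<Sum>j<n. G j)" .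
  moreover have "(\<Sum>i<m. rdist (p (i, n)) (p (i, n)) + (pent (tlaw i 0) - pent (p (i, n))) / 2) =
     (\<Sum>i<m. rdist (X i) (X i)) + (\<Sum>i<m. pent (tlaw i 0) - pent (p (i, n))) / 2"
    using mdp [OF nm] by (simp add: sum.distrib sum_divide_distrib)
  moreover define x where "x = (\<Sum>i<m. pent (tlaw i 0) - pent (p (i, n)))"
  moreover define s1 s2 s3 s4 where "s1 = (\<Sum>j<n. \<Sum>i<m. pent (p (i, j)))" and "s2 = (\<Sum>i<m. pent (p (i, n)))"
    and "s3 = (\<Sum>i<m. pent (tlaw i 0))" and "s4 = (\<Sum>i<m. rdist (X i) (X i))"
  moreover have n': "m - 1 = n" by (simp add: n)
  ultimately have main: "cmi P (cols m) (tails 0) total \<le> m * mdist m X + (s1 + s2) / m - ent P total - (\<Sum>j<n. G j)"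
    "n * k \<le> (\<Sum>j<n. G j) - (s1 + (s2 - s3)) / m + \<eta> * (n * s4 + x / 2)"
    "k \<le> ent P total - s3 / m + \<eta> * (s4 + x / 2)"
    using first last by (simp_all add: sum_subtractf)
  have mn: "real m = real n + 1" by (simp add: n)
  have "m * k = n * k + k" by (simp add: mn distrib_right)
  moreover have "\<eta> * (n * s4 + x / 2) + \<eta> * (s4 + x / 2) = \<eta> * (m * s4 + x)" unfolding mn by (simp add: algebra_simps)
  moreover have "(s1 + (s2 - s3)) / m + s3 / m = (s1 + s2) / m" by (simp add: add_divide_distrib [symmetric])
  moreover have "m * (mdist m X - k) = m * mdist m X - m * k" by (rule right_diff_distrib)
  ultimately show ?thesis using main unfolding n' x_def [symmetric] s4_def [symmetric] by linarith
qed

end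

section \<open>The entropic Balog--Szemeredi--Gowers theorem\<close>

text \<open>Take two copies of the sample point that are conditionally independent given (W, C).
  Since A + B = -C is common to both, A_1 - B_2 = A_2 - B_1. Submodularity for A_1 and B_1 given
  this difference and W then reduces to the pairs (A_1, B_2) and (B_1, A_2).\<close>

lemma entropic_balog_szemeredi_gowers:
  fixes A B C :: "'w \<Rightarrow> 'g::ab_group_add" and W :: "'w \<Rightarrow> 'v"
  assumes fin: "finite (set_pmf P)" and zero: "\<And>\<omega>. \<omega> \<in> set_pmf P \<Longrightarrow> A \<omega> + B \<omega> + C \<omega> = 0"
  defines "V \<equiv> \<lambda>\<omega>. (W \<omega>, C \<omega>)"
  shows "(\<Sum>v\<in>V ` set_pmf P. pmf (map_pmf V P) v * rdist (map_pmf A (fibre P V v)) (map_pmf B (fibre P V v)))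
     \<le> cmi P A B W + cmi P A C W + cmi P B C W"
proof -
  let ?R = "map_pmf V P" and ?K = "fibre P V"
  let ?M = "mix ?R (\<lambda>v. pair_pmf (?K v) (?K v))"
  have finK: "finite (set_pmf (?K v))" if "v \<in> set_pmf ?R" for v
    using that fin by (auto simp: set_fibre)
  have finM: "finite (set_pmf ?M)" by (rule finite_mix) (use fin finK in auto)
  define w1 w2 :: "('v \<times> 'g) \<times> 'w \<times> 'w \<Rightarrow> 'w" where "w1 z = fst (snd z)" and "w2 z = snd (snd z)" for z
  have w1: "map_pmf w1 ?M = P" and w2: "map_pmf w2 ?M = P"
    using map_snd_mix [of "\<lambda>_. fst" ?R "\<lambda>v. pair_pmf (?K v) (?K v)"] map_snd_mix [of "\<lambda>_. snd" ?R "\<lambda>v. pair_pmf (?K v) (?K v)"]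
      bind_fibre [of V P "\<lambda>x. x"]
    by (simp_all add: w1_def [abs_def] w2_def [abs_def] map_fst_pair_pmf map_snd_pair_pmf)
  have e1: "ent ?M (\<lambda>z. F (w1 z)) = ent P F" and e2: "ent ?M (\<lambda>z. F (w2 z)) = ent P F" for F :: "'w \<Rightarrow> 'x"
    using w1 w2 by (simp_all add: ent_map [symmetric])
  have supp: "w1 z \<in> set_pmf P" "w2 z \<in> set_pmf P" "fst z = V (w1 z)" "fst z = V (w2 z)" if "z \<in> set_pmf ?M" for z
    using that unfolding set_mix w1_def w2_def by (auto simp: set_fibre)
  have WC: "W (w2 z) = W (w1 z)" "C (w2 z) = C (w1 z)" if "z \<in> set_pmf ?M" for z
    using supp(3,4) [OF that] by (auto simp: V_def)
  define E where "E z = A (w1 z) - B (w2 z)" for z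
  define W1 where "W1 z = W (w1 z)" for z
  have AB: "A (w1 z) + B (w1 z) = A (w2 z) + B (w2 z)" if "z \<in> set_pmf ?M" for z
    using zero [OF supp(1) [OF that]] zero [OF supp(2) [OF that]] WC(2) [OF that]
    by (metis add_right_cancel)
  have E2: "E z = A (w2 z) - B (w1 z)" if "z \<in> set_pmf ?M" for z
    using AB [OF that] by (simp add: E_def algebra_simps)
  have C_det: "C (w1 z) = - (A (w1 z) + B (w1 z))" if "z \<in> set_pmf ?M" for z
    using zero [OF supp(1) [OF that]] by (metis add_eq_0_iff add.commute)
  have 1: "ent ?M (\<lambda>z. (A (w1 z), B (w1 z), E z, W1 z)) + ent ?M (\<lambda>z. (E z, W1 z))
     \<le> ent ?M (\<lambda>z. (A (w1 z), E z, W1 z)) + ent ?M (\<lambda>z. (B (w1 z), E z, W1 z))"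
    by (rule ent_submod [OF finM])
  have 2: "ent ?M (\<lambda>z. (A (w1 z), E z, W1 z)) + ent P W \<le> ent P (\<lambda>\<omega>. (A \<omega>, W \<omega>)) + ent P (\<lambda>\<omega>. (B \<omega>, W \<omega>))"
  proof -
    have "ent ?M (\<lambda>z. (A (w1 z), E z, W1 z)) = ent ?M (\<lambda>z. (A (w1 z), B (w2 z), W1 z))"
      by (rule ent_cong [OF finM]) (auto simp: E_def)
    moreover have "ent ?M (\<lambda>z. (A (w1 z), B (w2 z), W1 z)) + ent ?M W1 \<le> ent ?M (\<lambda>z. (A (w1 z), W1 z)) + ent ?M (\<lambda>z. (B (w2 z), W1 z))"
      by (rule ent_submod [OF finM])
    moreover have "ent ?M W1 = ent P W" using e1 [of W] by (simp add: W1_def [abs_def])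
    moreover have "ent ?M (\<lambda>z. (A (w1 z), W1 z)) = ent P (\<lambda>\<omega>. (A \<omega>, W \<omega>))" using e1 [of "\<lambda>\<omega>. (A \<omega>, W \<omega>)"] by (simp add: W1_def)
    moreover have "ent ?M (\<lambda>z. (B (w2 z), W1 z)) = ent ?M (\<lambda>z. (B (w2 z), W (w2 z)))"
      by (rule ent_cong [OF finM]) (auto simp: W1_def WC)
    moreover have "\<dots> = ent P (\<lambda>\<omega>. (B \<omega>, W \<omega>))" using e2 [of "\<lambda>\<omega>. (B \<omega>, W \<omega>)"] by simp
    ultimately show ?thesis by simp
  qed
  have 3: "ent ?M (\<lambda>z. (B (w1 z), E z, W1 z)) + ent P W \<le> ent P (\<lambda>\<omega>. (A \<omega>, W \<omega>)) + ent P (\<lambda>\<omega>. (B \<omega>, W \<omega>))"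
  proof -
    have "ent ?M (\<lambda>z. (B (w1 z), E z, W1 z)) = ent ?M (\<lambda>z. (B (w1 z), A (w2 z), W1 z))"
      by (rule ent_cong [OF finM]) (auto simp: E2)
    moreover have "ent ?M (\<lambda>z. (B (w1 z), A (w2 z), W1 z)) + ent ?M W1 \<le> ent ?M (\<lambda>z. (B (w1 z), W1 z)) + ent ?M (\<lambda>z. (A (w2 z), W1 z))"
      by (rule ent_submod [OF finM])
    moreover have "ent ?M W1 = ent P W" using e1 [of W] by (simp add: W1_def [abs_def])
    moreover have "ent ?M (\<lambda>z. (B (w1 z), W1 z)) = ent P (\<lambda>\<omega>. (B \<omega>, W \<omega>))" using e1 [of "\<lambda>\<omega>. (B \<omega>, W \<omega>)"] by (simp add: W1_def)
    moreover have "ent ?M (\<lambda>z. (A (w2 z), W1 z)) = ent ?M (\<lambda>z. (A (w2 z), W (w2 z)))"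
      by (rule ent_cong [OF finM]) (auto simp: W1_def WC)
    moreover have "\<dots> = ent P (\<lambda>\<omega>. (A \<omega>, W \<omega>))" using e2 [of "\<lambda>\<omega>. (A \<omega>, W \<omega>)"] by simp
    ultimately show ?thesis by simp
  qed
  \<comment> \<open>Any two of \<open>A\<close>, \<open>B\<close>, \<open>C\<close> determine the
    third.\<close>
  have V_AB: "ent P (\<lambda>\<omega>. ((A \<omega>, B \<omega>), V \<omega>)) = ent P (\<lambda>\<omega>. (A \<omega>, B \<omega>, W \<omega>))"
    "ent P (\<lambda>\<omega>. (A \<omega>, V \<omega>)) = ent P (\<lambda>\<omega>. (A \<omega>, B \<omega>, W \<omega>))"
    "ent P (\<lambda>\<omega>. (B \<omega>, V \<omega>)) = ent P (\<lambda>\<omega>. (A \<omega>, B \<omega>, W \<omega>))"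
    "ent P (\<lambda>\<omega>. (A \<omega>, C \<omega>, W \<omega>)) = ent P (\<lambda>\<omega>. (A \<omega>, B \<omega>, W \<omega>))"
    "ent P (\<lambda>\<omega>. (B \<omega>, C \<omega>, W \<omega>)) = ent P (\<lambda>\<omega>. (A \<omega>, B \<omega>, W \<omega>))"
    "ent P V = ent P (\<lambda>\<omega>. (C \<omega>, W \<omega>))"
  proof -
    have C: "C \<omega> = - A \<omega> - B \<omega>" if "\<omega> \<in> set_pmf P" for \<omega>
      using zero [OF that] by (metis add_eq_0_iff add.commute diff_conv_add_uminus minus_add_distrib)
    show "ent P (\<lambda>\<omega>. ((A \<omega>, B \<omega>), V \<omega>)) = ent P (\<lambda>\<omega>. (A \<omega>, B \<omega>, W \<omega>))"
      "ent P (\<lambda>\<omega>. (A \<omega>, V \<omega>)) = ent P (\<lambda>\<omega>. (A \<omega>, B \<omega>, W \<omega>))"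
      "ent P (\<lambda>\<omega>. (B \<omega>, V \<omega>)) = ent P (\<lambda>\<omega>. (A \<omega>, B \<omega>, W \<omega>))"
      "ent P (\<lambda>\<omega>. (A \<omega>, C \<omega>, W \<omega>)) = ent P (\<lambda>\<omega>. (A \<omega>, B \<omega>, W \<omega>))"
      "ent P (\<lambda>\<omega>. (B \<omega>, C \<omega>, W \<omega>)) = ent P (\<lambda>\<omega>. (A \<omega>, B \<omega>, W \<omega>))"
      "ent P V = ent P (\<lambda>\<omega>. (C \<omega>, W \<omega>))"
      by (rule ent_cong [OF fin]; auto simp: V_def C)+
  qed
  have pentR: "pent ?R = ent P V" by (simp add: ent_def)
  \<comment> \<open>A_1, B_1, the difference and W recover A_2, B_2 and V, so this entropy is H(V) +
    2 H(A, B | V) by conditional independence.\<close>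
  have 4: "ent ?M (\<lambda>z. (A (w1 z), B (w1 z), E z, W1 z)) = 2 * ent P (\<lambda>\<omega>. (A \<omega>, B \<omega>, W \<omega>)) - ent P V"
  proof -
    have "ent ?M (\<lambda>z. (A (w1 z), B (w1 z), E z, W1 z)) = ent ?M (\<lambda>z. (((A (fst (snd z)), B (fst (snd z))), (A (snd (snd z)), B (snd (snd z)))), fst z))"
    proof (rule ent_cong [OF finM])
      fix z z' assume z: "z \<in> set_pmf ?M" "z' \<in> set_pmf ?M"
      have "fst y = (W1 y, - (A (w1 y) + B (w1 y)))" "B (w2 y) = A (w1 y) - E y" "A (w2 y) = E y + B (w1 y)" if "y \<in> set_pmf ?M" for y
      proof -
        show "fst y = (W1 y, - (A (w1 y) + B (w1 y)))"
          using supp(3) [OF that] C_det [OF that] by (auto simp: V_def W1_def)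
        show "B (w2 y) = A (w1 y) - E y" by (simp add: E_def)
        show "A (w2 y) = E y + B (w1 y)" using E2 [OF that] by simp
      qed
      note this [OF z(1)] this [OF z(2)]
      then show "((((A (fst (snd z)), B (fst (snd z))), (A (snd (snd z)), B (snd (snd z)))), fst z) = (((A (fst (snd z')), B (fst (snd z'))), (A (snd (snd z')), B (snd (snd z')))), fst z'))
         = ((A (w1 z), B (w1 z), E z, W1 z) = (A (w1 z'), B (w1 z'), E z', W1 z'))"
        unfolding w1_def [symmetric] w2_def [symmetric] by auto
    qed
    also have "\<dots> = pent ?R + (\<Sum>v\<in>set_pmf ?R. pmf ?R v * ent (pair_pmf (?K v) (?K v)) (\<lambda>\<omega>. ((A (fst \<omega>), B (fst \<omega>)), (A (snd \<omega>), B (snd \<omega>)))))"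
      by (rule ent_mix [where X="\<lambda>v \<omega>. ((A (fst \<omega>), B (fst \<omega>)), (A (snd \<omega>), B (snd \<omega>)))"]) (use fin finK in auto)
    also have "(\<Sum>v\<in>set_pmf ?R. pmf ?R v * ent (pair_pmf (?K v) (?K v)) (\<lambda>\<omega>. ((A (fst \<omega>), B (fst \<omega>)), (A (snd \<omega>), B (snd \<omega>)))))
       = (\<Sum>v\<in>set_pmf ?R. 2 * (pmf ?R v * ent (?K v) (\<lambda>\<omega>. (A \<omega>, B \<omega>))))"
      by (rule sum.cong [OF refl]) (use ent_pair [of "?K _" "?K _" "\<lambda>\<omega>. (A \<omega>, B \<omega>)" "\<lambda>\<omega>. (A \<omega>, B \<omega>)"] finK in simp)
    also have "\<dots> = 2 * (ent P (\<lambda>\<omega>. (A \<omega>, B \<omega>, W \<omega>)) - ent P V)"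
      using sum_fibre_ent [OF fin, of V "\<lambda>\<omega>. (A \<omega>, B \<omega>)"] unfolding V_AB sum_distrib_left [symmetric] by simp
    finally show ?thesis by (simp add: pentR)
  qed
  \<comment> \<open>The left side is H(A_1 - B_2 | V); as W is a component of V, it is at most H(A_1
    - B_2 | W).\<close>
  have 5: "(\<Sum>v\<in>set_pmf ?R. pmf ?R v * pent (conv (map_pmf A (?K v)) (neg (map_pmf B (?K v))))) \<le> ent ?M (\<lambda>z. (E z, W1 z)) - ent P W"
  proof -
    have c: "conv (map_pmf A (?K v)) (neg (map_pmf B (?K v))) = map_pmf (\<lambda>\<omega>. A (fst \<omega>) - B (snd \<omega>)) (pair_pmf (?K v) (?K v))" for v
      using conv_map_pair [of A "?K v" "\<lambda>\<omega>. - B \<omega>" "?K v"] by (simp add: neg_def map_pmf_comp)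
    have "ent ?M (\<lambda>z. (A (fst (snd z)) - B (snd (snd z)), fst z)) = pent ?R + (\<Sum>v\<in>set_pmf ?R. pmf ?R v * ent (pair_pmf (?K v) (?K v)) (\<lambda>\<omega>. A (fst \<omega>) - B (snd \<omega>)))"
      by (rule ent_mix [where X="\<lambda>v \<omega>. A (fst \<omega>) - B (snd \<omega>)"]) (use fin finK in auto)
    moreover have "(\<lambda>z. (A (fst (snd z)) - B (snd (snd z)), fst z)) = (\<lambda>z. (E z, fst z))" by (auto simp: E_def w1_def w2_def)
    moreover have "ent ?M (\<lambda>z. (E z, fst z, W1 z)) + ent ?M W1 \<le> ent ?M (\<lambda>z. (E z, W1 z)) + ent ?M (\<lambda>z. (fst z, W1 z))"
      by (rule ent_submod [OF finM])
    moreover have W1f: "W1 z = fst (fst z)" if "z \<in> set_pmf ?M" for z using supp(3) [OF that] by (simp add: W1_def V_def)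
    have "ent ?M (\<lambda>z. (E z, fst z, W1 z)) = ent ?M (\<lambda>z. (E z, fst z))" "ent ?M (\<lambda>z. (fst z, W1 z)) = ent ?M fst"
      by (rule ent_cong [OF finM]; auto simp: W1f)+
    moreover have "ent ?M fst = pent ?R" by (simp add: ent_def map_fst_mix)
    moreover have "ent ?M W1 = ent P W" using e1 [of W] by (simp add: W1_def [abs_def])
    ultimately show ?thesis by (simp add: c ent_def)
  qed
  have 6: "(\<Sum>v\<in>set_pmf ?R. pmf ?R v * pent (map_pmf A (?K v))) = ent P (\<lambda>\<omega>. (A \<omega>, B \<omega>, W \<omega>)) - ent P V"
    "(\<Sum>v\<in>set_pmf ?R. pmf ?R v * pent (map_pmf B (?K v))) = ent P (\<lambda>\<omega>. (A \<omega>, B \<omega>, W \<omega>)) - ent P V"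
    using sum_fibre_ent [OF fin, of V A] sum_fibre_ent [OF fin, of V B] unfolding V_AB by (simp_all add: ent_def)
  have "(\<Sum>v\<in>set_pmf ?R. pmf ?R v * rdist (map_pmf A (?K v)) (map_pmf B (?K v))) =
    (\<Sum>v\<in>set_pmf ?R. pmf ?R v * pent (conv (map_pmf A (?K v)) (neg (map_pmf B (?K v)))))
     - (\<Sum>v\<in>set_pmf ?R. pmf ?R v * pent (map_pmf A (?K v))) / 2 - (\<Sum>v\<in>set_pmf ?R. pmf ?R v * pent (map_pmf B (?K v))) / 2"
    by (simp add: rdist_def sum_subtractf sum.distrib sum_divide_distrib algebra_simps)
  also have "\<dots> \<le> cmi P A B W + cmi P A C W + cmi P B C W"
    using 1 2 3 4 5 unfolding 6 cmi_def V_AB by simp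
  finally show ?thesis by simp
qed

section \<open>Iterated sumsets\<close>

primrec sums_of :: "nat \<Rightarrow> 'g::ab_group_add set \<Rightarrow> 'g set" where
  "sums_of 0 S = {0}"
| "sums_of (Suc n) S = (\<lambda>(x, y). x + y) ` (sums_of n S \<times> S)"

lemma sums_of_add: "x \<in> sums_of a S \<Longrightarrow> y \<in> sums_of b S \<Longrightarrow> x + y \<in> sums_of (a + b) S"
proof (induction b arbitrary: y)
  case (Suc b)
  then obtain u v where "y = u + v" "u \<in> sums_of b S" "v \<in> S" by auto
  then have "x + u \<in> sums_of (a + b) S" using Suc by auto
  then have "(x + u) + v \<in> sums_of (a + Suc b) S" using \<open>v \<in> S\<close> by force
  then show ?case using \<open>y = u + v\<close> by (simp add: add.assoc)
qed simp

lemma sums_of_mono: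
  assumes "0 \<in> S" "a \<le> b" shows "sums_of a S \<subseteq> sums_of b S"
proof (rule lift_Suc_mono_le [where f="\<lambda>n. sums_of n S", OF _ assms(2)])
  show "sums_of n S \<subseteq> sums_of (Suc n) S" for n
    using assms(1) by (force simp: image_iff)
qed

lemma sums_of_1: "sums_of 1 S = S" by (auto simp: image_iff)

lemma sums_of_mult: "x \<in> sums_of a (sums_of b S) \<Longrightarrow> x \<in> sums_of (a * b) S"
proof (induction a arbitrary: x)
  case (Suc a)
  then obtain u v where "x = u + v" "u \<in> sums_of a (sums_of b S)" "v \<in> sums_of b S" by auto
  then show ?case using sums_of_add [of u "a * b" S v b] Suc by (simp add: add.commute)
qed simp

lemma sum_in_sums_of: "finite I \<Longrightarrow> (\<And>i. i \<in> I \<Longrightarrow> f i \<in> sums_of b S) \<Longrightarrow> sum f I \<in> sums_of (card I * b) S"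
proof (induction I rule: finite_induct)
  case (insert i I)
  then show ?case using sums_of_add [of "f i" b S "sum f I" "card I * b"] by simp
qed simp

lemma smul_in_sums_of: "x \<in> S \<Longrightarrow> smul n x \<in> sums_of n S"
proof (induction n)
  case (Suc n)
  then show ?case using sums_of_add [of "x" 1 S "smul n x" n] by (simp add: sums_of_1 plus_1_eq_Suc del: sums_of.simps One_nat_def)
qed simp

lemma sumlaw_in_sums_of: "finite I \<Longrightarrow> (\<And>i. i \<in> I \<Longrightarrow> set_pmf (X i) \<subseteq> S) \<Longrightarrow> set_pmf (sumlaw X I) \<subseteq> sums_of (card I) S"
proof (induction I rule: finite_induct)
  case (insert i I)
  have IH: "set_pmf (sumlaw X I) \<subseteq> sums_of (card I) S" and i: "set_pmf (X i) \<subseteq> S" using insert by auto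
  show ?case
  proof
    fix z assume "z \<in> set_pmf (sumlaw X (insert i I))"
    then obtain a b where "z = a + b" "a \<in> set_pmf (X i)" "b \<in> set_pmf (sumlaw X I)"
      using insert(1,2) by (auto simp: set_conv)
    then have "z = b + a" "a \<in> S" "b \<in> sums_of (card I) S"
      using IH i by (auto simp: add.commute)
    then show "z \<in> sums_of (card (insert i I)) S"
      using insert(1,2) by force
  qed
qed simp

section \<open>Decreasing the multidistance\<close>

text \<open>
  This is \<open>- i - j\<close> modulo \<open>m\<close>.
\<close>

definition antidiag :: "nat \<Rightarrow> nat \<Rightarrow> nat \<Rightarrow> nat" where
  "antidiag m i j = (if i + j = 0 then 0 else if i + j \<le> m then m - i - j else 2 * m - i - j)"

lemma antidiag_less: "i < m \<Longrightarrow> j < m \<Longrightarrow> antidiag m i j < m"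
  by (auto simp: antidiag_def)

lemma antidiag_invol: "i < m \<Longrightarrow> j < m \<Longrightarrow> antidiag m i (antidiag m i j) = j"
  by (auto simp: antidiag_def)

lemma antidiag_commute: "antidiag m i j = antidiag m j i"
  by (auto simp: antidiag_def)

lemma antidiag_sum: "i < m \<Longrightarrow> j < m \<Longrightarrow> (i + j + antidiag m i j) mod m = 0"
  by (auto simp: antidiag_def)

lemma bij_antidiag: "i < m \<Longrightarrow> bij_betw (antidiag m i) {..<m} {..<m}"
  by (rule bij_betw_byWitness [where f'="antidiag m i"]) (auto simp: antidiag_less antidiag_invol)

lemma bij_antidiag': "j < m \<Longrightarrow> bij_betw (\<lambda>i. antidiag m i j) {..<m} {..<m}"
  using bij_antidiag [of j m] by (simp add: antidiag_commute [of m _ j])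

context tuple
begin

abbreviation "I2 \<equiv> {..<m} \<times> {..<m}"
abbreviation "PY \<equiv> Pi_pmf I2 0 (\<lambda>k. X (fst k))"

lemma finPY: "finite (set_pmf PY)"
  using fin by simp

text \<open>Cell (i, j) of the rearranged array receives the entry at \<open>e (i, j)\<close>. Each
  column must meet every original row once, so that it carries the whole tuple \<open>X\<close>; of
  the rows only their entropies matter. The bound consists of m \<eta> D from the defect and 2 m^2
  \<eta> D from each of the two penalty sums.\<close>

lemma cmi_arrangement:
  fixes \<eta> :: real
  assumes e: "bij_betw e I2 I2" and \<eta>: "\<eta> \<ge> 0"
    and perm: "\<And>j. j < m \<Longrightarrow> \<exists>\<phi>. bij_betw \<phi> {..<m} {..<m} \<and> (\<forall>i<m. fst (e (i, j)) = \<phi> i)"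
    and rows: "(\<Sum>i<m. pent (sumlaw (\<lambda>j. X (fst (e (i, j)))) {0..<m}) - pent (X (fst (e (i, m - 1))))) \<le> 2 * m\<^sup>2 * D"
    and L: "\<And>i. i < m \<Longrightarrow> set_pmf (X i) \<subseteq> L"
      "\<And>i. i < m \<Longrightarrow> set_pmf (sumlaw (\<lambda>j. X (fst (e (i, j)))) {0..<m}) \<subseteq> L"
    and least: "\<And>Y. (\<And>i. i < m \<Longrightarrow> finite (set_pmf (Y i)) \<and> set_pmf (Y i) \<subseteq> L) \<Longrightarrow>
      (1 - \<eta>) * D \<le> mdist m Y + \<eta> * (\<Sum>i<m. rdist (X i) (Y i))"
    and F: "\<And>\<omega> \<omega>'. (\<And>j. j < m \<Longrightarrow> (\<Sum>i<m. \<omega> (e (i, j))) = (\<Sum>i<m. \<omega>' (e (i, j)))) \<Longrightarrow> F \<omega> = F \<omega>'"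
    and G: "\<And>\<omega> \<omega>'. (\<And>i. i < m \<Longrightarrow> (\<Sum>j<m. \<omega> (e (i, j))) = (\<Sum>j<m. \<omega>' (e (i, j)))) \<Longrightarrow> G \<omega> = G \<omega>'"
  shows "cmi PY F G (matrix.total m) \<le> (4 * m\<^sup>2 + m) * \<eta> * D"
proof -
  interpret M: matrix m "\<lambda>k. X (fst (e k))"
    by unfold_locales (rule fin)
  define re where "re = tup I2 0 (\<lambda>k \<omega>. \<omega> (e k) :: 'g)"
  have e_mem: "e k \<in> I2" if "k \<in> I2" for k using bij_betwE [OF e] that by blast
  have P: "M.P = map_pmf re PY"
  proof -
    have "map_pmf re PY = Pi_pmf I2 0 (\<lambda>k. map_pmf (\<lambda>\<omega>. \<omega> (e k)) PY)"
      unfolding re_def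
      by (rule tup_law [where B="\<lambda>k. {e k}"])
        (use e in \<open>auto simp: depends_on_def disjoint_family_on_def bij_betw_def inj_on_def\<close>)
    also have "\<dots> = M.P"
      by (rule Pi_pmf_cong) (use e_mem in \<open>auto simp: Pi_pmf_component mem_Times_iff\<close>)
    finally show ?thesis ..
  qed
  have re: "re \<omega> (i, j) = \<omega> (e (i, j))" if "i < m" "j < m" for i j \<omega>
    using that by (simp add: re_def tup_def)
  have total: "M.total (re \<omega>) = M.total \<omega>" for \<omega> :: "nat \<times> nat \<Rightarrow> 'g"
  proof -
    have "M.total (re \<omega>) = (\<Sum>i<m. \<Sum>j<m. \<omega> (e (i, j)))"
      unfolding M.total_def by (intro sum.cong) (auto simp: re)
    also have "\<dots> = (\<Sum>k\<in>I2. \<omega> (e k))" by (simp add: sum.cartesian_product)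
    also have "\<dots> = (\<Sum>k\<in>I2. \<omega> k)" by (rule sum.reindex_bij_betw [OF e])
    finally show ?thesis by (simp add: M.total_def sum.cartesian_product)
  qed
  have tl: "M.tlaw i 0 = sumlaw (\<lambda>j. X (fst (e (i, j)))) {0..<m}" for i by (simp add: M.tlaw_def)
  have "cmi PY F G M.total \<le> cmi PY (\<lambda>\<omega>. M.cols m (re \<omega>)) (\<lambda>\<omega>. M.tails 0 (re \<omega>)) M.total"
  proof (rule cmi_mono [OF finPY])
    fix \<omega> \<omega>' :: "nat \<times> nat \<Rightarrow> 'g"
    assume "M.cols m (re \<omega>) = M.cols m (re \<omega>')"
    then show "F \<omega> = F \<omega>'"
      by (intro F) (simp add: tup_eq_iff M.col_def re)
  next
    fix \<omega> \<omega>' :: "nat \<times> nat \<Rightarrow> 'g"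
    assume "M.tails 0 (re \<omega>) = M.tails 0 (re \<omega>')"
    then show "G \<omega> = G \<omega>'"
      by (intro G) (simp add: tup_eq_iff M.tail_def re atLeast0LessThan)
  qed
  also have "\<dots> = cmi M.P (M.cols m) (M.tails 0) M.total"
    unfolding P cmi_def ent_map by (simp add: total)
  also have "\<dots> \<le> m * (D - (1 - \<eta>) * D)
     + \<eta> * (m * (\<Sum>i<m. rdist (X i) (X i)) + (\<Sum>i<m. pent (M.tlaw i 0) - pent (X (fst (e (i, m - 1))))))"
  proof (rule M.cmi_le [where L=L and X=X and k="(1 - \<eta>) * D"])
    show "m \<ge> 2" by (rule m)
    show "\<eta> \<ge> 0" by (rule \<eta>)
    show "finite (set_pmf (X i))" for i by (rule fin)
    show "\<exists>\<phi>. bij_betw \<phi> {..<m} {..<m} \<and> (\<forall>i<m. X (fst (e (i, j))) = X (\<phi> i))" if "j < m" for j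
      using perm [OF that] by metis
    show "set_pmf (X (fst (e (i, j)))) \<subseteq> L" if "i < m" "j < m" for i j
      by (rule L(1)) (use e_mem [of "(i, j)"] that in \<open>auto simp: mem_Times_iff\<close>)
    show "set_pmf (M.tlaw i 0) \<subseteq> L" if "i < m" for i using L(2) [OF that] by (simp add: tl)
  qed (rule least)
  also have "\<dots> \<le> m * (D - (1 - \<eta>) * D) + \<eta> * (m * (2 * m * D) + 2 * m\<^sup>2 * D)"
    using rows sum_rdist_self_le unfolding tl by (intro add_left_mono mult_left_mono add_mono \<eta>) auto
  also have "\<dots> = (4 * m\<^sup>2 + m) * \<eta> * D" by (simp add: algebra_simps power2_eq_square)
  finally show ?thesis .
qed

section \<open>The three weighted sums of the array\<close>

definition "Z1 \<omega> = (\<Sum>i<m. \<Sum>j<m. smul i (\<omega> (i, j) :: 'g))"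
definition "Z2 \<omega> = (\<Sum>i<m. \<Sum>j<m. smul j (\<omega> (i, j) :: 'g))"
definition "Z3 \<omega> = (\<Sum>i<m. \<Sum>j<m. smul (antidiag m i j) (\<omega> (i, j) :: 'g))"
abbreviation "W \<equiv> matrix.total m :: (nat \<times> nat \<Rightarrow> 'g) \<Rightarrow> 'g"

lemma Z1_rows: "Z1 \<omega> = (\<Sum>i<m. smul i (\<Sum>j<m. \<omega> (i, j)))" 
  by (simp add: Z1_def smul_sum)

lemma Z2_cols: "Z2 \<omega> = (\<Sum>j<m. smul j (\<Sum>i<m. \<omega> (i, j)))"
  unfolding Z2_def smul_sum by (rule sum.swap)

text \<open>For fixed i the map \<open>antidiag m i\<close> is an involution, so reindexing by it
  makes the weight equal to the column index of the array whose columns are the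
  antidiagonals.\<close>

lemma Z3_antidiag: "Z3 \<omega> = (\<Sum>j<m. smul j (\<Sum>i<m. \<omega> (i, antidiag m i j)))"
proof -
  have "Z3 \<omega> = (\<Sum>i<m. \<Sum>j<m. smul (antidiag m i (antidiag m i j)) (\<omega> (i, antidiag m i j)))"
    unfolding Z3_def
    by (rule sum.cong [OF refl], rule sum.reindex_bij_betw [symmetric], rule bij_antidiag) simp
  also have "\<dots> = (\<Sum>i<m. \<Sum>j<m. smul j (\<omega> (i, antidiag m i j)))"
    by (intro sum.cong refl) (simp add: antidiag_invol)
  also have "\<dots> = (\<Sum>j<m. smul j (\<Sum>i<m. \<omega> (i, antidiag m i j)))"
    unfolding smul_sum by (rule sum.swap)
  finally show ?thesis .
qed

lemma Z3_antidiag': "Z3 \<omega> = (\<Sum>i<m. smul i (\<Sum>j<m. \<omega> (antidiag m i j, j)))"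
proof -
  have "Z3 \<omega> = (\<Sum>j<m. \<Sum>i<m. smul (antidiag m i j) (\<omega> (i, j)))"
    unfolding Z3_def by (rule sum.swap)
  also have "\<dots> = (\<Sum>j<m. \<Sum>i<m. smul (antidiag m (antidiag m i j) j) (\<omega> (antidiag m i j, j)))"
    by (rule sum.cong [OF refl], rule sum.reindex_bij_betw [symmetric], rule bij_antidiag') simp
  also have "\<dots> = (\<Sum>j<m. \<Sum>i<m. smul i (\<omega> (antidiag m i j, j)))"
    by (intro sum.cong refl) (simp add: antidiag_invol antidiag_commute [of m _ "_ :: nat"] antidiag_commute)
  also have "\<dots> = (\<Sum>i<m. smul i (\<Sum>j<m. \<omega> (antidiag m i j, j)))"
    unfolding smul_sum by (rule sum.swap)
  finally show ?thesis .
qed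

lemma PY_mem: "\<omega> \<in> set_pmf PY \<Longrightarrow> i < m \<Longrightarrow> j < m \<Longrightarrow> \<omega> (i, j) \<in> set_pmf (X i)"
  by (auto simp: set_Pi_pmf PiE_dflt_def)

lemma Z_sum:
  assumes tor: "\<And>i x. i < m \<Longrightarrow> x \<in> set_pmf (X i) \<Longrightarrow> smul m x = 0" and \<omega>: "\<omega> \<in> set_pmf PY"
  shows "Z2 \<omega> + Z1 \<omega> + Z3 \<omega> = 0"
proof -
  have "Z2 \<omega> + Z1 \<omega> + Z3 \<omega> = (\<Sum>i<m. \<Sum>j<m. smul (j + i + antidiag m i j) (\<omega> (i, j)))"
    by (simp add: Z1_def Z2_def Z3_def sum.distrib smul_add_left)
  also have "\<dots> = (\<Sum>i<m. \<Sum>j<m. 0)"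
  proof (intro sum.cong refl)
    fix i j assume "i \<in> {..<m}" "j \<in> {..<m}"
    then have ij: "i < m" "j < m" by auto
    have "smul (j + i + antidiag m i j) (\<omega> (i, j)) = smul ((j + i + antidiag m i j) mod m) (\<omega> (i, j))"
      by (rule smul_mod [symmetric]) (use tor PY_mem [OF \<omega> ij] ij in auto)
    then show "smul (j + i + antidiag m i j) (\<omega> (i, j)) = 0"
      using antidiag_sum [OF ij] by (simp add: add.commute)
  qed
  finally show ?thesis by simp
qed

lemma col_Q: "j < m \<Longrightarrow> map_pmf (\<lambda>\<omega>. \<Sum>i<m. \<omega> (i, j)) PY = Q"
proof -
  assume j: "j < m"
  interpret M: matrix m "\<lambda>k. X (fst k)" by unfold_locales (rule fin)
  show ?thesis using M.col_law [OF j] by (simp add: M.col_def [abs_def])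
qed

lemma Z2_law: "map_pmf Z2 PY = Zlaw"
proof -
  have "map_pmf Z2 PY = sumlaw (\<lambda>j. map_pmf (\<lambda>\<omega>. smul j (\<Sum>i<m. \<omega> (i, j))) PY) {..<m}"
    unfolding Z2_cols [abs_def]
    by (rule sum_law [where B="\<lambda>j. {..<m} \<times> {j}"])
      (auto simp: depends_on_def disjoint_family_on_def intro!: arg_cong [where f="smul _"] sum.cong)
  also have "\<dots> = Zlaw"
  proof (rule conv.cong [OF refl])
    fix j assume "j \<in> {..<m}"
    then have "map_pmf (smul j) (map_pmf (\<lambda>\<omega>. \<Sum>i<m. \<omega> (i, j)) PY) = map_pmf (smul j) Q"
      by (simp add: col_Q)
    then show "map_pmf (\<lambda>\<omega>. smul j (\<Sum>i<m. \<omega> (i, j))) PY = map_pmf (smul j) Q"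
      by (simp add: map_pmf_comp)
  qed
  finally show ?thesis .
qed

text \<open>Column 0 has weight 0 in \<open>Z2\<close>. Given the other columns, \<open>Z2\<close>
  is fixed while the total keeps the entropy of Q. The information is thus at most H(W) - H(Q), and
  W is a sum of m independent copies of Q.\<close>

lemma info_Z2_W: "ent PY Z2 + ent PY W - ent PY (\<lambda>\<omega>. (Z2 \<omega>, W \<omega>)) \<le> m\<^sup>2 * D"
proof -
  interpret M: matrix m "\<lambda>k. X (fst k)" by unfold_locales (rule fin)
  define R where "R = tup ({..<m} \<times> {1..<m}) 0 (\<lambda>k \<omega>. \<omega> k :: 'g)"
  have R: "\<omega> (i, j) = \<omega>' (i, j)" if "R \<omega> = R \<omega>'" "i < m" "j < m" "j \<noteq> 0" for \<omega> \<omega>' i j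
    using that by (auto simp: R_def tup_eq_iff)
  have Z2R: "Z2 \<omega> = Z2 \<omega>'" if "R \<omega> = R \<omega>'" for \<omega> \<omega>'
    unfolding Z2_def
  proof (intro sum.cong refl)
    fix i j assume "i \<in> {..<m}" "j \<in> {..<m}"
    then show "smul j (\<omega> (i, j)) = smul j (\<omega>' (i, j))" using R [OF that, of i j] by (cases "j = 0") auto
  qed
  have WR: "W \<omega> = W \<omega>' \<longleftrightarrow> M.col 0 \<omega> = M.col 0 \<omega>'" if "R \<omega> = R \<omega>'" for \<omega> \<omega>'
  proof -
    have "W \<omega> = M.col 0 \<omega> + (\<Sum>j\<in>{1..<m}. M.col j \<omega>)" for \<omega>
    proof -
      have "{..<m} = insert 0 {1..<m}" using m by auto
      then show ?thesis unfolding M.total_eq(2) by simp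
    qed
    moreover have "(\<Sum>j\<in>{1..<m}. M.col j \<omega>) = (\<Sum>j\<in>{1..<m}. M.col j \<omega>')"
      unfolding M.col_def by (intro sum.cong refl R [OF that]) auto
    ultimately show ?thesis by simp
  qed
  have "ent PY (\<lambda>\<omega>. (W \<omega>, R \<omega>, Z2 \<omega>)) + ent PY Z2 \<le> ent PY (\<lambda>\<omega>. (W \<omega>, Z2 \<omega>)) + ent PY (\<lambda>\<omega>. (R \<omega>, Z2 \<omega>))"
    by (rule ent_submod [OF finPY])
  moreover have "ent PY (\<lambda>\<omega>. (R \<omega>, Z2 \<omega>)) = ent PY R"
    by (rule ent_cong [OF finPY]) (auto dest: Z2R)
  moreover have "ent PY (\<lambda>\<omega>. (W \<omega>, R \<omega>, Z2 \<omega>)) = ent PY (\<lambda>\<omega>. (M.col 0 \<omega>, R \<omega>))"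
    by (rule ent_cong [OF finPY]) (auto dest: Z2R WR)
  moreover have "\<dots> = ent PY (M.col 0) + ent PY R"
    by (rule ent_indep_Pi_pmf [where B="{..<m} \<times> {0}" and C="{..<m} \<times> {1..<m}"])
      (auto simp: fin M.depends_col R_def, auto simp: depends_on_def tup_eq_iff)
  moreover have "ent PY (M.col 0) = pent Q"
    using col_Q [of 0] m by (simp add: ent_def M.col_def [abs_def])
  moreover have "ent PY (\<lambda>\<omega>. (W \<omega>, Z2 \<omega>)) = ent PY (\<lambda>\<omega>. (Z2 \<omega>, W \<omega>))"
    by (rule ent_cong [OF finPY]) auto
  moreover have "ent PY W = pent (sumlaw (\<lambda>_. Q) {..<m})"
  proof -
    have "map_pmf W PY = sumlaw (\<lambda>j. map_pmf (M.col j) PY) {..<m}"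
      unfolding M.total_eq(2) [abs_def]
      by (rule sum_law [where B="\<lambda>j. {..<m} \<times> {j}"]) (auto simp: M.depends_col disjoint_family_on_def)
    also have "\<dots> = sumlaw (\<lambda>_. Q) {..<m}"
      by (rule conv.cong) (auto simp: M.col_def [abs_def] col_Q)
    finally show ?thesis by (simp add: ent_def)
  qed
  moreover have "pent (sumlaw (\<lambda>_. Q) {..<m}) - pent Q \<le> m\<^sup>2 * D"
  proof -
    obtain n where n: "m = Suc n" using m by (cases m) auto
    have "pent (sumlaw (\<lambda>_. Q) {..<Suc n}) - pent Q \<le> n * (pent (conv Q Q) - pent Q)"
      by (rule pent_sumlaw_iid_le) simp
    also have "\<dots> \<le> m * (m * D)"
      using pent_Q_Q D_nonneg pent_conv_ge [OF fin_Q fin_Q] by (intro mult_mono) (auto simp: n)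
    finally show ?thesis unfolding n [symmetric] by (simp add: power2_eq_square mult.assoc)
  qed
  ultimately show ?thesis by linarith
qed

text \<open>If the claim fails, \<open>X\<close> is nearly minimal among tuples supported in
  \<open>L\<close>. The 40 comes from the final count: the bound c on each conditional information
  satisfies m c \<le> D / 8, so the fibres cost at most 6 D / 8 and the penalty about 3 D / 40,
  together less than (1 - \<eta>) D.\<close>

lemma decrement:
  assumes D: "D > 0" and S0: "0 \<in> S" and S: "\<And>i. i < m \<Longrightarrow> set_pmf (X i) \<subseteq> S"
    and tor: "\<And>x. x \<in> S \<Longrightarrow> smul m x = 0"
  defines "\<eta> \<equiv> 1 / (40 * real m ^ 3)"
  shows "\<exists>Y. (\<forall>i. finite (set_pmf (Y i))) \<and> (\<forall>i<m. set_pmf (Y i) \<subseteq> sums_of (m ^ 3) S) \<and>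
    mdist m Y + \<eta> * (\<Sum>i<m. rdist (X i) (Y i)) \<le> (1 - \<eta>) * D"
proof (rule ccontr)
  assume neg: "\<not> ?thesis"
  \<comment> \<open>Length m^3 suffices for the entries, the row sums and the values of
    \<open>Z2\<close>, which are sums of m^2 entries with multiplicities below m.\<close>
  define L where "L = sums_of (m ^ 3) S"
  have m0: "real m > 0" and \<eta>0: "\<eta> \<ge> 0" using m by (auto simp: \<eta>_def)
  have \<eta>m: "real m ^ 3 * \<eta> = 1 / 40" using m0 by (simp add: \<eta>_def)
  have m3: "real m ^ 3 \<ge> 8" using power_mono [of 2 "real m" 3] m by simp
  have least: "(1 - \<eta>) * D \<le> mdist m Y + \<eta> * (\<Sum>i<m. rdist (X i) (Y i))"
    if Y: "\<And>i. i < m \<Longrightarrow> finite (set_pmf (Y i)) \<and> set_pmf (Y i) \<subseteq> L" for Y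
  proof (rule ccontr)
    \<comment> \<open>The negated claim asks for finite supports at all indices, so \<open>Y\<close>
      is padded by point masses beyond \<open>m\<close>.\<close>
    define Y' where "Y' i = (if i < m then Y i else return_pmf 0)" for i
    assume *: "\<not> ?thesis"
    have "sumlaw Y' {..<m} = sumlaw Y {..<m}" by (rule conv.cong) (auto simp: Y'_def)
    then have "mdist m Y' = mdist m Y" by (simp add: mdist_def Y'_def)
    moreover have "(\<Sum>i<m. rdist (X i) (Y' i)) = (\<Sum>i<m. rdist (X i) (Y i))" by (simp add: Y'_def)
    ultimately have "mdist m Y' + \<eta> * (\<Sum>i<m. rdist (X i) (Y' i)) \<le> (1 - \<eta>) * D" using * by simp
    moreover have "finite (set_pmf (Y' i))" "i < m \<Longrightarrow> set_pmf (Y' i) \<subseteq> sums_of (m ^ 3) S" for i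
      using Y by (auto simp: Y'_def L_def)
    ultimately show False using neg by blast
  qed
  have SL: "S \<subseteq> L" "sums_of m S \<subseteq> L"
    using sums_of_mono [OF S0, of 1 "m ^ 3"] sums_of_mono [OF S0, of m "m ^ 3"] m self_le_power [of m 3]
    unfolding L_def sums_of_1 by auto
  have L: "set_pmf (X i) \<subseteq> L" if "i < m" for i using S [OF that] SL by blast
  have rowL: "set_pmf (sumlaw (\<lambda>j. X (g j)) {0..<m}) \<subseteq> L" if "\<And>j. j < m \<Longrightarrow> g j < m" for g
    using sumlaw_in_sums_of [of "{0..<m}" "\<lambda>j. X (g j)" S] S that SL by auto
  let ?c = "(4 * m\<^sup>2 + m) * \<eta> * D"
  have row_iid: "(\<Sum>i<m. pent (sumlaw (\<lambda>j. X i) {0..<m}) - pent (X i)) \<le> 2 * m\<^sup>2 * D"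
  proof -
    have "(\<Sum>i<m. pent (sumlaw (\<lambda>j. X i) {0..<m}) - pent (X i)) \<le> (\<Sum>i<m. m * rdist (X i) (X i))"
      unfolding atLeast0LessThan by (intro sum_mono mdist_iid_le fin) (use m in auto)
    also have "\<dots> \<le> m * (2 * m * D)"
      unfolding sum_distrib_left [symmetric] using sum_rdist_self_le by (intro mult_left_mono) auto
    finally show ?thesis by (simp add: power2_eq_square algebra_simps)
  qed
  \<comment> \<open>The array as it stands: \<open>Z2\<close> is a function of the column sums and
    \<open>Z1\<close> of the row sums.\<close>
  have c12: "cmi PY Z2 Z1 W \<le> ?c"
  proof (rule cmi_arrangement [where e="\<lambda>k. k" and L=L])
    show "\<exists>\<phi>. bij_betw \<phi> {..<m} {..<m} \<and> (\<forall>i<m. fst (i, j) = \<phi> i)" if "j < m" for j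
      by (rule exI [of _ "\<lambda>i. i"]) (auto simp: bij_betw_def)
    show "(\<Sum>i<m. pent (sumlaw (\<lambda>j. X (fst (i, j))) {0..<m}) - pent (X (fst (i, m - 1)))) \<le> 2 * m\<^sup>2 * D"
      using row_iid by simp
    show "Z2 \<omega> = Z2 \<omega>'" if "\<And>j. j < m \<Longrightarrow> (\<Sum>i<m. \<omega> (i, j)) = (\<Sum>i<m. \<omega>' (i, j))" for \<omega> \<omega>'
      unfolding Z2_cols by (simp add: that)
    show "Z1 \<omega> = Z1 \<omega>'" if "\<And>i. i < m \<Longrightarrow> (\<Sum>j<m. \<omega> (i, j)) = (\<Sum>j<m. \<omega>' (i, j))" for \<omega> \<omega>'
      unfolding Z1_rows by (simp add: that)
  qed (auto simp: bij_betw_def \<eta>0 L rowL intro: least)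
  \<comment> \<open>A permutation within each row turns antidiagonals into columns and preserves the
    row sums.\<close>
  have c13: "cmi PY Z3 Z1 W \<le> ?c"
  proof (rule cmi_arrangement [where e="\<lambda>k. (fst k, antidiag m (fst k) (snd k))" and L=L])
    show "bij_betw (\<lambda>k. (fst k, antidiag m (fst k) (snd k))) I2 I2"
      by (rule bij_betw_byWitness [where f'="\<lambda>k. (fst k, antidiag m (fst k) (snd k))"]) (auto simp: antidiag_invol antidiag_less)
    show "\<exists>\<phi>. bij_betw \<phi> {..<m} {..<m} \<and> (\<forall>i<m. fst (fst (i, j), antidiag m (fst (i, j)) (snd (i, j))) = \<phi> i)" if "j < m" for j
      by (rule exI [of _ "\<lambda>i. i"]) (auto simp: bij_betw_def)
    show "(\<Sum>i<m. pent (sumlaw (\<lambda>j. X (fst (fst (i, j), antidiag m (fst (i, j)) (snd (i, j))))) {0..<m})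
      - pent (X (fst (fst (i, m - 1), antidiag m (fst (i, m - 1)) (snd (i, m - 1)))))) \<le> 2 * m\<^sup>2 * D"
      using row_iid by simp
    show "Z3 \<omega> = Z3 \<omega>'" if "\<And>j. j < m \<Longrightarrow> (\<Sum>i<m. \<omega> (fst (i, j), antidiag m (fst (i, j)) (snd (i, j)))) = (\<Sum>i<m. \<omega>' (fst (i, j), antidiag m (fst (i, j)) (snd (i, j))))" for \<omega> \<omega>'
      using that unfolding Z3_antidiag by simp
    show "Z1 \<omega> = Z1 \<omega>'" if "\<And>i. i < m \<Longrightarrow> (\<Sum>j<m. \<omega> (fst (i, j), antidiag m (fst (i, j)) (snd (i, j)))) = (\<Sum>j<m. \<omega>' (fst (i, j), antidiag m (fst (i, j)) (snd (i, j))))" for \<omega> \<omega>'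
    proof -
      have "(\<Sum>j<m. \<omega> (i, antidiag m i j)) = (\<Sum>j<m. \<omega> (i, j))" if "i < m" for i and \<omega> :: "nat \<times> nat \<Rightarrow> 'g"
        by (rule sum.reindex_bij_betw [OF bij_antidiag [OF that]])
      with that show ?thesis unfolding Z1_rows by simp
    qed
  qed (auto simp: \<eta>0 L rowL intro: least)
  \<comment> \<open>A permutation within each column turns antidiagonals into rows. Now every row
    contains each \<open>X i\<close> once, so its sum is distributed as \<open>Q\<close> and not as
    a sum of m copies of one \<open>X i\<close>.\<close>
  have c23: "cmi PY Z2 Z3 W \<le> ?c"
  proof (rule cmi_arrangement [where e="\<lambda>k. (antidiag m (fst k) (snd k), snd k)" and L=L])
    show "bij_betw (\<lambda>k. (antidiag m (fst k) (snd k), snd k)) I2 I2"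
      by (rule bij_betw_byWitness [where f'="\<lambda>k. (antidiag m (fst k) (snd k), snd k)"])
        (auto simp: antidiag_invol antidiag_less antidiag_commute [of m _ "_ :: nat"], (metis antidiag_invol antidiag_commute)+)
    show "\<exists>\<phi>. bij_betw \<phi> {..<m} {..<m} \<and> (\<forall>i<m. fst (antidiag m (fst (i, j)) (snd (i, j)), snd (i, j)) = \<phi> i)" if "j < m" for j
      by (rule exI [of _ "\<lambda>i. antidiag m i j"]) (auto simp: bij_antidiag' that)
    show "(\<Sum>i<m. pent (sumlaw (\<lambda>j. X (fst (antidiag m (fst (i, j)) (snd (i, j)), snd (i, j)))) {0..<m})
      - pent (X (fst (antidiag m (fst (i, m - 1)) (snd (i, m - 1)), snd (i, m - 1))))) \<le> 2 * m\<^sup>2 * D"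
    proof -
      have "sumlaw (\<lambda>j. X (antidiag m i j)) {0..<m} = Q" if "i < m" for i
        unfolding atLeast0LessThan by (rule conv.reindex_bij_betw [OF bij_antidiag [OF that]])
      then have "(\<Sum>i<m. pent (sumlaw (\<lambda>j. X (antidiag m i j)) {0..<m}) - pent (X (antidiag m i (m - 1))))
         = (\<Sum>i<m. pent Q - pent (X (antidiag m i (m - 1))))"
        by simp
      also have "\<dots> = (\<Sum>i<m. pent Q - pent (X i))"
        by (rule sum.reindex_bij_betw [OF bij_antidiag']) (use m in auto)
      also have "\<dots> = m * D" by (rule sum_diff_Q)
      also have "\<dots> \<le> 2 * m\<^sup>2 * D"
        using D m by (intro mult_right_mono) (auto simp: power2_eq_square)
      finally show ?thesis by simp
    qed
    show "Z2 \<omega> = Z2 \<omega>'" if "\<And>j. j < m \<Longrightarrow> (\<Sum>i<m. \<omega> (antidiag m (fst (i, j)) (snd (i, j)), snd (i, j))) = (\<Sum>i<m. \<omega>' (antidiag m (fst (i, j)) (snd (i, j)), snd (i, j)))" for \<omega> \<omega>'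
    proof -
      have "(\<Sum>i<m. \<omega> (antidiag m i j, j)) = (\<Sum>i<m. \<omega> (i, j))" if "j < m" for j and \<omega> :: "nat \<times> nat \<Rightarrow> 'g"
        by (rule sum.reindex_bij_betw [OF bij_antidiag' [OF that]])
      with that show ?thesis unfolding Z2_cols by simp
    qed
    show "Z3 \<omega> = Z3 \<omega>'" if "\<And>i. i < m \<Longrightarrow> (\<Sum>j<m. \<omega> (antidiag m (fst (i, j)) (snd (i, j)), snd (i, j))) = (\<Sum>j<m. \<omega>' (antidiag m (fst (i, j)) (snd (i, j)), snd (i, j)))" for \<omega> \<omega>'
      using that unfolding Z3_antidiag' by simp
  qed (auto simp: \<eta>0 L rowL antidiag_less intro: least)
  define V where "V \<omega> = (W \<omega>, Z3 \<omega>)" for \<omega>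
  let ?U = "\<lambda>v. map_pmf Z2 (fibre PY V v)" and ?B = "\<lambda>v. map_pmf Z1 (fibre PY V v)"
  let ?w = "\<lambda>v. pmf (map_pmf V PY) v"
  have zero: "Z2 \<omega> + Z1 \<omega> + Z3 \<omega> = 0" if "\<omega> \<in> set_pmf PY" for \<omega>
    by (rule Z_sum) (use that tor S in auto)
  have UB: "(\<Sum>v\<in>V ` set_pmf PY. ?w v * rdist (?U v) (?B v)) \<le> 3 * ?c"
    using entropic_balog_szemeredi_gowers [where P=PY and A=Z2 and B=Z1 and C=Z3 and W=W, OF finPY zero] c12 c13 c23
    by (simp add: V_def [abs_def] cmi_commute [OF finPY, of Z1 Z3])
  \<comment> \<open>By the chain rule I(Z2 : V) = I(Z2 : W) + I(Z2 : Z3 | W).\<close>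
  have XU: "(\<Sum>v\<in>V ` set_pmf PY. ?w v * rdist (X i) (?U v)) \<le> rdist (X i) Zlaw + (m\<^sup>2 * D + ?c) / 2" for i
  proof -
    have "(\<Sum>v\<in>V ` set_pmf PY. ?w v * rdist (X i) (?U v)) \<le> rdist (X i) (map_pmf Z2 PY) + (ent PY Z2 + ent PY V - ent PY (\<lambda>\<omega>. (Z2 \<omega>, V \<omega>))) / 2"
      by (rule sum_fibre_rdist [OF finPY fin])
    moreover have "ent PY V = ent PY (\<lambda>\<omega>. (Z3 \<omega>, W \<omega>))"
      by (rule ent_cong [OF finPY]) (auto simp: V_def)
    moreover have "ent PY (\<lambda>\<omega>. (Z2 \<omega>, V \<omega>)) = ent PY (\<lambda>\<omega>. (Z2 \<omega>, Z3 \<omega>, W \<omega>))"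
      by (rule ent_cong [OF finPY]) (auto simp: V_def)
    moreover have "s \<le> r + (x + y) / 2"
      if "s \<le> r + (a + v - b) / 2" "v = c" "b = d" "a + w - e \<le> x" "e + c - d - w \<le> y" for s r a v b c d e w x y :: real
      using that by (simp add: field_simps)
    ultimately show ?thesis
      using info_Z2_W c23 unfolding Z2_law cmi_def by blast
  qed
  \<comment> \<open>Near-minimality for m independent copies of the fibre of \<open>Z2\<close>. Its
    self-distance is at most twice the distance to the fibre of \<open>Z1\<close>, which is what the
    Balog--Szemeredi--Gowers theorem bounds.\<close>
  have point: "(1 - \<eta>) * D \<le> 2 * m * rdist (?U v) (?B v) + \<eta> * (\<Sum>i<m. rdist (X i) (?U v))" if v: "v \<in> V ` set_pmf PY" for v
  proof -
    have finU: "finite (set_pmf (?U v))" "finite (set_pmf (?B v))" using finPY v by (auto simp: set_fibre)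
    have "Z2 \<omega> \<in> L" if \<omega>: "\<omega> \<in> set_pmf PY" for \<omega>
    proof -
      have "smul j (\<omega> (i, j)) \<in> sums_of m S" if "i < m" "j < m" for i j
        using smul_in_sums_of [of "\<omega> (i, j)" S j] PY_mem [OF \<omega> that] S [OF that(1)] sums_of_mono [OF S0, of j m] that by auto
      then have "(\<Sum>j<m. smul j (\<omega> (i, j))) \<in> sums_of (m * m) S" if "i < m" for i
        using sum_in_sums_of [of "{..<m}" "\<lambda>j. smul j (\<omega> (i, j))" m S] that by auto
      then show ?thesis
        using sum_in_sums_of [of "{..<m}" "\<lambda>i. \<Sum>j<m. smul j (\<omega> (i, j))" "m * m" S]
        by (auto simp: L_def Z2_def power3_eq_cube mult.assoc)
    qed
    then have "set_pmf (?U v) \<subseteq> L" using v by (auto simp: set_fibre)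
    then have "(1 - \<eta>) * D \<le> mdist m (\<lambda>_. ?U v) + \<eta> * (\<Sum>i<m. rdist (X i) (?U v))"
      using finU by (intro least) auto
    moreover have "mdist m (\<lambda>_. ?U v) \<le> m * rdist (?U v) (?U v)"
      by (rule mdist_iid_le) (use finU m in auto)
    moreover have "rdist (?U v) (?U v) \<le> 2 * rdist (?U v) (?B v)"
      using rdist_triangle [OF finU(1) finU(2) finU(1)] by (simp add: rdist_commute)
    then have "m * rdist (?U v) (?U v) \<le> m * (2 * rdist (?U v) (?B v))" by (rule mult_left_mono) simp
    ultimately show ?thesis by simp
  qed
  have "(1 - \<eta>) * D = (\<Sum>v\<in>V ` set_pmf PY. ?w v * ((1 - \<eta>) * D))"
    using sum_pmf_eq_1' [of "map_pmf V PY"] finPY by (simp add: sum_distrib_right [symmetric])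
  also have "\<dots> \<le> (\<Sum>v\<in>V ` set_pmf PY. ?w v * (2 * m * rdist (?U v) (?B v) + \<eta> * (\<Sum>i<m. rdist (X i) (?U v))))"
    by (intro sum_mono mult_left_mono point) auto
  also have "\<dots> = 2 * m * (\<Sum>v\<in>V ` set_pmf PY. ?w v * rdist (?U v) (?B v)) + \<eta> * (\<Sum>v\<in>V ` set_pmf PY. \<Sum>i<m. ?w v * rdist (X i) (?U v))"
    unfolding sum_distrib_left sum.distrib [symmetric] by (intro sum.cong refl) (simp add: algebra_simps sum_distrib_left)
  also have "(\<Sum>v\<in>V ` set_pmf PY. \<Sum>i<m. ?w v * rdist (X i) (?U v)) = (\<Sum>i<m. \<Sum>v\<in>V ` set_pmf PY. ?w v * rdist (X i) (?U v))"
    by (rule sum.swap)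
  also have "2 * m * (\<Sum>v\<in>V ` set_pmf PY. ?w v * rdist (?U v) (?B v)) + \<eta> * (\<Sum>i<m. \<Sum>v\<in>V ` set_pmf PY. ?w v * rdist (X i) (?U v))
     \<le> 2 * m * (3 * ?c) + \<eta> * (\<Sum>i<m. rdist (X i) Zlaw + (m\<^sup>2 * D + ?c) / 2)"
    by (intro add_mono mult_left_mono sum_mono UB XU \<eta>0) auto
  also have "(\<Sum>i<m. rdist (X i) Zlaw + (m\<^sup>2 * D + ?c) / 2) \<le> 5 / 2 * m ^ 3 * D + m * ((m\<^sup>2 * D + ?c) / 2)"
    using sum_rdist_Zlaw_le by (simp add: sum.distrib)
  finally have "(1 - \<eta>) * D \<le> 2 * m * (3 * ?c) + \<eta> * (5 / 2 * m ^ 3 * D + m * ((m\<^sup>2 * D + ?c) / 2))"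
    using \<eta>0 by (simp add: mult_left_mono)
  moreover have mc: "m * ?c \<le> D / 8"
  proof -
    have "real m * (4 * m\<^sup>2 + m) \<le> 5 * real m ^ 3"
      using m by (simp add: power2_eq_square power3_eq_cube algebra_simps)
    then have "real m * (4 * m\<^sup>2 + m) * (\<eta> * D) \<le> 5 * real m ^ 3 * (\<eta> * D)"
      using \<eta>0 D by (intro mult_right_mono) auto
    also have "\<dots> = 5 * (real m ^ 3 * \<eta>) * D" by simp
    also have "\<dots> = D / 8" unfolding \<eta>m by simp
    finally show ?thesis by (simp add: mult.assoc)
  qed
  moreover have "\<eta> * (5 / 2 * m ^ 3 * D + m * ((m\<^sup>2 * D + ?c) / 2)) = 3 * (real m ^ 3 * \<eta>) * D + \<eta> * (m * ?c) / 2"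
    by (simp add: power2_eq_square power3_eq_cube field_simps)
  moreover have "\<eta> \<le> 1 / 320"
    using m3 m0 by (simp add: \<eta>_def field_simps)
  moreover have "\<eta> * (m * ?c) \<le> 1 / 320 * (D / 8)"
    using \<open>\<eta> \<le> 1 / 320\<close> mc \<eta>0 D by (intro mult_mono) auto
  moreover have "\<eta> * D \<le> 1 / 320 * D" using \<open>\<eta> \<le> 1 / 320\<close> D by (intro mult_right_mono) auto
  moreover have "2 * m * (3 * ?c) = 6 * (m * ?c)" by (simp only: mult.assoc mult.left_commute)
  moreover have "(1 - \<eta>) * D = D - \<eta> * D" by (simp add: left_diff_distrib)
  moreover have False
    if "a \<le> b + c" "y \<le> D / 8" "c = 3 * (1 / 40) * D + z / 2" "z \<le> 1 / 320 * (D / 8)" "w \<le> 1 / 320 * D" "b = 6 * y" "a = D - w" for a b c y z w :: real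
    using that D by simp
  ultimately show False unfolding \<eta>m by blast
qed

end

section \<open>Distributions of very small self-distance\<close>

text \<open>Total variation distance at most \<open>t\<close>. In terms of events, compatibility
  with images under maps is immediate.\<close>

definition tv_close :: "real \<Rightarrow> 'a pmf \<Rightarrow> 'a pmf \<Rightarrow> bool" where
  "tv_close t p q \<longleftrightarrow> (\<forall>E. \<bar>measure p E - measure q E\<bar> \<le> t)"

lemma tv_close_triangle: "tv_close s p q \<Longrightarrow> tv_close t q r \<Longrightarrow> tv_close (s + t) p r"
  unfolding tv_close_def
proof (intro allI)
  fix E assume *: "\<forall>E. \<bar>measure p E - measure q E\<bar> \<le> s" "\<forall>E. \<bar>measure q E - measure r E\<bar> \<le> t"
  show "\<bar>measure p E - measure r E\<bar> \<le> s + t" using *(1)[rule_format, of E] *(2)[rule_format, of E] by linarith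
qed

lemma tv_close_commute: "tv_close s p q \<Longrightarrow> tv_close s q p"
  by (simp add: tv_close_def abs_minus_commute)

lemma tv_close_map: "tv_close s p q \<Longrightarrow> tv_close s (map_pmf f p) (map_pmf f q)"
  by (simp add: tv_close_def)

lemma measure_pmf_sum:
  assumes "finite F" "set_pmf p \<subseteq> F"
  shows "measure p E = (\<Sum>z\<in>F \<inter> E. pmf p z)"
proof -
  have "measure p E = measure p (E \<inter> F)"
    using assms(2) by (intro measure_pmf.finite_measure_eq_AE) (auto simp: AE_measure_pmf_iff)
  then show ?thesis using assms(1) by (simp add: measure_measure_pmf_finite Int_commute)
qed

text \<open>Relative entropy dominates the squared Hellinger distance because \<open>- ln t \<ge> 2 (1 - sqrt t)\<close>.\<close>

lemma measure_diff_le_relative_entropy: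
  assumes fin: "finite (set_pmf q)" and sub: "set_pmf p \<subseteq> set_pmf q"
  shows "(measure p E - measure q E)\<^sup>2 \<le> 4 * (\<Sum>z\<in>set_pmf p. pmf p z * ln (pmf p z / pmf q z))"
proof -
  let ?F = "set_pmf q"
  let ?a = "\<lambda>z. sqrt (pmf p z)" and ?b = "\<lambda>z. sqrt (pmf q z)"
  have sp: "(\<Sum>z\<in>?F. pmf p z) = 1" and sq: "(\<Sum>z\<in>?F. pmf q z) = 1"
    using fin sub by (auto intro!: sum_pmf_eq_1)
  have "\<bar>measure p E - measure q E\<bar> = \<bar>\<Sum>z\<in>?F \<inter> E. pmf p z - pmf q z\<bar>"
    using measure_pmf_sum [OF fin sub, of E] measure_pmf_sum [OF fin order_refl, of E] by (simp add: sum_subtractf)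
  also have "\<dots> \<le> (\<Sum>z\<in>?F \<inter> E. \<bar>pmf p z - pmf q z\<bar>)" by (rule sum_abs)
  also have "\<dots> \<le> (\<Sum>z\<in>?F. \<bar>pmf p z - pmf q z\<bar>)" by (rule sum_mono2) (use fin in auto)
  \<comment> \<open>p - q factors as the difference times the sum of the square roots.
    Cauchy-Schwarz separates the squared Hellinger distance from the second factor, which
    contributes the constant 4.\<close>
  also have "\<dots> = (\<Sum>z\<in>?F. \<bar>?a z - ?b z\<bar> * (?a z + ?b z))"
  proof (rule sum.cong [OF refl])
    fix z
    have "pmf p z - pmf q z = (?a z - ?b z) * (?a z + ?b z)" by (simp add: algebra_simps)
    then show "\<bar>pmf p z - pmf q z\<bar> = \<bar>?a z - ?b z\<bar> * (?a z + ?b z)" by (simp add: abs_mult)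
  qed
  finally have "(measure p E - measure q E)\<^sup>2 \<le> (\<Sum>z\<in>?F. \<bar>?a z - ?b z\<bar> * (?a z + ?b z))\<^sup>2"
    using power_mono [of "\<bar>measure p E - measure q E\<bar>" _ 2] by simp
  also have "\<dots> \<le> (\<Sum>z\<in>?F. \<bar>?a z - ?b z\<bar>\<^sup>2) * (\<Sum>z\<in>?F. (?a z + ?b z)\<^sup>2)"
    by (rule Cauchy_Schwarz_ineq_sum)
  finally have 0: "(measure p E - measure q E)\<^sup>2 \<le> (\<Sum>z\<in>?F. \<bar>?a z - ?b z\<bar>\<^sup>2) * (\<Sum>z\<in>?F. (?a z + ?b z)\<^sup>2)" .
  have "(\<Sum>z\<in>?F. (?a z + ?b z)\<^sup>2) \<le> (\<Sum>z\<in>?F. 2 * pmf p z + 2 * pmf q z)"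
  proof (rule sum_mono)
    fix z
    have "(?a z + ?b z)\<^sup>2 + (?a z - ?b z)\<^sup>2 = 2 * pmf p z + 2 * pmf q z"
      by (simp add: power2_eq_square algebra_simps)
    then show "(?a z + ?b z)\<^sup>2 \<le> 2 * pmf p z + 2 * pmf q z"
      using zero_le_power2 [of "?a z - ?b z"] by linarith
  qed
  also have "\<dots> = 4" by (simp add: sum.distrib sum_distrib_left [symmetric] sp sq)
  finally have 4: "(\<Sum>z\<in>?F. (?a z + ?b z)\<^sup>2) \<le> 4" .
  have "(\<Sum>z\<in>?F. \<bar>?a z - ?b z\<bar>\<^sup>2) = 2 - 2 * (\<Sum>z\<in>?F. ?a z * ?b z)"
  proof -
    have "(\<Sum>z\<in>?F. \<bar>?a z - ?b z\<bar>\<^sup>2) = (\<Sum>z\<in>?F. pmf p z + pmf q z - 2 * (?a z * ?b z))"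
      by (rule sum.cong) (auto simp: power2_eq_square algebra_simps)
    then show ?thesis by (simp add: sum.distrib sum_subtractf sum_distrib_left [symmetric] sp sq)
  qed
  also have "(\<Sum>z\<in>?F. ?a z * ?b z) = (\<Sum>z\<in>set_pmf p. ?a z * ?b z)"
    by (rule sum.mono_neutral_right [OF fin sub]) (auto simp: set_pmf_iff)
  finally have h: "(\<Sum>z\<in>?F. \<bar>?a z - ?b z\<bar>\<^sup>2) = 2 - 2 * (\<Sum>z\<in>set_pmf p. ?a z * ?b z)" .
  have "(measure p E - measure q E)\<^sup>2 \<le> (\<Sum>z\<in>?F. \<bar>?a z - ?b z\<bar>\<^sup>2) * 4"
    by (rule order_trans [OF 0 mult_left_mono [OF 4]]) (simp add: sum_nonneg)
  then have 1: "(measure p E - measure q E)\<^sup>2 \<le> (2 - 2 * (\<Sum>z\<in>set_pmf p. ?a z * ?b z)) * 4"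
    by (simp only: h)
  have fp: "finite (set_pmf p)" using fin sub by (rule rev_finite_subset)
  have "(\<Sum>z\<in>set_pmf p. 2 * pmf p z - 2 * (?a z * ?b z)) \<le> (\<Sum>z\<in>set_pmf p. pmf p z * ln (pmf p z / pmf q z))"
  proof (rule sum_mono)
    fix z assume z: "z \<in> set_pmf p"
    then have pos: "pmf p z > 0" "pmf q z > 0" using sub by (auto simp: pmf_positive)
    have "ln (?b z / ?a z) \<le> ?b z / ?a z - 1" by (rule ln_le_minus_one) (use pos in simp)
    moreover have "ln (pmf p z / pmf q z) = - 2 * ln (?b z / ?a z)"
      using pos by (simp add: ln_div ln_sqrt)
    ultimately have "2 - 2 * (?b z / ?a z) \<le> ln (pmf p z / pmf q z)" by simp
    then have "pmf p z * (2 - 2 * (?b z / ?a z)) \<le> pmf p z * ln (pmf p z / pmf q z)"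
      using pos by (intro mult_left_mono) auto
    moreover have "pmf p z * (2 - 2 * (?b z / ?a z)) = 2 * pmf p z - 2 * (?a z * ?b z)"
    proof -
      have "pmf p z / ?a z = ?a z" by (simp add: real_div_sqrt)
      moreover have "pmf p z * (2 - 2 * (?b z / ?a z)) = 2 * pmf p z - 2 * (pmf p z / ?a z * ?b z)"
        by (simp add: algebra_simps)
      ultimately show ?thesis by simp
    qed
    ultimately show "2 * pmf p z - 2 * (?a z * ?b z) \<le> pmf p z * ln (pmf p z / pmf q z)" by simp
  qed
  then have "2 - 2 * (\<Sum>z\<in>set_pmf p. ?a z * ?b z) \<le> (\<Sum>z\<in>set_pmf p. pmf p z * ln (pmf p z / pmf q z))"
    using sum_pmf_eq_1' [OF fp] by (simp add: sum_subtractf sum_distrib_left [symmetric])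
  then have "(2 - 2 * (\<Sum>z\<in>set_pmf p. ?a z * ?b z)) * 4 \<le> (\<Sum>z\<in>set_pmf p. pmf p z * ln (pmf p z / pmf q z)) * 4"
    by (rule mult_right_mono) simp
  with 1 show ?thesis by (simp only: mult.commute [of 4])
qed

section \<open>Subgroups, cosets and uniform distributions\<close>

definition add_subgroup :: "'g::ab_group_add set \<Rightarrow> bool" where
  "add_subgroup H \<longleftrightarrow> 0 \<in> H \<and> (\<forall>x\<in>H. \<forall>y\<in>H. x - y \<in> H)"

text \<open>As a function of its second argument this is the quotient map, with the coset itself as
  value; \<open>ent p (coset H)\<close> is the entropy of \<open>p\<close> modulo
  \<open>H\<close>.\<close>

definition coset :: "'g::ab_group_add set \<Rightarrow> 'g \<Rightarrow> 'g set" where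
  "coset H x = {y. y - x \<in> H}"

lemma add_subgroup_uminus: "add_subgroup H \<Longrightarrow> x \<in> H \<Longrightarrow> - x \<in> H"
  using diff_0 [of x] unfolding add_subgroup_def by fastforce

lemma add_subgroup_add: "add_subgroup H \<Longrightarrow> x \<in> H \<Longrightarrow> y \<in> H \<Longrightarrow> x + y \<in> H"
  using add_subgroup_uminus [of H y] unfolding add_subgroup_def by (metis diff_minus_eq_add)

lemma coset_eq_iff:
  assumes "add_subgroup H"
  shows "coset H x = coset H y \<longleftrightarrow> x - y \<in> H"
proof
  assume "coset H x = coset H y"
  moreover have "x \<in> coset H x" using assms by (simp add: coset_def add_subgroup_def)
  ultimately show "x - y \<in> H" by (simp add: coset_def)
next
  assume xy: "x - y \<in> H"
  have "z - x \<in> H \<longleftrightarrow> z - y \<in> H" for z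
    using add_subgroup_add [OF assms, of "z - x" "x - y"] add_subgroup_add [OF assms, of "z - y" "- (x - y)"] xy
      add_subgroup_uminus [OF assms xy] by auto
  then show "coset H x = coset H y" by (auto simp: coset_def)
qed

lemma pmf_coset: "add_subgroup H \<Longrightarrow> pmf (map_pmf (coset H) p) (coset H x) = measure p (coset H x)"
proof -
  assume H: "add_subgroup H"
  have "coset H -` {coset H x} = coset H x" 
    unfolding vimage_def singleton_iff coset_eq_iff [OF H] by (simp only: coset_def)
  then show ?thesis by (simp add: pmf_map)
qed

text \<open>Adding a uniform element of \<open>H\<close> spreads the mass of each coset evenly over
  that coset.\<close>

lemma pent_conv_uniform:
  assumes fin: "finite (set_pmf p)" and H: "add_subgroup H" "finite H"
  shows "pent (conv p (pmf_of_set H)) = ent p (coset H) + ln (real (card H))"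
proof -
  let ?u = "pmf_of_set H"
  have ne: "H \<noteq> {}" using H(1) by (auto simp: add_subgroup_def)
  then have cH: "real (card H) > 0" using H(2) by (simp add: card_gt_0_iff)
  have set_u: "set_pmf ?u = H" using ne H(2) by simp
  have F: "finite (set_pmf (pair_pmf p ?u))" using fin set_u H(2) by simp
  have pm: "pmf (conv p ?u) (x + h) = measure p (coset H x) / card H" if "h \<in> H" for x h
  proof -
    have "pmf (conv p ?u) (x + h) = (\<Sum>\<omega> | \<omega> \<in> set_pmf (pair_pmf p ?u) \<and> fst \<omega> + snd \<omega> = x + h. pmf (pair_pmf p ?u) \<omega>)"
      unfolding conv_def by (rule pmf_map_sum [OF F])
    also have "\<dots> = (\<Sum>y\<in>set_pmf p \<inter> coset H x. pmf p y / card H)"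
    proof (rule sum.reindex_bij_witness [where i="\<lambda>y. (y, x + h - y)" and j=fst])
      fix \<omega> assume w: "\<omega> \<in> {\<omega>. \<omega> \<in> set_pmf (pair_pmf p ?u) \<and> fst \<omega> + snd \<omega> = x + h}"
      then have *: "fst \<omega> + snd \<omega> = x + h" "fst \<omega> \<in> set_pmf p" "snd \<omega> \<in> H"
        unfolding set_pair_pmf set_u mem_Collect_eq mem_Times_iff by blast+
      show "(fst \<omega>, x + h - fst \<omega>) = \<omega>" by (simp add: *(1) [symmetric] prod_eq_iff)
      have "fst \<omega> - x = (fst \<omega> + snd \<omega>) - x - snd \<omega>" by simp
      then have "fst \<omega> - x = h - snd \<omega>" unfolding *(1) by simp
      then show "fst \<omega> \<in> set_pmf p \<inter> coset H x"
        using *(2,3) H(1) that unfolding coset_def add_subgroup_def by simp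
      show "pmf p (fst \<omega>) / card H = pmf (pair_pmf p ?u) \<omega>"
        using *(3) ne H(2) by (cases \<omega>) (simp add: pmf_pair)
    next
      fix y assume y: "y \<in> set_pmf p \<inter> coset H x"
      have "h - (y - x) \<in> H" using y that H(1) unfolding add_subgroup_def coset_def by simp
      moreover have "h - (y - x) = x + h - y" by simp
      ultimately have "x + h - y \<in> H" by (simp only:)
      then show "(y, x + h - y) \<in> {\<omega>. \<omega> \<in> set_pmf (pair_pmf p ?u) \<and> fst \<omega> + snd \<omega> = x + h}"
        using y unfolding set_pair_pmf set_u by simp
    qed simp
    also have "\<dots> = measure p (coset H x) / card H"
      using measure_pmf_sum [OF fin order_refl] by (simp add: sum_divide_distrib)
    finally show ?thesis .
  qed
  have pos: "measure p (coset H x) > 0" if "x \<in> set_pmf p" for x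
    using pmf_map_pos [OF that, of "coset H"] by (simp add: pmf_coset [OF H(1)])
  have "pent (conv p ?u) = (\<Sum>\<omega>\<in>set_pmf (pair_pmf p ?u). pmf (pair_pmf p ?u) \<omega> * - ln (pmf (conv p ?u) (fst \<omega> + snd \<omega>)))"
    using ent_eq_sum [OF F, of "\<lambda>\<omega>. fst \<omega> + snd \<omega>"] unfolding conv_def [symmetric] pent_conv [symmetric] .
  also have "\<dots> = (\<Sum>\<omega>\<in>set_pmf (pair_pmf p ?u). pmf (pair_pmf p ?u) \<omega> * (- ln (measure p (coset H (fst \<omega>))) + ln (real (card H))))"
  proof (rule sum.cong [OF refl])
    fix \<omega> assume "\<omega> \<in> set_pmf (pair_pmf p ?u)"
    then have "fst \<omega> \<in> set_pmf p" "snd \<omega> \<in> H"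
      unfolding set_pair_pmf set_u mem_Times_iff by blast+
    then have "ln (pmf (conv p ?u) (fst \<omega> + snd \<omega>)) = ln (measure p (coset H (fst \<omega>))) - ln (real (card H))"
      using pos [of "fst \<omega>"] cH by (simp add: pm ln_div)
    then show "pmf (pair_pmf p ?u) \<omega> * - ln (pmf (conv p ?u) (fst \<omega> + snd \<omega>)) =
       pmf (pair_pmf p ?u) \<omega> * (- ln (measure p (coset H (fst \<omega>))) + ln (real (card H)))" by simp
  qed
  also have "\<dots> = (\<Sum>\<omega>\<in>set_pmf (pair_pmf p ?u). pmf (pair_pmf p ?u) \<omega> * - ln (measure p (coset H (fst \<omega>)))) + ln (real (card H))"
    by (simp only: distrib_left sum.distrib sum_distrib_right [symmetric] sum_pmf_eq_1' [OF F] mult_1)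
  also have "(\<Sum>\<omega>\<in>set_pmf (pair_pmf p ?u). pmf (pair_pmf p ?u) \<omega> * - ln (measure p (coset H (fst \<omega>)))) =
      (\<Sum>x\<in>set_pmf p. pmf p x * - ln (measure p (coset H x)))"
    using sum_map_pmf [OF F, of fst "\<lambda>x. - ln (measure p (coset H x))"] by (simp add: map_fst_pair_pmf)
  also have "\<dots> = ent p (coset H)"
    by (simp add: ent_eq_sum [OF fin] pmf_coset [OF H(1)])
  finally show ?thesis .
qed

text \<open>What is left of \<open>r\<close> after removing \<open>c\<close> times \<open>u\<close>
  is nonnegative of mass 1 - c; rescaled, it is \<open>R\<close>.\<close>

lemma pmf_mixture:
  assumes fin: "finite (set_pmf r)" and c: "0 < c" "c < 1" and le: "\<And>x. c * pmf u x \<le> pmf r x"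
  shows "\<exists>R. finite (set_pmf R) \<and> r = bind_pmf (bernoulli_pmf c) (\<lambda>b. if b then u else R)"
proof -
  let ?f = "\<lambda>x. (pmf r x - c * pmf u x) / (1 - c)"
  have sub: "set_pmf u \<subseteq> set_pmf r"
  proof
    fix x assume "x \<in> set_pmf u"
    then have "c * pmf u x > 0" using c by (simp add: pmf_positive)
    then have "pmf r x \<noteq> 0" using le [of x] by linarith
    then show "x \<in> set_pmf r" by (simp add: set_pmf_iff)
  qed
  have finu: "finite (set_pmf u)" using sub fin by (rule finite_subset)
  have u0: "pmf u x = 0" if "pmf r x = 0" for x using sub that by (auto simp: set_pmf_iff)
  have f0: "?f x \<ge> 0" for x using le c by simp
  have "(\<integral>\<^sup>+x. ennreal (?f x) \<partial>count_space UNIV) = (\<Sum>x\<in>set_pmf r. ennreal (?f x))"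
    by (rule nn_integral_count_space' [OF fin]) (use u0 in \<open>auto simp: set_pmf_iff\<close>)
  also have "\<dots> = ennreal (\<Sum>x\<in>set_pmf r. ?f x)" using f0 by simp
  also have "(\<Sum>x\<in>set_pmf r. ?f x) = ((\<Sum>x\<in>set_pmf r. pmf r x) - c * (\<Sum>x\<in>set_pmf r. pmf u x)) / (1 - c)"
    by (simp only: sum_divide_distrib [symmetric] sum_subtractf sum_distrib_left [symmetric])
  also have "\<dots> = 1"
    using c by (simp add: sum_pmf_eq_1' [OF fin] sum_pmf_eq_1 [OF fin sub])
  finally have int: "(\<integral>\<^sup>+x. ennreal (?f x) \<partial>count_space UNIV) = 1" by simp
  define R where "R = embed_pmf ?f"
  have R: "pmf R x = ?f x" for x unfolding R_def by (rule pmf_embed_pmf [OF f0 int])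
  have "set_pmf R \<subseteq> set_pmf r"
  proof
    fix x assume x: "x \<in> set_pmf R"
    show "x \<in> set_pmf r"
    proof (rule ccontr)
      assume "x \<notin> set_pmf r"
      then have "pmf r x = 0" by (simp add: set_pmf_iff)
      with u0 [OF this] have "pmf R x = 0" unfolding R by simp
      with x show False by (simp add: set_pmf_iff)
    qed
  qed
  then have "finite (set_pmf R)" using fin by (rule finite_subset)
  moreover have "r = bind_pmf (bernoulli_pmf c) (\<lambda>b. if b then u else R)"
  proof (rule pmf_eqI)
    fix x
    have "pmf (bind_pmf (bernoulli_pmf c) (\<lambda>b. if b then u else R)) x = c * pmf u x + (1 - c) * pmf R x"
      using c by (simp add: pmf_bind integral_bernoulli_pmf)
    then show "pmf r x = pmf (bind_pmf (bernoulli_pmf c) (\<lambda>b. if b then u else R)) x"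
      using c by (simp add: R)
  qed
  ultimately show ?thesis by blast
qed

lemma bind_conv_right: "bind_pmf R (\<lambda>v. conv q (K v)) = conv q (bind_pmf R K)"
proof -
  have "neg (bind_pmf R (\<lambda>v. neg (K v))) = bind_pmf R K"
    unfolding neg_def map_bind_pmf by (simp add: map_pmf_comp)
  then show ?thesis using bind_conv [of R q "\<lambda>v. neg (K v)"] by simp
qed

text \<open>Concavity of entropy on the mixture, together with H(p + R) \<ge> H(p) for the
  remainder. Thus any distribution that dominates a multiple of \<open>u\<close> controls the cost
  of adding \<open>u\<close>.\<close>

lemma pent_conv_mixture_le:
  assumes fin: "finite (set_pmf p)" "finite (set_pmf r)" and c: "0 < c" "c < 1"
    and le: "\<And>x. c * pmf u x \<le> pmf r x"
  shows "c * (pent (conv p u) - pent p) \<le> pent (conv p r) - pent p"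
proof -
  obtain R where R: "finite (set_pmf R)" "r = bind_pmf (bernoulli_pmf c) (\<lambda>b. if b then u else R)"
    using pmf_mixture [OF fin(2) c le] by blast
  let ?B = "bernoulli_pmf c"
  have setB: "set_pmf ?B = {True, False}" using c by auto
  have finu: "finite (set_pmf u)" using fin(2) setB unfolding R(2) by (auto simp: setB)
  have "(\<Sum>b\<in>set_pmf ?B. pmf ?B b * pent (conv p (if b then u else R))) \<le> pent (bind_pmf ?B (\<lambda>b. conv p (if b then u else R)))"
    by (rule pent_concave) (use fin R(1) finu setB in auto)
  moreover have "bind_pmf ?B (\<lambda>b. conv p (if b then u else R)) = conv p r"
    by (subst R(2)) (rule bind_conv_right)
  moreover have "pent p \<le> pent (conv p R)" by (rule pent_conv_ge [OF fin(1) R(1)])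
  then have "(1 - c) * pent p \<le> (1 - c) * pent (conv p R)" using c by (intro mult_left_mono) auto
  ultimately show ?thesis using c unfolding setB by (simp add: algebra_simps)
qed

text \<open>Data processing for the mutual information of X - X' and X'. It equals H(X - X') - H(X),
  and when the difference is reduced modulo H it becomes the same expression modulo H.\<close>

lemma ent_coset_diff_le:
  assumes fin: "finite (set_pmf p)" and H: "add_subgroup H"
  shows "ent (conv p (neg p)) (coset H) - ent p (coset H) \<le> pent (conv p (neg p)) - pent p"
proof -
  let ?P = "pair_pmf p p"
  define E where "E \<omega> = fst \<omega> - snd \<omega>" for \<omega> :: "'a \<times> 'a"
  have F: "finite (set_pmf ?P)" using fin by simp
  have q: "conv p (neg p) = map_pmf E ?P"
    using conv_map_pair [of "\<lambda>x. x" p uminus p] by (simp add: neg_def E_def [abs_def])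
  have cmi: "cmi ?P X Y (\<lambda>_. ()) = ent ?P X + ent ?P Y - ent ?P (\<lambda>\<omega>. (X \<omega>, Y \<omega>))" for X :: "'a \<times> 'a \<Rightarrow> 'x" and Y :: "'a \<times> 'a \<Rightarrow> 'y"
  proof -
    have "ent ?P (\<lambda>\<omega>. (X \<omega>, ())) = ent ?P X" "ent ?P (\<lambda>\<omega>. (Y \<omega>, ())) = ent ?P Y"
      "ent ?P (\<lambda>\<omega>. (X \<omega>, Y \<omega>, ())) = ent ?P (\<lambda>\<omega>. (X \<omega>, Y \<omega>))"
      by (intro ent_cong [OF F]; auto)+
    then show ?thesis by (simp add: cmi_def)
  qed
  have "cmi ?P (\<lambda>\<omega>. coset H (E \<omega>)) snd (\<lambda>_. ()) \<le> cmi ?P E snd (\<lambda>_. ())"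
    by (rule cmi_mono_left [OF F]) simp
  moreover have "ent ?P (\<lambda>\<omega>. (E \<omega>, snd \<omega>)) = ent ?P (\<lambda>\<omega>. (fst \<omega>, snd \<omega>))"
    by (rule ent_cong [OF F]) (auto simp: E_def)
  moreover have "\<dots> = pent p + pent p"
    using ent_pair [OF fin fin, of "\<lambda>x. x" "\<lambda>x. x"] by (simp add: ent_id)
  moreover have "ent ?P (\<lambda>\<omega>. (coset H (E \<omega>), snd \<omega>)) = ent ?P (\<lambda>\<omega>. (coset H (fst \<omega>), snd \<omega>))"
  proof (rule ent_cong [OF F])
    fix \<omega> \<omega>' :: "'a \<times> 'a"
    show "((coset H (fst \<omega>), snd \<omega>) = (coset H (fst \<omega>'), snd \<omega>')) = ((coset H (E \<omega>), snd \<omega>) = (coset H (E \<omega>'), snd \<omega>'))"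
      by (cases "snd \<omega> = snd \<omega>'") (simp_all add: E_def coset_eq_iff [OF H])
  qed
  moreover have "\<dots> = ent p (coset H) + pent p"
    using ent_pair [OF fin fin, of "coset H" "\<lambda>x. x"] by (simp add: ent_id)
  moreover have "ent ?P (\<lambda>\<omega>. coset H (E \<omega>)) = ent (conv p (neg p)) (coset H)"
    by (simp add: q ent_map)
  moreover have "ent ?P E = pent (conv p (neg p))" by (simp add: q ent_def)
  ultimately show ?thesis by (simp add: cmi)
qed

text \<open>e^6 is at most 3^6 = 729. The value 6 is large enough for the final comparison in
  \<open>ent_coset_le\<close>.\<close>

lemma ln_inverse_ge_6:
  fixes x :: real
  assumes "0 < x" "x \<le> 1 / 1000"
  shows "6 \<le> - ln x"
proof -
  have "exp (6 :: real) = exp 1 ^ 6" by (simp add: exp_of_nat_mult [symmetric])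
  also have "\<dots> \<le> 3 ^ 6" by (intro power_mono exp_le) auto
  also have "\<dots> \<le> 1000" by simp
  also have "\<dots> \<le> 1 / x" using assms by (simp add: field_simps)
  finally have "6 \<le> ln (1 / x)" using assms by (simp add: ln_ge_iff)
  then show ?thesis using assms by (simp add: ln_div)
qed

text \<open>
  All but a small part of the mass of \<open>p\<close> lies in a single coset of \<open>H\<close>; the entropy of the
  remaining small part reappears in the difference distribution with weight close to two.
\<close>

lemma ent_coset_le:
  assumes fin: "finite (set_pmf p)" and H: "add_subgroup H"
    and mass: "measure (conv p (neg p)) H \<ge> 1 - 1 / 1000"
  shows "ent p (coset H) \<le> 3 * (ent (conv p (neg p)) (coset H) - ent p (coset H))"
proof -
  let ?P = "pair_pmf p p" and ?S = "set_pmf p"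
  define q where "q = conv p (neg p)"
  have F: "finite (set_pmf ?P)" using fin by simp
  have q: "q = map_pmf (\<lambda>\<omega>. fst \<omega> - snd \<omega>) ?P"
    using conv_map_pair [of "\<lambda>x. x" p uminus p] by (simp add: neg_def q_def)
  have finq: "finite (set_pmf q)" using fin by (simp add: q_def)
  have negq: "map_pmf uminus q = q"
    using neg_conv [of p "neg p"] by (simp add: q_def neg_def [symmetric] conv_commute)
  define w where "w x = measure p (coset H x)" for x
  have w_sum: "w x = (\<Sum>y\<in>?S \<inter> coset H x. pmf p y)" for x
    unfolding w_def by (rule measure_pmf_sum [OF fin order_refl])
  have coset_sym: "x \<in> coset H y \<longleftrightarrow> y \<in> coset H x" for x y
    using add_subgroup_uminus [OF H, of "x - y"] add_subgroup_uminus [OF H, of "y - x"] by (auto simp: coset_def)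
  have coset_mem: "x \<in> coset H y \<longleftrightarrow> coset H x = coset H y" for x y
    by (simp add: coset_eq_iff [OF H]) (simp add: coset_def)
  have self: "x \<in> coset H x" for x by (simp add: coset_mem)
  have wpos: "w x > 0" if "x \<in> ?S" for x
    using pmf_map_pos [OF that, of "coset H"] by (simp add: pmf_coset [OF H] w_def)
  have qH: "measure q H = (\<Sum>y\<in>?S. pmf p y * w y)"
  proof -
    have "measure q H = measure ?P {\<omega>. fst \<omega> - snd \<omega> \<in> H}" unfolding q by (simp add: vimage_def)
    also have "\<dots> = (\<Sum>\<omega>\<in>set_pmf ?P \<inter> {\<omega>. fst \<omega> - snd \<omega> \<in> H}. pmf ?P \<omega>)"
      by (rule measure_pmf_sum [OF F order_refl])
    also have "\<dots> = (\<Sum>\<omega>\<in>(SIGMA y:?S. ?S \<inter> coset H y). pmf p (fst \<omega>) * pmf p (snd \<omega>))"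
      by (rule sum.reindex_bij_witness [where i="\<lambda>\<omega>. (snd \<omega>, fst \<omega>)" and j="\<lambda>\<omega>. (snd \<omega>, fst \<omega>)"])
        (auto simp: coset_def pmf_pair)
    also have "\<dots> = (\<Sum>y\<in>?S. \<Sum>x\<in>?S \<inter> coset H y. pmf p y * pmf p x)"
      using fin by (subst sum.Sigma) (auto simp: case_prod_beta)
    finally show ?thesis by (simp add: w_sum sum_distrib_left)
  qed
  \<comment> \<open>The mass of \<open>H\<close> under \<open>q\<close> is the p-average of the
    coset masses \<open>w\<close>, so some coset is at least as heavy as that average.\<close>
  have "\<exists>x0\<in>?S. w x0 \<ge> 1 - 1 / 1000"
  proof (rule ccontr)
    assume "\<not> ?thesis"
    then have less: "w y < 1 - 1 / 1000" if "y \<in> ?S" for y using that by force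
    have "measure q H < (\<Sum>y\<in>?S. pmf p y * (1 - 1 / 1000))"
      unfolding qH by (rule sum_strict_mono) (use fin less in \<open>auto simp: set_pmf_not_empty pmf_positive intro!: mult_strict_left_mono\<close>)
    also have "\<dots> = 1 - 1 / 1000" using sum_pmf_eq_1' [OF fin] by (simp only: sum_distrib_right [symmetric]) simp
    finally show False using mass by (simp add: q_def)
  qed
  then obtain x0 where x0: "x0 \<in> ?S" "w x0 \<ge> 1 - 1 / 1000" by blast
  define M N where "M = ?S \<inter> coset H x0" and "N = ?S - coset H x0"
  have finMN: "finite M" "finite N" and MN: "M \<inter> N = {}" "?S = M \<union> N" using fin by (auto simp: M_def N_def)
  define \<beta> where "\<beta> = (\<Sum>x\<in>N. pmf p x)"
  have sumM: "(\<Sum>x\<in>M. pmf p x) = 1 - \<beta>"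
    using sum_pmf_eq_1' [OF fin] sum.union_disjoint [OF finMN MN(1), of "pmf p"] by (simp add: MN(2) \<beta>_def)
  have \<beta>: "0 \<le> \<beta>" "\<beta> \<le> 1 / 1000"
    using x0(2) sumM by (auto simp: \<beta>_def sum_nonneg w_sum M_def)
  have wN: "w x \<le> \<beta>" if "x \<in> N" for x
    unfolding w_sum \<beta>_def
  proof (rule sum_mono2 [OF finMN(2)])
    show "?S \<inter> coset H x \<subseteq> N" using that by (auto simp: N_def coset_mem)
  qed auto
  have wM: "w x = 1 - \<beta>" if "x \<in> M" for x
    using that sumM by (simp add: w_sum M_def coset_mem)
  \<comment> \<open>The contribution of the light cosets to the entropy. Each has mass at most
    1/1000, so \<open>A\<close> is at least 6 \<beta>, and terms of order \<beta> can be
    absorbed.\<close>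
  define A where "A = (\<Sum>x\<in>N. pmf p x * - ln (w x))"
  have A6: "6 * \<beta> \<le> A"
  proof -
    have "(\<Sum>x\<in>N. pmf p x * 6) \<le> A" unfolding A_def
      by (intro sum_mono mult_left_mono ln_inverse_ge_6) (use wN \<beta> wpos in \<open>fastforce simp: N_def\<close>)+
    then show ?thesis by (simp add: \<beta>_def sum_distrib_right [symmetric])
  qed
  have Hc: "ent p (coset H) \<le> A + \<beta>"
  proof -
    have "ent p (coset H) = (\<Sum>x\<in>?S. pmf p x * - ln (w x))"
      by (simp add: ent_eq_sum [OF fin] pmf_coset [OF H] w_def)
    also have "\<dots> = (\<Sum>x\<in>M. pmf p x * - ln (w x)) + A"
      unfolding MN(2) A_def by (rule sum.union_disjoint [OF finMN MN(1)])
    also have "(\<Sum>x\<in>M. pmf p x * - ln (w x)) = (\<Sum>x\<in>M. pmf p x * - ln (1 - \<beta>))"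
      by (rule sum.cong) (simp_all add: wM)
    also have "\<dots> = (1 - \<beta>) * - ln (1 - \<beta>)" by (simp only: sum_distrib_right [symmetric] sumM)
    also have "\<dots> \<le> (1 - \<beta>) * (1 / (1 - \<beta>) - 1)"
      using ln_le_minus_one [of "1 / (1 - \<beta>)"] \<beta> by (intro mult_left_mono) (auto simp: ln_div)
    also have "\<dots> = \<beta>" using \<beta> by (simp add: field_simps)
    finally show ?thesis by simp
  qed
  \<comment> \<open>The q-mass of the coset of x - y for any y in the main coset.\<close>
  define G where "G x = measure q (coset H (x - x0))" for x
  have suppq: "x - y \<in> set_pmf q" if "x \<in> ?S" "y \<in> ?S" for x y using that by (force simp: q)
  have mq: "measure q (coset H z) > 0" if "z \<in> set_pmf q" for z
    using pmf_map_pos [OF that, of "coset H"] by (simp add: pmf_coset [OF H])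
  have Gpos: "G x > 0" if "x \<in> N" for x
    unfolding G_def by (rule mq) (use suppq x0 that in \<open>auto simp: N_def\<close>)
  have G_neg: "measure q (coset H (x0 - x)) = G x" for x
  proof -
    have "measure q (coset H (x0 - x)) = measure q (uminus -` coset H (x0 - x))"
      by (subst negq [symmetric]) simp
    also have "uminus -` coset H (x0 - x) = coset H (x - x0)"
    proof -
      have "- z - (x0 - x) \<in> H \<longleftrightarrow> z - (x - x0) \<in> H" for z
        using add_subgroup_uminus [OF H, of "- z - (x0 - x)"] add_subgroup_uminus [OF H, of "z - (x - x0)"]
        by (auto simp: algebra_simps)
      then show ?thesis by (auto simp: coset_def)
    qed
    finally show ?thesis by (simp add: G_def)
  qed
  define F1 where "F1 = (\<Sum>x\<in>N. pmf p x * - ln (G x))"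
  \<comment> \<open>Summing over the points of one coset cancels \<open>w\<close> and leaves
    q-masses of distinct cosets other than \<open>H\<close>. Their total is at most 1 - (1 -
    \<beta>)^2.\<close>
  have sumG: "(\<Sum>x\<in>N. pmf p x * (G x / w x)) \<le> 2 * \<beta>"
  proof -
    let ?c = "\<lambda>x. coset H (x - x0)"
    have "(\<Sum>x\<in>N. pmf p x * (G x / w x)) = (\<Sum>k\<in>?c ` N. \<Sum>x | x \<in> N \<and> ?c x = k. pmf p x * (G x / w x))"
      by (rule sum.image_gen [OF finMN(2)])
    also have "\<dots> = (\<Sum>k\<in>?c ` N. measure q k)"
    proof (rule sum.cong [OF refl])
      fix k assume "k \<in> ?c ` N"
      then obtain x' where x': "x' \<in> N" "k = ?c x'" by auto
      have *: "?c x = k \<longleftrightarrow> coset H x = coset H x'" for x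
        unfolding x'(2) by (simp add: coset_eq_iff [OF H])
      have "{x. x \<in> N \<and> ?c x = k} = ?S \<inter> coset H x'"
      proof (rule Set.set_eqI)
        fix x
        show "x \<in> {x. x \<in> N \<and> ?c x = k} \<longleftrightarrow> x \<in> ?S \<inter> coset H x'"
          using x'(1) coset_mem [of x x'] coset_mem [of x x0] coset_mem [of x' x0]
          unfolding mem_Collect_eq Int_iff * N_def Diff_iff by metis
      qed
      then have "(\<Sum>x | x \<in> N \<and> ?c x = k. pmf p x * (G x / w x)) = (\<Sum>x\<in>?S \<inter> coset H x'. pmf p x * (G x / w x))"
        by simp
      also have "\<dots> = (\<Sum>x\<in>?S \<inter> coset H x'. pmf p x * (measure q k / w x'))"
      proof (rule sum.cong [OF refl])
        fix x assume "x \<in> ?S \<inter> coset H x'"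
        then have "coset H x = coset H x'" by (simp add: coset_mem)
        then show "pmf p x * (G x / w x) = pmf p x * (measure q k / w x')"
          using * [of x] by (simp add: G_def w_def)
      qed
      also have "\<dots> = w x' * (measure q k / w x')" by (simp only: sum_distrib_right [symmetric] w_sum)
      also have "\<dots> = measure q k" using wpos [of x'] x'(1) by (simp add: N_def)
      finally show "(\<Sum>x | x \<in> N \<and> ?c x = k. pmf p x * (G x / w x)) = measure q k" .
    qed
    also have "\<dots> = measure q (\<Union> (?c ` N))"
    proof -
      have "measure q (\<Union>k\<in>?c ` N. k) = (\<Sum>k\<in>?c ` N. measure q k)"
      proof (rule measure_pmf.finite_measure_finite_Union)
        have "z \<notin> ?c y" if "?c x \<noteq> ?c y" "z \<in> ?c x" for x y z
          using that coset_mem [of z "x - x0"] coset_mem [of z "y - x0"] by metis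
        then show "disjoint_family_on (\<lambda>k. k) (?c ` N)"
          unfolding disjoint_family_on_def by blast
      qed (use finMN(2) in auto)
      then show ?thesis by simp
    qed
    also have "\<dots> \<le> measure q (- H)"
    proof (rule measure_pmf.finite_measure_mono)
      show "\<Union> (?c ` N) \<subseteq> - H"
      proof (clarsimp)
        fix x z assume "x \<in> N" "z \<in> ?c x" "z \<in> H"
        then have "z - (z - (x - x0)) \<in> H" using H unfolding add_subgroup_def coset_def by blast
        then have "x \<in> coset H x0" by (simp add: coset_def)
        then show False using \<open>x \<in> N\<close> by (simp add: N_def)
      qed
    qed simp
    also have "\<dots> = 1 - measure q H"
      using measure_pmf.prob_compl [of H q] by (simp add: Compl_eq_Diff_UNIV)
    also have "\<dots> \<le> 2 * \<beta>"
    proof -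
      have "(1 - \<beta>) * (1 - \<beta>) = (\<Sum>x\<in>M. pmf p x * w x)"
        unfolding sumM [symmetric] sum_distrib_right by (rule sum.cong) (simp_all add: wM sumM)
      also have "\<dots> \<le> measure q H"
        unfolding qH by (rule sum_mono2 [OF fin]) (auto simp: M_def w_def)
      finally have "(1 - \<beta>) * (1 - \<beta>) \<le> measure q H" .
      moreover have "(1 - \<beta>) * (1 - \<beta>) = 1 - 2 * \<beta> + \<beta> * \<beta>" by (simp add: algebra_simps)
      moreover have "\<beta> * \<beta> \<ge> 0" by simp
      ultimately show ?thesis by linarith
    qed
    finally show ?thesis .
  qed
  \<comment> \<open>Gibbs' inequality between the p-masses of the light cosets, of total \<beta>,
    and the corresponding q-masses, of total at most 2 \<beta>.\<close>
  have F1_ge: "F1 \<ge> A - \<beta> * ln 2"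
  proof -
    have "F1 - (A - \<beta> * ln 2) = - (\<Sum>x\<in>N. pmf p x * ln (G x / (2 * w x)))"
    proof -
      have "F1 - (A - \<beta> * ln 2) = (\<Sum>x\<in>N. pmf p x * - ln (G x) - pmf p x * - ln (w x) + pmf p x * ln 2)"
        by (simp add: F1_def A_def \<beta>_def sum.distrib sum_subtractf sum_distrib_right sum_negf)
      also have "\<dots> = (\<Sum>x\<in>N. - (pmf p x * ln (G x / (2 * w x))))"
      proof (rule sum.cong [OF refl])
        fix x assume "x \<in> N"
        then have "G x > 0" "w x > 0" using Gpos wpos by (auto simp: N_def)
        then show "pmf p x * - ln (G x) - pmf p x * - ln (w x) + pmf p x * ln 2 = - (pmf p x * ln (G x / (2 * w x)))"
          by (simp add: ln_div ln_mult algebra_simps)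
      qed
      finally show ?thesis by (simp add: sum_negf)
    qed
    moreover have "(\<Sum>x\<in>N. pmf p x * ln (G x / (2 * w x))) \<le> (\<Sum>x\<in>N. pmf p x * (G x / (2 * w x) - 1))"
      by (intro sum_mono mult_left_mono ln_le_minus_one) (use Gpos wpos in \<open>auto simp: N_def\<close>)
    moreover have "(\<Sum>x\<in>N. pmf p x * (G x / (2 * w x) - 1)) = (\<Sum>x\<in>N. pmf p x * (G x / w x)) / 2 - \<beta>"
      by (simp add: \<beta>_def sum_subtractf sum_divide_distrib right_diff_distrib mult.commute [of 2])
    ultimately show ?thesis using sumG by linarith
  qed
  \<comment> \<open>Only pairs with exactly one point in the main coset are kept. The symmetry of
    \<open>q\<close> makes both orders contribute equally, whence the factor 2.\<close>
  have Hq: "ent q (coset H) \<ge> 2 * (1 - \<beta>) * F1"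
  proof -
    let ?t = "\<lambda>\<omega>. pmf ?P \<omega> * - ln (measure q (coset H (fst \<omega> - snd \<omega>)))"
    have "ent q (coset H) = (\<Sum>z\<in>set_pmf q. pmf q z * - ln (measure q (coset H z)))"
      by (simp add: ent_eq_sum [OF finq] pmf_coset [OF H])
    also have "\<dots> = (\<Sum>\<omega>\<in>set_pmf ?P. ?t \<omega>)"
      using sum_map_pmf [OF F, of "\<lambda>\<omega>. fst \<omega> - snd \<omega>" "\<lambda>z. - ln (measure q (coset H z))"]
      unfolding q [symmetric] .
    also have "\<dots> \<ge> (\<Sum>\<omega>\<in>N \<times> M \<union> M \<times> N. ?t \<omega>)"
    proof (rule sum_mono2 [OF F])
      show "N \<times> M \<union> M \<times> N \<subseteq> set_pmf ?P" by (auto simp: M_def N_def)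
      show "0 \<le> ?t \<omega>" if "\<omega> \<in> set_pmf ?P - (N \<times> M \<union> M \<times> N)" for \<omega>
      proof (rule mult_nonneg_nonneg)
        have "0 < measure q (coset H (fst \<omega> - snd \<omega>))"
          by (rule mq [OF suppq]) (use that in auto)
        then show "0 \<le> - ln (measure q (coset H (fst \<omega> - snd \<omega>)))" by simp
      qed simp
    qed
    also have "(\<Sum>\<omega>\<in>N \<times> M \<union> M \<times> N. ?t \<omega>) = (\<Sum>\<omega>\<in>N \<times> M. ?t \<omega>) + (\<Sum>\<omega>\<in>M \<times> N. ?t \<omega>)"
      by (rule sum.union_disjoint) (use finMN MN in auto)
    also have "(\<Sum>\<omega>\<in>N \<times> M. ?t \<omega>) = (\<Sum>x\<in>N. \<Sum>y\<in>M. (pmf p x * - ln (G x)) * pmf p y)"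
      unfolding sum.cartesian_product
    proof (rule sum.cong [OF refl], clarify)
      fix x y assume "x \<in> N" "y \<in> M"
      then have "coset H (x - y) = coset H (x - x0)"
        using coset_sym [of y x0] by (simp add: coset_eq_iff [OF H] M_def) (simp add: coset_def)
      then show "?t (x, y) = (pmf p x * - ln (G x)) * pmf p y" by (simp add: pmf_pair G_def)
    qed
    also have "(\<Sum>\<omega>\<in>M \<times> N. ?t \<omega>) = (\<Sum>x\<in>M. \<Sum>y\<in>N. pmf p x * (pmf p y * - ln (G y)))"
      unfolding sum.cartesian_product
    proof (rule sum.cong [OF refl], clarify)
      fix x y assume "x \<in> M" "y \<in> N"
      then have "coset H (x - y) = coset H (x0 - y)"
        by (simp add: coset_eq_iff [OF H] M_def) (simp add: coset_def)
      then show "?t (x, y) = pmf p x * (pmf p y * - ln (G y))" by (simp add: pmf_pair G_neg)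
    qed
    also have "(\<Sum>x\<in>N. \<Sum>y\<in>M. (pmf p x * - ln (G x)) * pmf p y) = F1 * (1 - \<beta>)"
      unfolding F1_def sumM [symmetric] by (rule sum_product [symmetric])
    also have "(\<Sum>x\<in>M. \<Sum>y\<in>N. pmf p x * (pmf p y * - ln (G y))) = (1 - \<beta>) * F1"
      unfolding F1_def sumM [symmetric] by (rule sum_product [symmetric])
    finally show ?thesis by (simp add: algebra_simps)
  qed
  have "\<beta> * ln 2 \<le> \<beta> * (25 / 36)"
    using \<beta> ln2_le_25_over_36 by (intro mult_left_mono) auto
  then have F1: "F1 \<ge> A - 25 / 36 * \<beta>" using F1_ge by simp
  then have "F1 \<ge> 0" using A6 \<beta> by linarith
  then have "2 * (1 - 1 / 1000) * F1 \<le> 2 * (1 - \<beta>) * F1"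
    using \<beta> by (intro mult_right_mono) auto
  then have "ent q (coset H) \<ge> 2 * (1 - 1 / 1000) * F1" using Hq by linarith
  \<comment> \<open>Since A \<ge> 6 \<beta>, the lower bound 2 (1 - 1/1000) (A - 25/36 \<beta>) is
    at least 4/3 (A + \<beta>), which gives the factor 3.\<close>
  then show ?thesis using F1 A6 Hc \<beta> unfolding q_def [symmetric] by simp
qed

section \<open>Near-periods of the difference distribution\<close>

lemma measures_meet:
  fixes q :: "'a pmf"
  assumes "measure q A + measure q B > 1"
  shows "\<exists>z. z \<in> A \<and> z \<in> B"
proof (rule ccontr)
  assume "\<not> ?thesis"
  then have "A \<inter> B = {}" by auto
  then have "measure q (A \<union> B) = measure q A + measure q B"
    by (intro measure_pmf.finite_measure_Union) auto
  then show False using assms measure_pmf.prob_le_1 [of q "A \<union> B"] by linarith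
qed

text \<open>The laws of x - Y average to \<open>q\<close>, so the left side is the mutual
  information of X and X - Y, written as a mean relative entropy.\<close>

lemma sum_relative_entropy_translates:
  fixes p :: "'g::ab_group_add pmf"
  assumes fin: "finite (set_pmf p)"
  defines "q \<equiv> conv p (neg p)"
  shows "(\<Sum>x\<in>set_pmf p. pmf p x * (\<Sum>z\<in>set_pmf (map_pmf (\<lambda>y. x - y) p).
      pmf (map_pmf (\<lambda>y. x - y) p) z * ln (pmf (map_pmf (\<lambda>y. x - y) p) z / pmf q z))) = pent q - pent p"
proof -
  let ?S = "set_pmf p" and ?P = "pair_pmf p p"
  have F: "finite (set_pmf ?P)" using fin by simp
  have q: "q = map_pmf (\<lambda>\<omega>. fst \<omega> - snd \<omega>) ?P"
    using conv_map_pair [of "\<lambda>x. x" p uminus p] by (simp add: neg_def q_def)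
  have inner: "(\<Sum>z\<in>set_pmf (map_pmf (\<lambda>y. x - y) p). pmf (map_pmf (\<lambda>y. x - y) p) z * ln (pmf (map_pmf (\<lambda>y. x - y) p) z / pmf q z))
     = (\<Sum>y\<in>?S. pmf p y * (ln (pmf p y) - ln (pmf q (x - y))))" if x: "x \<in> ?S" for x
  proof -
    have inj: "inj (\<lambda>y. x - y)" by (simp add: inj_on_def)
    have "(\<Sum>z\<in>set_pmf (map_pmf (\<lambda>y. x - y) p). pmf (map_pmf (\<lambda>y. x - y) p) z * ln (pmf (map_pmf (\<lambda>y. x - y) p) z / pmf q z))
      = (\<Sum>y\<in>?S. pmf p y * ln (pmf (map_pmf (\<lambda>y. x - y) p) (x - y) / pmf q (x - y)))"
      by (rule sum_map_pmf [OF fin])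
    also have "\<dots> = (\<Sum>y\<in>?S. pmf p y * (ln (pmf p y) - ln (pmf q (x - y))))"
    proof (rule sum.cong [OF refl])
      fix y assume y: "y \<in> ?S"
      have "x - y \<in> set_pmf q" using x y by (force simp: q)
      then have "pmf q (x - y) > 0" "pmf p y > 0" using y by (auto simp: pmf_positive)
      then show "pmf p y * ln (pmf (map_pmf (\<lambda>y. x - y) p) (x - y) / pmf q (x - y)) = pmf p y * (ln (pmf p y) - ln (pmf q (x - y)))"
        using pmf_map_inj' [OF inj, of p y] by (simp add: ln_div)
    qed
    finally show ?thesis .
  qed
  have "pent q = (\<Sum>x\<in>?S. pmf p x * (\<Sum>y\<in>?S. pmf p y * - ln (pmf q (x - y))))"
  proof -
    have "pent q = ent ?P (\<lambda>\<omega>. fst \<omega> - snd \<omega>)" by (simp add: q ent_def)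
    also have "\<dots> = (\<Sum>\<omega>\<in>?S \<times> ?S. pmf ?P \<omega> * - ln (pmf q (fst \<omega> - snd \<omega>)))"
      unfolding ent_eq_sum [OF F] q [symmetric] by simp
    also have "\<dots> = (\<Sum>x\<in>?S. \<Sum>y\<in>?S. pmf p x * pmf p y * - ln (pmf q (x - y)))"
      unfolding sum.cartesian_product by (rule sum.cong) (auto simp: pmf_pair)
    finally show ?thesis by (simp only: sum_distrib_left mult.assoc)
  qed
  moreover have "pent p = (\<Sum>x\<in>?S. pmf p x * (\<Sum>y\<in>?S. pmf p y * - ln (pmf p y)))"
    using sum_pmf_eq_1' [OF fin] by (simp only: sum_distrib_right [symmetric] pent_def mult_1)
  ultimately have "pent q - pent p = (\<Sum>x\<in>?S. pmf p x * ((\<Sum>y\<in>?S. pmf p y * - ln (pmf q (x - y))) - (\<Sum>y\<in>?S. pmf p y * - ln (pmf p y))))"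
    by (simp only: right_diff_distrib sum_subtractf)
  also have "\<dots> = (\<Sum>x\<in>?S. pmf p x * (\<Sum>y\<in>?S. pmf p y * (ln (pmf p y) - ln (pmf q (x - y)))))"
    unfolding sum_subtractf [symmetric] by (intro sum.cong refl arg_cong2 [where f="(*)"]) (simp add: algebra_simps)
  finally show ?thesis using inner by simp
qed

text \<open>Let N be the points of H with less than half of the uniform mass 1/n. Then q(N) is at
  most |N|/(2n), whereas the translates of N by H have mean mass q(H)|N|/n; near-invariance forces N
  to be small. Hence for at least half of the a in H both a and x - a avoid N, and each such a
  contributes at least 1/(4n^2).\<close>

lemma conv_ge_uniform:
  fixes q :: "'g::ab_group_add pmf"
  assumes fin: "finite (set_pmf q)" and H: "add_subgroup H" "finite H"
    and mass: "measure q H \<ge> 1 - 1 / 1000"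
    and close: "\<And>h. h \<in> H \<Longrightarrow> tv_close (1 / 500) (map_pmf ((+) h) q) q"
  shows "1 / 8 * pmf (pmf_of_set H) x \<le> pmf (conv q q) x"
proof (cases "x \<in> H")
  case False
  have "H \<noteq> {}" using H(1) by (auto simp: add_subgroup_def)
  then show ?thesis using False H(2) by simp
next
  case x: True
  have ne: "H \<noteq> {}" using x by auto
  define n where "n = real (card H)"
  have n0: "n > 0" using ne H(2) by (simp add: n_def card_gt_0_iff)
  define N where "N = {y \<in> H. pmf q y < 1 / (2 * n)}"
  have finN: "finite N" and NH: "N \<subseteq> H" using H(2) by (auto simp: N_def)
  have reflect: "bij_betw (\<lambda>h. y - h) H H" if "y \<in> H" for y
    by (rule bij_betw_byWitness [where f'="\<lambda>h. y - h"]) (use H(1) that in \<open>auto simp: add_subgroup_def\<close>)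
  have "measure q N \<le> real (card N) / (2 * n)"
  proof -
    have "measure q N = (\<Sum>y\<in>N. pmf q y)" using finN by (simp add: measure_measure_pmf_finite)
    also have "\<dots> \<le> (\<Sum>y\<in>N. 1 / (2 * n))" by (rule sum_mono) (auto simp: N_def)
    finally show ?thesis by simp
  qed
  then have bound: "measure (map_pmf ((+) h) q) N \<le> real (card N) / (2 * n) + 1 / 500" if "h \<in> H" for h
    using close [OF that] unfolding tv_close_def by (smt (verit))
  have "real (card N) * measure q H = (\<Sum>h\<in>H. measure (map_pmf ((+) h) q) N)"
  proof -
    have "measure (map_pmf ((+) h) q) N = (\<Sum>y\<in>N. pmf q (y - h))" for h
    proof -
      have "measure (map_pmf ((+) h) q) N = (\<Sum>y\<in>N. pmf (map_pmf ((+) h) q) y)"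
        using finN by (rule measure_measure_pmf_finite)
      moreover have "pmf (map_pmf ((+) h) q) y = pmf q (y - h)" for y
        using pmf_map_inj' [of "(+) h" q "y - h"] by (simp add: inj_on_def)
      ultimately show ?thesis by simp
    qed
    then have "(\<Sum>h\<in>H. measure (map_pmf ((+) h) q) N) = (\<Sum>h\<in>H. \<Sum>y\<in>N. pmf q (y - h))" by simp
    also have "\<dots> = (\<Sum>y\<in>N. \<Sum>h\<in>H. pmf q (y - h))" by (rule sum.swap)
    also have "\<dots> = (\<Sum>y\<in>N. measure q H)"
    proof (rule sum.cong [OF refl])
      fix y assume "y \<in> N"
      then have "(\<Sum>h\<in>H. pmf q (y - h)) = (\<Sum>h\<in>H. pmf q h)"
        using NH by (intro sum.reindex_bij_betw reflect) auto
      then show "(\<Sum>h\<in>H. pmf q (y - h)) = measure q H" using H(2) by (simp add: measure_measure_pmf_finite)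
    qed
    finally show ?thesis by simp
  qed
  also have "\<dots> \<le> (\<Sum>h\<in>H. real (card N) / (2 * n) + 1 / 500)" by (rule sum_mono) (rule bound)
  also have "\<dots> = real (card N) / 2 + n / 500" using n0 by (simp add: n_def field_simps)
  finally have "real (card N) * measure q H \<le> real (card N) / 2 + n / 500" .
  moreover have "real (card N) * (1 - 1 / 1000) \<le> real (card N) * measure q H" using mass by (intro mult_left_mono) auto
  ultimately have cN: "real (card N) \<le> n / 4" using n0 by simp
  define T where "T = {a \<in> H. a \<notin> N \<and> x - a \<notin> N}"
  have finT: "finite T" using H(2) by (simp add: T_def)
  have cT: "real (card T) \<ge> n / 2"
  proof -
    have "H \<subseteq> T \<union> (N \<union> (\<lambda>a. x - a) ` N)"
    proof
      fix a assume "a \<in> H"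
      moreover have "a \<in> (\<lambda>a. x - a) ` N" if "x - a \<in> N" using that by (rule rev_image_eqI) simp
      ultimately show "a \<in> T \<union> (N \<union> (\<lambda>a. x - a) ` N)" by (auto simp: T_def)
    qed
    then have "card H \<le> card (T \<union> (N \<union> (\<lambda>a. x - a) ` N))" using finT finN by (intro card_mono) auto
    also have "\<dots> \<le> card T + (card N + card N)"
      by (intro order_trans [OF card_Un_le] add_mono order_refl card_image_le finN)
    finally show ?thesis using cN by (simp add: n_def)
  qed
  have F: "finite (set_pmf (pair_pmf q q))" using fin by simp
  have "n / 2 * (1 / (2 * n) * (1 / (2 * n))) \<le> real (card T) * (1 / (2 * n) * (1 / (2 * n)))"
    using cT n0 by (intro mult_right_mono) auto
  also have "\<dots> = (\<Sum>a\<in>T. 1 / (2 * n) * (1 / (2 * n)))" by simp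
  also have "\<dots> \<le> (\<Sum>a\<in>T. pmf q a * pmf q (x - a))"
  proof (intro sum_mono mult_mono)
    fix a assume a: "a \<in> T"
    then have "x - a \<in> H" using x H(1) by (auto simp: T_def add_subgroup_def)
    with a show "1 / (2 * n) \<le> pmf q a" "1 / (2 * n) \<le> pmf q (x - a)" by (auto simp: T_def N_def)
  qed (use n0 in auto)
  also have "\<dots> = (\<Sum>\<omega>\<in>(\<lambda>a. (a, x - a)) ` T. pmf (pair_pmf q q) \<omega>)"
    by (subst sum.reindex) (auto simp: inj_on_def pmf_pair)
  also have "\<dots> = measure (pair_pmf q q) ((\<lambda>a. (a, x - a)) ` T)"
    using finT by (simp add: measure_measure_pmf_finite)
  also have "\<dots> \<le> measure (pair_pmf q q) ((\<lambda>\<omega>. fst \<omega> + snd \<omega>) -` {x})"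
    by (rule measure_pmf.finite_measure_mono) auto
  also have "\<dots> = pmf (conv q q) x" by (simp add: conv_def pmf_map)
  finally have "1 / (8 * n) \<le> pmf (conv q q) x" using n0 by (simp add: field_simps)
  moreover have "pmf (pmf_of_set H) x = 1 / n" using x ne H(2) by (simp add: n_def)
  ultimately show ?thesis by simp
qed

lemma neg_pmf_of_set:
  assumes H: "add_subgroup H" "finite H"
  shows "neg (pmf_of_set H) = pmf_of_set H"
proof -
  have "uminus ` H = H"
    using add_subgroup_uminus [OF H(1)] by (auto intro!: image_eqI [of _ uminus "- _"])
  moreover have "H \<noteq> {}" using H(1) by (auto simp: add_subgroup_def)
  ultimately show ?thesis
    unfolding neg_def using H(2) by (subst map_pmf_of_set_inj) (auto simp: inj_on_def)
qed

text \<open>The near-periods form an exact subgroup because two thresholds are used: differences of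
  1/1000-periods are 1/500-periods, and conversely even a 1/250-period is a difference of two
  1/1000-periods, since these carry almost all of \<open>q\<close>.\<close>

theorem near_subgroup_of_small_rdist:
  fixes p :: "'g::ab_group_add pmf"
  assumes fin: "finite (set_pmf p)" and small: "rdist p p \<le> 1 / 10 ^ 11"
  shows "\<exists>H. add_subgroup H \<and> finite H \<and>
    H \<subseteq> {x - y |x y. x \<in> set_pmf (conv p (neg p)) \<and> y \<in> set_pmf (conv p (neg p))} \<and>
    rdist p (pmf_of_set H) \<le> 60 * rdist p p"
proof -
  let ?S = "set_pmf p"
  define q where "q = conv p (neg p)"
  define \<epsilon> where "\<epsilon> = rdist p p"
  have \<epsilon>: "pent q - pent p = \<epsilon>" by (simp add: q_def \<epsilon>_def rdist_def)
  have finq: "finite (set_pmf q)" using fin by (simp add: q_def)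
  have q: "q = map_pmf (\<lambda>\<omega>. fst \<omega> - snd \<omega>) (pair_pmf p p)"
    using conv_map_pair [of "\<lambda>x. x" p uminus p] by (simp add: neg_def q_def)
  let ?px = "\<lambda>x. map_pmf (\<lambda>y. x - y) p"
  define KL where "KL x = (\<Sum>z\<in>set_pmf (?px x). pmf (?px x) z * ln (pmf (?px x) z / pmf q z))" for x
  have sumKL: "(\<Sum>x\<in>?S. pmf p x * KL x) = \<epsilon>"
    using sum_relative_entropy_translates [OF fin] by (simp add: KL_def \<epsilon> q_def [symmetric])
  have pinsker: "(measure (?px x) E - measure q E)\<^sup>2 \<le> 4 * KL x" if "x \<in> ?S" for x E
    unfolding KL_def
  proof (rule measure_diff_le_relative_entropy [OF finq])
    show "set_pmf (?px x) \<subseteq> set_pmf q" using that by (force simp: q)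
  qed
  define good where "good = {x \<in> ?S. tv_close (1 / 2000) (?px x) q}"
  \<comment> \<open>(1/2000)^2 / 4 = 1 / (16 * 10^6). As the mean of \<open>KL\<close> is at most
    10^-11, Markov's inequality leaves bad mass at most 1.6 * 10^-4, below 1/2000.\<close>
  have KL_bad: "KL x \<ge> 1 / (16 * 10 ^ 6)" if "x \<in> ?S - good" for x
  proof -
    obtain E where E: "\<bar>measure (?px x) E - measure q E\<bar> > 1 / 2000"
      using \<open>x \<in> ?S - good\<close> by (auto simp: good_def tv_close_def not_le)
    have "(1 / 2000)\<^sup>2 \<le> \<bar>measure (?px x) E - measure q E\<bar>\<^sup>2"
      by (rule power_mono) (use E in auto)
    also have "\<dots> \<le> 4 * KL x" using pinsker [of x E] that by simp
    finally show ?thesis by (simp add: power2_eq_square)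
  qed
  have KL0: "KL x \<ge> 0" if "x \<in> ?S" for x
    using pinsker [OF that, of UNIV] by simp
  have bad: "(\<Sum>x\<in>?S - good. pmf p x) \<le> 1 / 2000"
  proof -
    have "(\<Sum>x\<in>?S - good. pmf p x) * (1 / (16 * 10 ^ 6)) = (\<Sum>x\<in>?S - good. pmf p x * (1 / (16 * 10 ^ 6)))"
      by (rule sum_distrib_right)
    also have "\<dots> \<le> (\<Sum>x\<in>?S - good. pmf p x * KL x)"
      by (intro sum_mono mult_left_mono KL_bad) auto
    also have "\<dots> \<le> (\<Sum>x\<in>?S. pmf p x * KL x)"
      by (rule sum_mono2) (use fin KL0 in auto)
    also have "\<dots> \<le> 1 / 10 ^ 11" using small by (simp add: sumKL \<epsilon>_def)
    finally show ?thesis by simp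
  qed
  have goodS: "good \<subseteq> ?S" "finite good" using fin by (auto simp: good_def)
  have mass_good: "measure p good \<ge> 1 - 1 / 2000"
  proof -
    have "(\<Sum>x\<in>?S - good. pmf p x) = (\<Sum>x\<in>?S. pmf p x) - (\<Sum>x\<in>good. pmf p x)"
      by (rule sum_diff) (use fin goodS in auto)
    then show ?thesis
      using bad sum_pmf_eq_1' [OF fin] goodS by (simp add: measure_measure_pmf_finite)
  qed
  define cl where "cl t h = tv_close t (map_pmf ((+) h) q) q" for t h
  have shift: "map_pmf ((+) a) (map_pmf ((+) b) r) = map_pmf ((+) (a + b)) r" for a b :: 'g and r
    unfolding map_pmf_comp by (rule map_pmf_cong) (simp_all add: add.assoc)
  have s0: "map_pmf ((+) 0) q = q" by (simp add: map_pmf_idI)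
  have cl_diff: "cl (s + t) (a - b)" if "cl s a" "cl t b" for s t a b
  proof -
    have "tv_close s (map_pmf ((+) (- b)) (map_pmf ((+) a) q)) (map_pmf ((+) (- b)) q)"
      using that(1) unfolding cl_def by (rule tv_close_map)
    moreover have "tv_close t (map_pmf ((+) (- b)) (map_pmf ((+) b) q)) (map_pmf ((+) (- b)) q)"
      using that(2) unfolding cl_def by (rule tv_close_map)
    then have "tv_close t (map_pmf ((+) (- b)) q) q"
      unfolding shift left_minus s0 by (rule tv_close_commute)
    ultimately show ?thesis unfolding cl_def shift using tv_close_triangle by fastforce
  qed
  define A where "A = {h. cl (1 / 1000) h}"
  define H where "H = {h. cl (1 / 500) h}"
  have AH: "a - b \<in> H" if "a \<in> A" "b \<in> A" for a b
    using cl_diff [of "1 / 1000" a "1 / 1000" b] that by (simp add: A_def H_def)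
  have qA: "measure q A \<ge> 1 - 1 / 1000"
  proof -
    have "(1 - 1 / 2000) * (1 - 1 / 2000) \<le> measure p good * measure p good"
      by (intro mult_mono mass_good) auto
    also have "\<dots> = measure (pair_pmf p p) (good \<times> good)"
      using goodS(2) by (intro measure_pmf_prob_product [symmetric]) (auto intro: countable_finite)
    also have "\<dots> \<le> measure (pair_pmf p p) ((\<lambda>\<omega>. fst \<omega> - snd \<omega>) -` A)"
    proof (rule measure_pmf.finite_measure_mono)
      show "good \<times> good \<subseteq> (\<lambda>\<omega>. fst \<omega> - snd \<omega>) -` A"
      proof clarify
        fix x y assume xy: "x \<in> good" "y \<in> good"
        have "map_pmf ((+) (x - y)) (?px y) = ?px x"
          by (simp add: map_pmf_comp)
        moreover have "tv_close (1 / 2000) (map_pmf ((+) (x - y)) (?px y)) (map_pmf ((+) (x - y)) q)"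
          using xy(2) by (intro tv_close_map) (simp add: good_def)
        ultimately have "tv_close (1 / 2000) (map_pmf ((+) (x - y)) q) (?px x)"
          by (simp add: tv_close_commute)
        moreover have "tv_close (1 / 2000) (?px x) q" using xy(1) by (simp add: good_def)
        ultimately have "tv_close (1 / 2000 + 1 / 2000) (map_pmf ((+) (x - y)) q) q" by (rule tv_close_triangle)
        then show "(x, y) \<in> (\<lambda>\<omega>. fst \<omega> - snd \<omega>) -` A" by (simp add: A_def cl_def)
      qed
    qed simp
    also have "\<dots> = measure q A" by (simp add: q)
    finally show ?thesis by simp
  qed
  have subg: "add_subgroup H"
    unfolding add_subgroup_def
  proof (intro conjI ballI)
    show "0 \<in> H" unfolding H_def mem_Collect_eq cl_def s0 by (simp add: tv_close_def)
    fix x y assume "x \<in> H" "y \<in> H"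
    \<comment> \<open>The threshold doubles, but \<open>A\<close> and its preimage under the shift
      by x - y still have mass above 1/2 each. They meet, so x - y is a difference of elements of
      \<open>A\<close> and the threshold 1/500 is restored.\<close>
    then have "cl (1 / 500 + 1 / 500) (x - y)" by (intro cl_diff) (auto simp: H_def)
    then have "\<bar>measure (map_pmf ((+) (x - y)) q) A - measure q A\<bar> \<le> 1 / 500 + 1 / 500"
      unfolding cl_def tv_close_def by blast
    then have "measure q A + measure q ((+) (x - y) -` A) > 1" using qA unfolding measure_map_pmf by linarith
    then obtain z where "z \<in> A" "(x - y) + z \<in> A" using measures_meet by (metis vimage_eq)
    then have "((x - y) + z) - z \<in> H" by (intro AH)
    then show "x - y \<in> H" by simp
  qed
  have contain: "H \<subseteq> {x - y |x y. x \<in> set_pmf q \<and> y \<in> set_pmf q}"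
  proof
    fix h assume "h \<in> H"
    then have "\<bar>measure (map_pmf ((+) h) q) (set_pmf q) - measure q (set_pmf q)\<bar> \<le> 1 / 500"
      unfolding H_def cl_def tv_close_def by blast
    moreover have "measure q (set_pmf q) = 1" by (simp add: measure_pmf.prob_eq_1 AE_measure_pmf_iff)
    ultimately have "measure q (set_pmf q) + measure q ((+) h -` set_pmf q) > 1" unfolding measure_map_pmf by linarith
    then obtain z where "z \<in> set_pmf q" "h + z \<in> set_pmf q" using measures_meet by (metis vimage_eq)
    moreover have "h = (h + z) - z" by simp
    ultimately show "h \<in> {x - y |x y. x \<in> set_pmf q \<and> y \<in> set_pmf q}" by blast
  qed
  have finH: "finite H"
    by (rule finite_subset [OF contain], rule finite_subset [OF _ finite_imageI [OF finite_cartesian_product [OF finq finq], of "\<lambda>(x, y). x - y"]]) auto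
  have "A \<subseteq> H"
  proof
    fix h assume "h \<in> A"
    then have "\<bar>measure (map_pmf ((+) h) q) E - measure q E\<bar> \<le> 1 / 1000" for E
      unfolding A_def cl_def tv_close_def by blast
    from order_trans [OF this, of "1 / 500"] show "h \<in> H"
      unfolding H_def cl_def tv_close_def by auto
  qed
  then have qH: "measure q H \<ge> 1 - 1 / 1000"
    using qA measure_pmf.finite_measure_mono [of A H q] by simp
  let ?u = "pmf_of_set H"
  have ne: "H \<noteq> {}" using subg by (auto simp: add_subgroup_def)
  have set_u: "set_pmf ?u = H" using finH ne by simp
  \<comment> \<open>The convolution of \<open>q\<close> with itself dominates 1/8 of the uniform
    distribution on \<open>H\<close>. Adding it to \<open>p\<close> means adding two copies of
    \<open>p\<close>, at a cost of 2 \<epsilon> each, and two of \<open>neg p\<close>, at \<epsilon>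
    each; so 48 = 8 * 6.\<close>
  have "1 / 8 * (pent (conv p ?u) - pent p) \<le> pent (conv p (conv q q)) - pent p"
    by (rule pent_conv_mixture_le [OF fin])
      (use finq conv_ge_uniform [OF finq subg finH qH] in \<open>auto simp: H_def cl_def\<close>)
  also have "\<dots> \<le> 6 * \<epsilon>"
  proof -
    let ?f = "\<lambda>i::nat. if i < 2 then p else neg p"
    have "conv p (sumlaw ?f {..<4}) = conv p (conv q q)"
      by (simp add: q_def lessThan_Suc numeral_eq_Suc conv.assoc conv.left_commute conv.commute)
    moreover have "pent (conv p (sumlaw ?f {..<4})) - pent p \<le> (\<Sum>i<4. pent (conv p (?f i)) - pent p)"
      by (rule pent_conv_sumlaw_le) (use fin in auto)
    moreover have "(\<Sum>i<4. pent (conv p (?f i)) - pent p) = 2 * (pent (conv p p) - pent p) + 2 * (pent (conv p (neg p)) - pent p)"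
      by (simp add: numeral_eq_Suc)
    ultimately show ?thesis
      using rdist_neg_self_le [OF fin] \<epsilon> by (simp add: \<epsilon>_def q_def)
  qed
  finally have 1: "pent (conv p ?u) - pent p \<le> 48 * \<epsilon>" by simp
  have 2: "ent p (coset H) \<le> 3 * \<epsilon>"
    using ent_coset_le [OF fin subg] ent_coset_diff_le [OF fin subg] qH \<epsilon> by (simp add: q_def)
  \<comment> \<open>\<open>p\<close> has little entropy modulo \<open>H\<close>, so ln |H| falls
    short of H(p) by at most 3 \<epsilon>. This allows H(p) / 2 in place of ln |H| / 2 in the
    distance.\<close>
  have "pent p \<le> pent (conv p ?u)" by (rule pent_conv_ge [OF fin]) (simp add: set_u finH)
  also have "\<dots> = ent p (coset H) + ln (real (card H))" by (rule pent_conv_uniform [OF fin subg finH])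
  finally have 3: "pent p \<le> 3 * \<epsilon> + ln (real (card H))" using 2 by simp
  have neg_u: "neg ?u = ?u" by (rule neg_pmf_of_set [OF subg finH])
  have pent_u: "pent ?u = ln (real (card H))"
    using finH ne by (simp add: pent_def ln_div)
  have "rdist p ?u \<le> 48 * \<epsilon> + 3 * \<epsilon> / 2"
    using 1 3 unfolding rdist_def neg_u pent_u by (simp add: field_simps)
  also have "\<dots> \<le> 60 * \<epsilon>" using rdist_nonneg [OF fin fin] by (simp add: \<epsilon>_def)
  finally show ?thesis
    using subg finH contain unfolding q_def \<epsilon>_def by blast
qed

section \<open>Iterating the decrement\<close>

lemma sums_of_uminus:
  assumes "uminus ` S = S" "x \<in> sums_of n S"
  shows "- x \<in> sums_of n S"
  using assms(2)
proof (induction n arbitrary: x)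
  case (Suc n)
  then obtain u v where x: "x = u + v" "u \<in> sums_of n S" "v \<in> S" by auto
  have "- v \<in> S" using assms(1) x(3) by blast
  moreover have "- u \<in> sums_of n S" using Suc.IH x(2) by blast
  moreover have "- x = - u + - v" by (simp add: x(1))
  ultimately show ?case by force
qed simp

lemma smul_sums_of:
  assumes "\<And>x. x \<in> S \<Longrightarrow> smul m x = 0" "x \<in> sums_of n S"
  shows "smul m x = 0"
  using assms(2) by (induction n arbitrary: x) (auto simp: smul_add assms(1))

lemma zero_in_sums_of: "0 \<in> S \<Longrightarrow> 0 \<in> sums_of n S"
  by (induction n) force+

text \<open>The last invariant is a budget: what the multidistance loses pays for the distance
  moved. \<open>K\<close> is 2 m d[p;p] because the initial constant tuple has multidistance at most
  m d[p;p] and penalty at most the same.\<close>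

lemma iterated_decrement:
  fixes p :: "'g::ab_group_add pmf"
  assumes m: "m \<ge> 2" and fp: "finite (set_pmf p)" and S0: "0 \<in> S" and S: "set_pmf p \<subseteq> S"
    and tor: "\<And>x. x \<in> S \<Longrightarrow> smul m x = 0"
  defines "\<eta> \<equiv> 1 / (40 * real m ^ 3)" and "K \<equiv> 2 * m * rdist p p"
  shows "\<exists>X. (\<forall>i. finite (set_pmf (X i))) \<and> (\<forall>i<m. set_pmf (X i) \<subseteq> sums_of (m ^ (3 * n)) S) \<and>
    mdist m X \<le> (1 - \<eta>) ^ n * K \<and> mdist m X + \<eta> * (\<Sum>i<m. rdist p (X i)) \<le> K"
proof -
  have m0: "real m > 0" using m by simp
  have m3: "real m ^ 3 \<ge> 8" using power_mono [of 2 "real m" 3] m by simp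
  have \<eta>: "0 \<le> \<eta>" "\<eta> \<le> 1" using m3 m0 by (auto simp: \<eta>_def field_simps)
  have d0: "rdist p p \<ge> 0" by (rule rdist_nonneg [OF fp fp])
  then have K0: "K \<ge> 0" by (simp add: K_def)
  show ?thesis
  proof (induction n)
    case 0
    have 1: "mdist m (\<lambda>_. p) \<le> m * rdist p p" by (rule mdist_iid_le) (use fp m in auto)
    have "\<eta> * (\<Sum>i<m. rdist p p) \<le> 1 * (\<Sum>i<m. rdist p p)"
      using \<eta> d0 by (intro mult_right_mono) auto
    then have "mdist m (\<lambda>_. p) + \<eta> * (\<Sum>i<m. rdist p p) \<le> K" using 1 by (simp add: K_def)
    moreover have "mdist m (\<lambda>_. p) \<le> K"
      using 1 mult_nonneg_nonneg [OF less_imp_le [OF m0] d0] by (simp add: K_def)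
    moreover have "sums_of (m ^ (3 * 0)) S = S" using sums_of_1 [of S] by simp
    ultimately show ?case using fp S by (intro exI [of _ "\<lambda>_. p"]) auto
  next
    case (Suc n)
    then obtain X where X: "\<And>i. finite (set_pmf (X i))" "\<And>i. i < m \<Longrightarrow> set_pmf (X i) \<subseteq> sums_of (m ^ (3 * n)) S"
      "mdist m X \<le> (1 - \<eta>) ^ n * K" "mdist m X + \<eta> * (\<Sum>i<m. rdist p (X i)) \<le> K" by blast
    interpret tuple m X by unfold_locales (rule m, rule X(1))
    have mono: "sums_of (m ^ (3 * n)) S \<subseteq> sums_of (m ^ (3 * Suc n)) S"
      by (intro sums_of_mono [OF S0] power_increasing) (use m in auto)
    show ?case
    \<comment> \<open>\<open>decrement\<close> needs positive multidistance; a tuple of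
      multidistance 0 is kept.\<close>
    proof (cases "D = 0")
      case True
      moreover have "0 \<le> (1 - \<eta>) ^ Suc n * K" using \<eta> K0 by (intro mult_nonneg_nonneg zero_le_power) auto
      moreover have "set_pmf (X i) \<subseteq> sums_of (m ^ (3 * Suc n)) S" if "i < m" for i using X(2) [OF that] mono by blast
      ultimately show ?thesis using X(1,4) by (intro exI [of _ X]) simp
    next
      case False
      then have D: "D > 0" using D_nonneg by simp
      have "\<exists>Y. (\<forall>i. finite (set_pmf (Y i))) \<and> (\<forall>i<m. set_pmf (Y i) \<subseteq> sums_of (m ^ 3) (sums_of (m ^ (3 * n)) S)) \<and>
        mdist m Y + \<eta> * (\<Sum>i<m. rdist (X i) (Y i)) \<le> (1 - \<eta>) * D"
        unfolding \<eta>_def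
      proof (rule decrement [OF D])
        show "0 \<in> sums_of (m ^ (3 * n)) S" by (rule zero_in_sums_of [OF S0])
        show "set_pmf (X i) \<subseteq> sums_of (m ^ (3 * n)) S" if "i < m" for i by (rule X(2) [OF that])
        show "smul m x = 0" if "x \<in> sums_of (m ^ (3 * n)) S" for x by (rule smul_sums_of [OF _ that]) (rule tor)
      qed
      then obtain Y where Y: "\<And>i. finite (set_pmf (Y i))" "\<And>i. i < m \<Longrightarrow> set_pmf (Y i) \<subseteq> sums_of (m ^ 3) (sums_of (m ^ (3 * n)) S)"
        "mdist m Y + \<eta> * (\<Sum>i<m. rdist (X i) (Y i)) \<le> (1 - \<eta>) * D"
        by blast
      have "set_pmf (Y i) \<subseteq> sums_of (m ^ (3 * Suc n)) S" if "i < m" for i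
      proof
        fix x assume "x \<in> set_pmf (Y i)"
        then have "x \<in> sums_of (m ^ 3) (sums_of (m ^ (3 * n)) S)" using Y(2) [OF that] by blast
        then have "x \<in> sums_of (m ^ 3 * m ^ (3 * n)) S" by (rule sums_of_mult)
        moreover have "m ^ 3 * m ^ (3 * n) = m ^ (3 * Suc n)" by (simp only: mult_Suc_right power_add)
        ultimately show "x \<in> sums_of (m ^ (3 * Suc n)) S" by (simp only:)
      qed
      moreover have "mdist m Y \<le> (1 - \<eta>) ^ Suc n * K"
      proof -
        have "0 \<le> (\<Sum>i<m. rdist (X i) (Y i))" by (intro sum_nonneg rdist_nonneg X(1) Y(1))
        then have "0 \<le> \<eta> * (\<Sum>i<m. rdist (X i) (Y i))" using \<eta>(1) by (intro mult_nonneg_nonneg)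
        then have "mdist m Y \<le> (1 - \<eta>) * D" using Y(3) by linarith
        also have "\<dots> \<le> (1 - \<eta>) * ((1 - \<eta>) ^ n * K)" using X(3) \<eta> by (intro mult_left_mono) auto
        finally show ?thesis by simp
      qed
      moreover have "mdist m Y + \<eta> * (\<Sum>i<m. rdist p (Y i)) \<le> K"
      proof -
        have "(\<Sum>i<m. rdist p (Y i)) \<le> (\<Sum>i<m. rdist p (X i) + rdist (X i) (Y i))"
          by (intro sum_mono rdist_triangle fp X(1) Y(1))
        then have "\<eta> * (\<Sum>i<m. rdist p (Y i)) \<le> \<eta> * ((\<Sum>i<m. rdist p (X i)) + (\<Sum>i<m. rdist (X i) (Y i)))"
          using \<eta> by (intro mult_left_mono) (auto simp: sum.distrib)
        moreover have "(1 - \<eta>) * D \<le> D" using \<eta> D by (simp add: mult_le_cancel_right1)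
        ultimately show ?thesis using X(4) Y(3) by (simp add: distrib_left)
      qed
      ultimately show ?thesis using Y(1) by blast
    qed
  qed
qed

text \<open>Covers the distance bounds, which need 645, and the exponent, where 3 n is at most 3
  (1720 m^3 L + 1) with \<open>L\<close> the logarithm of 2 + m d.\<close>

definition marton_const :: real where "marton_const = 10 ^ 4"

text \<open>2^42 exceeds 4 * 10^12. After taking logarithms the large constant is absorbed into a
  multiple of ln (2 + x).\<close>

lemma power_bound:
  fixes x :: real assumes "x \<ge> 0"
  shows "1 + 4 * 10 ^ 12 * x \<le> (2 + x) ^ 43"
proof -
  have "1 + 4 * 10 ^ 12 * x \<le> (2 :: real) ^ 42 * (2 + x)" using assms by simp
  also have "\<dots> \<le> (2 + x) ^ 42 * (2 + x)" using assms by (intro mult_right_mono power_mono) auto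
  also have "\<dots> = (2 + x) ^ 43" by (simp add: eval_nat_numeral)
  finally show ?thesis .
qed

text \<open>The absolute smallness of D serves only to enter
  \<open>near_subgroup_of_small_rdist\<close>; the distances are estimated through D \<le> K \<le> 4
  m d, which keeps them linear in d. The index i with X_i near p and the index j with small
  self-distance may differ; they are linked by \<open>rdist_neg_le\<close> and the invariance of U_H
  under negation.\<close>

theorem entropic_marton:
  fixes p q :: "'g::ab_group_add pmf"
  assumes m: "m \<ge> 2" and fp: "finite (set_pmf p)" "finite (set_pmf q)"
    and S: "0 \<in> S" "uminus ` S = S" "set_pmf p \<subseteq> S" "set_pmf q \<subseteq> S"
    and tor: "\<And>x. x \<in> S \<Longrightarrow> smul m x = 0"
  shows "\<exists>H l. add_subgroup H \<and> finite H \<and> l > 0 \<and> H \<subseteq> sums_of l S \<and>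
    rdist p (pmf_of_set H) \<le> marton_const * real m ^ 3 * rdist p q \<and>
    rdist q (pmf_of_set H) \<le> marton_const * real m ^ 3 * rdist p q \<and>
    real l \<le> marton_const * (2 + real m * rdist p q) powr (marton_const * real m ^ 3 * ln (real m))"
proof -
  define \<eta> where "\<eta> = 1 / (40 * real m ^ 3)"
  define d where "d = rdist p q"
  define K where "K = 2 * real m * rdist p p"
  have m0: "real m > 0" and m1: "real m \<ge> 1" using m by auto
  have m3: "real m ^ 3 \<ge> 8" using power_mono [of 2 "real m" 3] m by simp
  have \<eta>: "0 < \<eta>" "\<eta> \<le> 1" using m3 m0 by (auto simp: \<eta>_def field_simps)
  have d0: "d \<ge> 0" unfolding d_def by (rule rdist_nonneg [OF fp])
  have pp0: "rdist p p \<ge> 0" by (rule rdist_nonneg [OF fp(1) fp(1)])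
  have pp: "rdist p p \<le> 2 * d"
    using rdist_triangle [OF fp(1) fp(2) fp(1)] by (simp add: d_def rdist_commute)
  have K0: "K \<ge> 0" using pp0 by (simp add: K_def)
  have K: "K \<le> 4 * m * d" using mult_left_mono [OF pp, of "2 * m"] by (simp add: K_def)
  \<comment> \<open>As (1 - \<eta>)^n is at most exp (- \<eta> n), so many steps bring K down to K /
    (1 + 10^12 K), which is below 10^-12.\<close>
  define n where "n = nat \<lceil>ln (1 + 10 ^ 12 * K) / \<eta>\<rceil>"
  have ln0: "ln (1 + 10 ^ 12 * K) \<ge> 0" using K0 by simp
  have n_ge: "ln (1 + 10 ^ 12 * K) \<le> \<eta> * n"
  proof -
    have "ln (1 + 10 ^ 12 * K) / \<eta> \<le> n" unfolding n_def by (rule real_nat_ceiling_ge)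
    then show ?thesis using \<eta> by (simp add: field_simps)
  qed
  have n_le: "real n \<le> ln (1 + 10 ^ 12 * K) / \<eta> + 1"
  proof -
    have "0 \<le> ln (1 + 10 ^ 12 * K) / \<eta>" using ln0 \<eta> by simp
    then have "real n = of_int \<lceil>ln (1 + 10 ^ 12 * K) / \<eta>\<rceil>" unfolding n_def by (intro of_nat_nat) simp
    then show ?thesis using of_int_ceiling_le_add_one [of "ln (1 + 10 ^ 12 * K) / \<eta>"] by simp
  qed
  have "\<exists>X. (\<forall>i. finite (set_pmf (X i))) \<and> (\<forall>i<m. set_pmf (X i) \<subseteq> sums_of (m ^ (3 * n)) S) \<and>
    mdist m X \<le> (1 - \<eta>) ^ n * K \<and> mdist m X + \<eta> * (\<Sum>i<m. rdist p (X i)) \<le> K"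
    unfolding \<eta>_def K_def by (rule iterated_decrement [OF m fp(1) S(1) S(3)]) (rule tor)
  then obtain X where X: "\<And>i. finite (set_pmf (X i))" "\<And>i. i < m \<Longrightarrow> set_pmf (X i) \<subseteq> sums_of (m ^ (3 * n)) S"
    "mdist m X \<le> (1 - \<eta>) ^ n * K" "mdist m X + \<eta> * (\<Sum>i<m. rdist p (X i)) \<le> K"
    by blast
  interpret tuple m X by unfold_locales (rule m, rule X(1))
  have small: "D \<le> 1 / 10 ^ 12"
  proof -
    have "(1 - \<eta>) ^ n \<le> exp (- \<eta>) ^ n" using \<eta> exp_ge_add_one_self [of "- \<eta>"] by (intro power_mono) auto
    also have "\<dots> = exp (- (\<eta> * n))" using exp_of_nat_mult [of n "- \<eta>"] by (simp add: mult.commute)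
    also have "\<dots> \<le> exp (- ln (1 + 10 ^ 12 * K))" using n_ge by simp
    also have "\<dots> = 1 / (1 + 10 ^ 12 * K)" using K0 by (simp add: exp_minus inverse_eq_divide)
    finally have "(1 - \<eta>) ^ n * K \<le> 1 / (1 + 10 ^ 12 * K) * K" using K0 by (rule mult_right_mono)
    also have "\<dots> \<le> 1 / 10 ^ 12" using K0 by (simp add: field_simps)
    finally show ?thesis using X(3) by simp
  qed
  have pX0: "0 \<le> (\<Sum>i<m. rdist p (X i))" by (intro sum_nonneg rdist_nonneg fp(1) X(1))
  have DK: "D \<le> K" using X(4) pX0 \<eta> mult_nonneg_nonneg [of \<eta> "\<Sum>i<m. rdist p (X i)"] by linarith
  \<comment> \<open>Pigeonhole: \<eta> times the sum of the m distances is at most 4 m d, and 160 =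
    4 * 40.\<close>
  have "\<exists>i<m. rdist p (X i) \<le> 160 * m ^ 3 * d"
  proof (rule ccontr)
    assume "\<not> ?thesis"
    then have "(\<Sum>i<m. 160 * m ^ 3 * d) < (\<Sum>i<m. rdist p (X i))"
      using m by (intro sum_strict_mono) (auto simp: not_le lessThan_empty_iff)
    then have "\<eta> * (m * (160 * m ^ 3 * d)) < \<eta> * (\<Sum>i<m. rdist p (X i))"
      using \<eta> by simp
    also have "\<dots> \<le> 4 * m * d" using X(4) D_nonneg K by linarith
    finally show False using m0 by (simp add: \<eta>_def field_simps)
  qed
  then obtain i where i: "i < m" "rdist p (X i) \<le> 160 * m ^ 3 * d" by blast
  have "\<exists>j<m. rdist (X j) (X j) \<le> 2 * D"
  proof (rule ccontr)
    assume "\<not> ?thesis"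
    then have "(\<Sum>i<m. 2 * D) < (\<Sum>i<m. rdist (X i) (X i))"
      using m by (intro sum_strict_mono) (auto simp: not_le lessThan_empty_iff)
    then show False using sum_rdist_self_le by simp
  qed
  then obtain j where j: "j < m" "rdist (X j) (X j) \<le> 2 * D" by blast
  have "rdist (X j) (X j) \<le> 1 / 10 ^ 11" using j(2) small by simp
  from near_subgroup_of_small_rdist [OF X(1) this] obtain H where H: "add_subgroup H" "finite H"
    "H \<subseteq> {x - y |x y. x \<in> set_pmf (conv (X j) (neg (X j))) \<and> y \<in> set_pmf (conv (X j) (neg (X j)))}"
    "rdist (X j) (pmf_of_set H) \<le> 60 * rdist (X j) (X j)" by blast
  let ?u = "pmf_of_set H"
  have ne: "H \<noteq> {}" using H(1) by (auto simp: add_subgroup_def)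
  have finu: "finite (set_pmf ?u)" using H(2) ne by simp
  define a where "a = m ^ (3 * n)"
  \<comment> \<open>Elements of \<open>H\<close> are differences of two differences of support
    points, so four blocks of length \<open>a\<close> suffice.\<close>
  have H_sub: "H \<subseteq> sums_of (4 * a) S"
  proof
    fix h assume "h \<in> H"
    then obtain x y where h: "h = x - y" "x \<in> set_pmf (conv (X j) (neg (X j)))" "y \<in> set_pmf (conv (X j) (neg (X j)))"
      using H(3) by blast
    have diff: "x \<in> sums_of (a + a) S" if x: "x \<in> set_pmf (conv (X j) (neg (X j)))" for x
    proof -
      obtain u v where uv: "x = u + - v" "u \<in> set_pmf (X j)" "v \<in> set_pmf (X j)"
        using x by (auto simp: set_conv set_neg)
      then have "u \<in> sums_of a S" "- v \<in> sums_of a S"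
        using X(2) [OF j(1)] sums_of_uminus [OF S(2)] by (auto simp: a_def)
      then show ?thesis unfolding uv(1) by (rule sums_of_add)
    qed
    have "x + - y \<in> sums_of ((a + a) + (a + a)) S"
      by (intro sums_of_add diff h sums_of_uminus [OF S(2)])
    moreover have "a + a + (a + a) = 4 * a" by simp
    ultimately show "h \<in> sums_of (4 * a) S" unfolding h(1) by (simp only: diff_conv_add_uminus)
  qed
  have j': "rdist (X j) ?u \<le> 480 * m * d" using H(4) j(2) DK K by linarith
  have i': "rdist (X i) ?u \<le> 4 * (m * m) * d + 480 * m * d"
  proof (cases "i = j")
    case True
    moreover have "0 \<le> 4 * (m * m) * d" using d0 by (intro mult_nonneg_nonneg) auto
    ultimately show ?thesis using j' unfolding True by linarith
  next
    case False
    have "rdist (X i) ?u \<le> rdist (X i) (neg (X j)) + rdist (neg (X j)) ?u"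
      by (rule rdist_triangle) (use X(1) finu in auto)
    moreover have "rdist (neg (X j)) ?u = rdist (X j) ?u"
      using rdist_neg_neg [of "X j" ?u] neg_pmf_of_set [OF H(1,2)] by simp
    moreover have "rdist (X i) (neg (X j)) \<le> m * D" by (rule rdist_neg_le [OF i(1) j(1) False])
    moreover have "m * D \<le> m * (4 * m * d)" using DK K by (intro mult_left_mono) auto
    moreover have "m * (4 * m * d) = 4 * (m * m) * d" by simp
    ultimately show ?thesis using j' by linarith
  qed
  have p_u: "rdist p ?u \<le> 644 * (m ^ 3 * d)"
  proof -
    have "rdist p ?u \<le> rdist p (X i) + rdist (X i) ?u"
      by (rule rdist_triangle) (use X(1) fp finu in auto)
    moreover have "real (m * m) * d \<le> real (m ^ 3) * d" "real m * d \<le> real (m ^ 3) * d"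
      using m d0 power_increasing [of 1 3 m] power_increasing [of 2 3 m]
      by (auto intro!: mult_right_mono simp del: of_nat_mult of_nat_power simp: power2_eq_square)
    ultimately show ?thesis using i(2) i' by (simp add: algebra_simps)
  qed
  have dm: "d \<le> m ^ 3 * d" using m3 d0 mult_right_mono [of 1 "real m ^ 3" d] by simp
  have q_u: "rdist q ?u \<le> 645 * (m ^ 3 * d)"
  proof -
    have "rdist q ?u \<le> rdist q p + rdist p ?u"
      by (rule rdist_triangle) (use fp finu in auto)
    then show ?thesis using p_u dm by (simp add: d_def rdist_commute)
  qed
  have md0: "m ^ 3 * d \<ge> 0" using d0 by simp
  define L where "L = ln (2 + m * d)"
  have L: "L \<ge> 1 / 2"
  proof -
    have "ln 2 \<le> L" unfolding L_def using d0 mult_nonneg_nonneg [of "real m" d] by (intro ln_mono) auto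
    then show ?thesis using ln2_ge_two_thirds by linarith
  qed
  have lnm: "ln (real m) \<ge> 0" using m by simp
  have lnK: "ln (1 + 10 ^ 12 * K) \<le> 43 * L"
  proof -
    have "1 + 10 ^ 12 * K \<le> 1 + 4 * 10 ^ 12 * (m * d)" using K by (simp add: mult_ac)
    also have "\<dots> \<le> (2 + m * d) ^ 43" using d0 by (intro power_bound) simp
    finally have "ln (1 + 10 ^ 12 * K) \<le> ln ((2 + m * d) ^ 43)" using K0 by (intro ln_mono) auto
    also have "\<dots> = 43 * L" unfolding L_def using d0 m0 by (subst ln_realpow) (auto intro: add_pos_nonneg)
    finally show ?thesis .
  qed
  have "ln (1 + 10 ^ 12 * K) / \<eta> \<le> 43 * L / \<eta>" using lnK \<eta> by (intro divide_right_mono) auto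
  moreover have "43 * L / \<eta> = 1720 * (m ^ 3 * L)" by (simp add: \<eta>_def)
  ultimately have n_le': "real n \<le> 1720 * (m ^ 3 * L) + 1" using n_le by linarith
  have m3L: "1 \<le> m ^ 3 * L" using mult_mono [of 8 "real m ^ 3" "1 / 2" L] m3 L by simp
  have "3 * real n \<le> 10 ^ 4 * (m ^ 3 * L)" using n_le' m3L by simp
  then have "3 * real n * ln m \<le> 10 ^ 4 * (m ^ 3 * L) * ln m" using lnm by (rule mult_right_mono)
  then have exp_le: "exp (3 * real n * ln m) \<le> exp (10 ^ 4 * real m ^ 3 * ln m * L)" by (simp add: mult_ac)
  have "4 * exp (3 * real n * ln m) \<le> 10 ^ 4 * exp (10 ^ 4 * real m ^ 3 * ln m * L)"
    by (rule mult_mono [OF _ exp_le]) auto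
  moreover have "real a = exp (3 * real n * ln m)"
  proof -
    have "real a = exp (ln (real m ^ (3 * n)))" using m0 by (simp add: a_def)
    then show ?thesis using m0 by (simp add: ln_realpow)
  qed
  moreover have "(2 + m * d) powr (10 ^ 4 * real m ^ 3 * ln m) = exp (10 ^ 4 * real m ^ 3 * ln m * L)"
  proof -
    have "2 + m * d \<noteq> 0" using d0 m0 by (smt (verit) mult_nonneg_nonneg)
    then show ?thesis by (simp add: powr_def L_def)
  qed
  ultimately have "real (4 * a) \<le> 10 ^ 4 * (2 + m * d) powr (10 ^ 4 * real m ^ 3 * ln m)"
    unfolding of_nat_mult by simp
  moreover have "4 * a > 0" using m by (simp add: a_def)
  moreover have "644 * (m ^ 3 * d) \<le> 10 ^ 4 * real m ^ 3 * d" "645 * (m ^ 3 * d) \<le> 10 ^ 4 * real m ^ 3 * d"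
    using md0 by (simp_all add: mult.commute)
  ultimately show ?thesis
    unfolding marton_const_def d_def [symmetric] using H(1,2) H_sub order_trans [OF p_u] order_trans [OF q_u] by blast
qed

section \<open>Transfer between groups\<close>

definition zsubgroup :: "(nat \<Rightarrow> int) set \<Rightarrow> bool" where
  "zsubgroup R \<longleftrightarrow> (\<lambda>_. 0) \<in> R \<and> (\<forall>f\<in>R. \<forall>g\<in>R. (\<lambda>i. f i - g i) \<in> R)"

text \<open>Indexing by all sets of vectors and imposing nothing at those that are not subgroups
  avoids a type of subgroups; the factors at such sets become trivial.\<close>

definition ucong :: "((nat \<Rightarrow> int) set \<Rightarrow> nat \<Rightarrow> int) \<Rightarrow> ((nat \<Rightarrow> int) set \<Rightarrow> nat \<Rightarrow> int) \<Rightarrow> bool" where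
  "ucong f g \<longleftrightarrow> (\<forall>R. zsubgroup R \<longrightarrow> (\<lambda>i. f R i - g R i) \<in> R)"

lemma zsubgroup_diff: "zsubgroup R \<Longrightarrow> f \<in> R \<Longrightarrow> g \<in> R \<Longrightarrow> (\<lambda>i. f i - g i) \<in> R"
  by (simp add: zsubgroup_def)

lemma zsubgroup_uminus: "zsubgroup R \<Longrightarrow> f \<in> R \<Longrightarrow> (\<lambda>i. - f i) \<in> R"
  using zsubgroup_diff [of R "\<lambda>_. 0" f] by (simp add: zsubgroup_def)

lemma zsubgroup_add: "zsubgroup R \<Longrightarrow> f \<in> R \<Longrightarrow> g \<in> R \<Longrightarrow> (\<lambda>i. f i + g i) \<in> R"
  using zsubgroup_diff [of R f "\<lambda>i. - g i"] zsubgroup_uminus [of R g] by simp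

lemma equivp_ucong: "equivp ucong"
proof (rule equivpI)
  show "reflp ucong" by (auto simp: reflp_def ucong_def zsubgroup_def)
  show "symp ucong"
  proof (rule sympI)
    fix f g assume "ucong f g"
    then show "ucong g f"
      unfolding ucong_def using zsubgroup_uminus by fastforce
  qed
  show "transp ucong"
  proof (rule transpI)
    fix f g h assume "ucong f g" "ucong g h"
    then show "ucong f h"
      unfolding ucong_def using zsubgroup_add by fastforce
  qed
qed

text \<open>The product of all quotients of \<open>\<int>\<^sup>\<nat>\<close> by subgroups. Every finite abelian group is such a quotient, so it embeds
  into this single type of class \<^class>\<open>ab_group_add\<close>.\<close>

quotient_type universal_group = "(nat \<Rightarrow> int) set \<Rightarrow> nat \<Rightarrow> int" / ucong
  by (rule equivp_ucong)

instantiation universal_group :: ab_group_add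
begin

lift_definition zero_universal_group :: universal_group is "\<lambda>_ _. 0" .

lift_definition plus_universal_group :: "universal_group \<Rightarrow> universal_group \<Rightarrow> universal_group"
  is "\<lambda>f g R i. f R i + g R i"
proof -
  fix f f' g g' assume *: "ucong f f'" "ucong g g'"
  show "ucong (\<lambda>R i. f R i + g R i) (\<lambda>R i. f' R i + g' R i)"
    unfolding ucong_def
  proof (intro allI impI)
    fix R assume R: "zsubgroup R"
    then have "(\<lambda>i. (f R i - f' R i) + (g R i - g' R i)) \<in> R"
      using * by (intro zsubgroup_add) (auto simp: ucong_def)
    then show "(\<lambda>i. f R i + g R i - (f' R i + g' R i)) \<in> R" by (simp add: algebra_simps)
  qed
qed

lift_definition uminus_universal_group :: "universal_group \<Rightarrow> universal_group" is "\<lambda>f R i. - f R i"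
proof -
  fix f f' assume *: "ucong f f'"
  show "ucong (\<lambda>R i. - f R i) (\<lambda>R i. - f' R i)"
    unfolding ucong_def
  proof (intro allI impI)
    fix R assume R: "zsubgroup R"
    then have "(\<lambda>i. - (f R i - f' R i)) \<in> R"
      using * by (intro zsubgroup_uminus) (auto simp: ucong_def)
    then show "(\<lambda>i. - f R i - - f' R i) \<in> R" by simp
  qed
qed

definition minus_universal_group :: "universal_group \<Rightarrow> universal_group \<Rightarrow> universal_group" where
  "minus_universal_group x y = x + - y"

instance
proof
  fix a b c :: universal_group
  show "a + b + c = a + (b + c)" by transfer (simp add: ucong_def zsubgroup_def add.assoc)
  show "a + b = b + a" by transfer (simp add: ucong_def zsubgroup_def)
  show "0 + a = a" by transfer (simp add: ucong_def zsubgroup_def)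
  show "- a + a = 0" by transfer (simp add: ucong_def zsubgroup_def)
  show "a - b = a + - b" by (rule minus_universal_group_def)
qed

end

text \<open>\<open>\<Phi>\<close> maps integer vectors homomorphically onto G, with kernel
  \<open>R\<close>. The embedding sends x to the class of the unit vector at x, placed in the factor
  belonging to \<open>R\<close>, with 0 in all other factors.\<close>

lemma finite_comm_group_embeds:
  fixes G (structure)
  assumes "comm_group G" and fin: "finite (carrier G)"
  shows "\<exists>\<iota> :: 'a \<Rightarrow> universal_group. inj_on \<iota> (carrier G) \<and>
    (\<forall>x\<in>carrier G. \<forall>y\<in>carrier G. \<iota> (x \<otimes> y) = \<iota> x + \<iota> y)"
proof -
  interpret comm_group G by fact
  obtain f :: "'a \<Rightarrow> nat" where f: "inj_on f (carrier G)"
    using finite_imp_inj_to_nat_seg [OF fin] by blast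
  define \<Phi> where "\<Phi> v = (\<Otimes>x\<in>carrier G. x [^] (v (f x) :: int))" for v
  have \<Phi>_cl: "\<Phi> v \<in> carrier G" for v unfolding \<Phi>_def by (rule finprod_closed) auto
  have \<Phi>_add: "\<Phi> (\<lambda>i. v i + w i) = \<Phi> v \<otimes> \<Phi> w" for v w
  proof -
    have "\<Phi> (\<lambda>i. v i + w i) = (\<Otimes>x\<in>carrier G. x [^] v (f x) \<otimes> x [^] w (f x))"
      unfolding \<Phi>_def by (rule finprod_cong') (auto simp: int_pow_mult)
    then show ?thesis unfolding \<Phi>_def by (simp add: finprod_multf)
  qed
  have \<Phi>_0: "\<Phi> (\<lambda>_. 0) = \<one>" unfolding \<Phi>_def by (simp add: finprod_one_eqI)
  have \<Phi>_diff: "\<Phi> (\<lambda>i. v i - w i) \<otimes> \<Phi> w = \<Phi> v" for v w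
    using \<Phi>_add [of "\<lambda>i. v i - w i" w] by simp
  define R where "R = {v. \<Phi> v = \<one>}"
  have R: "zsubgroup R"
    unfolding zsubgroup_def
  proof (intro conjI ballI)
    show "(\<lambda>_. 0) \<in> R" by (simp add: R_def \<Phi>_0)
    fix v w assume "v \<in> R" "w \<in> R"
    then show "(\<lambda>i. v i - w i) \<in> R" using \<Phi>_diff [of v w] \<Phi>_cl by (simp add: R_def)
  qed
  define \<delta> where "\<delta> x i = (if i = f x then 1 else 0 :: int)" for x i
  have \<Phi>_\<delta>: "\<Phi> (\<delta> x) = x" if x: "x \<in> carrier G" for x
  proof -
    have "\<Phi> (\<delta> x) = (\<Otimes>y\<in>carrier G. if x = y then y else \<one>)"
      unfolding \<Phi>_def
    proof (rule finprod_cong')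
      fix y assume y: "y \<in> carrier G"
      show "y [^] \<delta> x (f y) = (if x = y then y else \<one>)"
        using f x y by (auto simp: \<delta>_def inj_on_def int_pow_1)
    qed auto
    also have "\<dots> = x" by (rule finprod_singleton) (use x fin in auto)
    finally show ?thesis .
  qed
  define \<iota> where "\<iota> x = abs_universal_group (\<lambda>R'. if R' = R then \<delta> x else (\<lambda>_. 0))" for x
  have "\<iota> (x \<otimes> y) = \<iota> x + \<iota> y" if xy: "x \<in> carrier G" "y \<in> carrier G" for x y
  proof -
    have "\<Phi> (\<lambda>i. \<delta> (x \<otimes> y) i - (\<delta> x i + \<delta> y i)) \<otimes> (x \<otimes> y) = x \<otimes> y"
      using \<Phi>_diff [of "\<delta> (x \<otimes> y)" "\<lambda>i. \<delta> x i + \<delta> y i"] xy by (simp add: \<Phi>_add \<Phi>_\<delta>)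
    then have "(\<lambda>i. \<delta> (x \<otimes> y) i - (\<delta> x i + \<delta> y i)) \<in> R"
      using xy \<Phi>_cl by (simp add: R_def r_cancel_one')
    then show ?thesis
      unfolding \<iota>_def plus_universal_group.abs_eq
      by (subst universal_group.abs_eq_iff) (auto simp: ucong_def zsubgroup_def)
  qed
  moreover have "inj_on \<iota> (carrier G)"
  proof (rule inj_onI)
    fix x y assume xy: "x \<in> carrier G" "y \<in> carrier G" "\<iota> x = \<iota> y"
    then have "(\<lambda>i. \<delta> x i - \<delta> y i) \<in> R"
      using R unfolding \<iota>_def universal_group.abs_eq_iff ucong_def by force
    then show "x = y" using \<Phi>_diff [of "\<delta> x" "\<delta> y"] xy by (simp add: R_def \<Phi>_\<delta>)
  qed
  ultimately show ?thesis by blast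
qed

text \<open>Exponents of \<open>a\<close> matter only modulo \<open>m\<close>, so there are finitely
  many products of a power of \<open>a\<close> and an element of \<open>K\<close>.\<close>

lemma (in comm_group) finite_subgroup_insert:
  assumes K: "subgroup K G" "finite K" and a: "a \<in> carrier G" "a [^] (m::nat) = \<one>" "m > 0"
  shows "\<exists>K'. subgroup K' G \<and> finite K' \<and> K \<subseteq> K' \<and> a \<in> K'"
proof -
  interpret K: subgroup K G by (rule K(1))
  define K' where "K' = {a [^] (i::nat) \<otimes> k |i k. k \<in> K}"
  have inK': "a [^] (i::nat) \<otimes> k \<in> K'" if "k \<in> K" for i k using that by (auto simp: K'_def)
  have mod: "a [^] (i mod m) = a [^] i" for i :: nat
  proof -
    have "a [^] i = a [^] (m * (i div m) + i mod m)" by simp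
    also have "\<dots> = (a [^] m) [^] (i div m) \<otimes> a [^] (i mod m)"
      using a(1) by (simp only: nat_pow_mult [symmetric] nat_pow_pow)
    finally show ?thesis using a by simp
  qed
  have "K' \<subseteq> (\<lambda>(i, k). a [^] i \<otimes> k) ` ({..<m} \<times> K)"
  proof
    fix x assume "x \<in> K'"
    then obtain i k where "x = a [^] (i::nat) \<otimes> k" "k \<in> K" by (auto simp: K'_def)
    then have "x = (\<lambda>(i, k). a [^] i \<otimes> k) (i mod m, k)" "(i mod m, k) \<in> {..<m} \<times> K"
      using a(3) by (auto simp: mod)
    then show "x \<in> (\<lambda>(i, k). a [^] i \<otimes> k) ` ({..<m} \<times> K)" by blast
  qed
  then have fin: "finite K'" by (rule finite_subset) (use K(2) in auto)
  have sub: "subgroup K' G"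
  proof (rule subgroupI)
    show "K' \<subseteq> carrier G" using a(1) K.subset by (auto simp: K'_def)
    show "K' \<noteq> {}" using inK' [of \<one> 0] by auto
    fix x assume "x \<in> K'"
    then obtain i k where x: "x = a [^] (i::nat) \<otimes> k" "k \<in> K" by (auto simp: K'_def)
    have k: "k \<in> carrier G" using x(2) K.subset by auto
    have "inv (a [^] i) = a [^] (i * (m - 1))"
    proof (rule inv_equality)
      have "a [^] (i * (m - 1)) \<otimes> a [^] i = a [^] (i * m)"
      proof -
        have "i * (m - 1) + i = i * m" using a(3) by (cases m) auto
        then show ?thesis using a(1) by (simp only: nat_pow_mult)
      qed
      also have "\<dots> = (a [^] m) [^] i" using a(1) by (simp add: nat_pow_pow mult.commute)
      finally show "a [^] (i * (m - 1)) \<otimes> a [^] i = \<one>" using a(2) by simp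
    qed (use a(1) in auto)
    then have "inv x = a [^] (i * (m - 1)) \<otimes> inv k"
      using a(1) k by (simp add: x(1) inv_mult)
    then show "inv x \<in> K'" using x(2) by (simp add: inK')
    fix y assume "y \<in> K'"
    then obtain j l where y: "y = a [^] (j::nat) \<otimes> l" "l \<in> K" by (auto simp: K'_def)
    have l: "l \<in> carrier G" using y(2) K.subset by auto
    have "x \<otimes> y = (a [^] i \<otimes> a [^] j) \<otimes> (k \<otimes> l)"
      using a(1) k l by (simp add: x(1) y(1) m_ac)
    also have "\<dots> = a [^] (i + j) \<otimes> (k \<otimes> l)" using a(1) by (simp add: nat_pow_mult)
    finally show "x \<otimes> y \<in> K'" using x(2) y(2) by (simp add: inK')
  qed
  have "K \<subseteq> K'"
  proof
    fix k assume "k \<in> K"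
    then show "k \<in> K'" using inK' [of k 0] K.subset by auto
  qed
  moreover have "a \<in> K'" using inK' [of \<one> 1] a(1) by simp
  ultimately show ?thesis using sub fin by blast
qed

lemma (in comm_group) finite_subgroup_containing:
  assumes A: "finite A" "A \<subseteq> carrier G" and tor: "\<forall>g\<in>carrier G. g [^] (m::nat) = \<one>" "m > 0"
  shows "\<exists>K. subgroup K G \<and> finite K \<and> A \<subseteq> K"
  using A
proof (induction A rule: finite_induct)
  case empty
  show ?case using triv_subgroup by blast
next
  case (insert a A)
  then obtain K where "subgroup K G" "finite K" "A \<subseteq> K" by auto
  then show ?case using finite_subgroup_insert [of K a m] tor insert.prems by blast
qed

section \<open>The theorem for distributions in a group with carrier\<close>

definition gdist :: "'a monoid \<Rightarrow> 'a pmf \<Rightarrow> 'a pmf \<Rightarrow> real" where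
  "gdist G p q = pent (map_pmf (\<lambda>\<omega>. fst \<omega> \<otimes>\<^bsub>G\<^esub> inv\<^bsub>G\<^esub> (snd \<omega>)) (pair_pmf p q)) - pent p / 2 - pent q / 2"

text \<open>Speaking of distributions removes the types of the sample spaces and leaves only that of
  the group elements. The claim without a symmetric set is the case where \<open>S\<close> is the
  carrier.\<close>

definition marton_law :: "real \<Rightarrow> nat \<Rightarrow> 'a monoid \<Rightarrow> 'a pmf \<Rightarrow> 'a pmf \<Rightarrow> 'a set \<Rightarrow> bool" where
  "marton_law C m G p q S \<longleftrightarrow> (\<exists>H l. subgroup H G \<and> finite H \<and> l > 0 \<and> H \<subseteq> iterated_sumset G l S \<and>
     gdist G p (pmf_of_set H) \<le> C * real m ^ 3 * gdist G p q \<and>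
     gdist G q (pmf_of_set H) \<le> C * real m ^ 3 * gdist G p q \<and>
     real l \<le> C * (2 + real m * gdist G p q) powr (C * real m ^ 3 * ln (real m)))"

definition marton_data :: "nat \<Rightarrow> 'a monoid \<Rightarrow> 'a pmf \<Rightarrow> 'a pmf \<Rightarrow> 'a set \<Rightarrow> bool" where
  "marton_data m G p q S \<longleftrightarrow> m \<ge> 2 \<and> comm_group G \<and> (\<forall>g\<in>carrier G. g [^]\<^bsub>G\<^esub> m = \<one>\<^bsub>G\<^esub>) \<and>
     finite (set_pmf p) \<and> finite (set_pmf q) \<and> S \<subseteq> carrier G \<and> set_inv\<^bsub>G\<^esub> S = S \<and> \<one>\<^bsub>G\<^esub> \<in> S \<and>
     set_pmf p \<subseteq> S \<and> set_pmf q \<subseteq> S"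

lemma set_inv_eq_image: "set_inv\<^bsub>G\<^esub> S = (\<lambda>x. inv\<^bsub>G\<^esub> x) ` S"
  by (auto simp: SET_INV_def)

lemma iterated_sumset_mono: "A \<subseteq> B \<Longrightarrow> iterated_sumset G l A \<subseteq> iterated_sumset G l B"
proof (induction l)
  case (Suc l)
  then show ?case by (simp add: set_mult_def) blast
qed simp

locale subgroup_embedding = G: comm_group G + G': comm_group G' + K: subgroup K G
  for G :: "'a monoid" (structure) and G' :: "'b monoid" (structure) and K +
  fixes \<psi> :: "'a \<Rightarrow> 'b"
  assumes \<psi>_carrier: "x \<in> K \<Longrightarrow> \<psi> x \<in> carrier G'"
    and \<psi>_mult: "x \<in> K \<Longrightarrow> y \<in> K \<Longrightarrow> \<psi> (x \<otimes> y) = \<psi> x \<otimes>\<^bsub>G'\<^esub> \<psi> y"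
    and \<psi>_inj: "inj_on \<psi> K"
begin

lemma \<psi>_one: "\<psi> \<one> = \<one>\<^bsub>G'\<^esub>"
proof -
  have "\<psi> \<one> \<otimes>\<^bsub>G'\<^esub> \<psi> \<one> = \<psi> \<one>" using \<psi>_mult [of \<one> \<one>, symmetric] by simp
  then show ?thesis using \<psi>_carrier [of \<one>] G'.l_cancel_one' [of "\<psi> \<one>" "\<psi> \<one>"] by simp
qed

lemma \<psi>_inv: "x \<in> K \<Longrightarrow> \<psi> (inv x) = inv\<^bsub>G'\<^esub> (\<psi> x)"
proof -
  assume x: "x \<in> K"
  have "\<psi> (inv x) \<otimes>\<^bsub>G'\<^esub> \<psi> x = \<one>\<^bsub>G'\<^esub>"
    using \<psi>_mult [of "inv x" x] x K.subset by (auto simp: \<psi>_one)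
  then show ?thesis using x by (intro G'.inv_equality [symmetric] \<psi>_carrier) auto
qed

lemma iterated_sumset_K: "T \<subseteq> K \<Longrightarrow> iterated_sumset G l T \<subseteq> K"
  by (induction l) (auto simp: set_mult_def)

lemma iterated_sumset_image: "T \<subseteq> K \<Longrightarrow> iterated_sumset G' l (\<psi> ` T) = \<psi> ` iterated_sumset G l T"
proof (induction l)
  case (Suc l)
  have K: "iterated_sumset G l T \<subseteq> K" by (rule iterated_sumset_K [OF Suc.prems])
  have "iterated_sumset G' (Suc l) (\<psi> ` T) = {\<psi> x \<otimes>\<^bsub>G'\<^esub> \<psi> y |x y. x \<in> iterated_sumset G l T \<and> y \<in> T}"
    using Suc by (auto simp: set_mult_def)
  also have "\<dots> = {\<psi> (x \<otimes> y) |x y. x \<in> iterated_sumset G l T \<and> y \<in> T}"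
    using \<psi>_mult K Suc.prems by (metis (no_types, lifting) subsetD)
  also have "\<dots> = \<psi> ` iterated_sumset G (Suc l) T" by (auto simp: set_mult_def)
  finally show ?case .
qed (simp add: \<psi>_one)

lemma gdist_image:
  assumes "set_pmf p \<subseteq> K" "set_pmf q \<subseteq> K"
  shows "gdist G' (map_pmf \<psi> p) (map_pmf \<psi> q) = gdist G p q"
proof -
  have "map_pmf (\<lambda>\<omega>. fst \<omega> \<otimes>\<^bsub>G'\<^esub> inv\<^bsub>G'\<^esub> (snd \<omega>)) (pair_pmf (map_pmf \<psi> p) (map_pmf \<psi> q)) =
    map_pmf (\<lambda>\<omega>. \<psi> (fst \<omega>) \<otimes>\<^bsub>G'\<^esub> inv\<^bsub>G'\<^esub> (\<psi> (snd \<omega>))) (pair_pmf p q)"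
    unfolding map_pair [symmetric] by (simp add: map_pmf_comp case_prod_unfold)
  also have "\<dots> = map_pmf \<psi> (map_pmf (\<lambda>\<omega>. fst \<omega> \<otimes> inv (snd \<omega>)) (pair_pmf p q))"
    unfolding map_pmf_comp
    by (rule map_pmf_cong) (use assms in \<open>auto simp: \<psi>_mult \<psi>_inv subset_iff\<close>)
  moreover have sub: "set_pmf (map_pmf (\<lambda>\<omega>. fst \<omega> \<otimes> inv (snd \<omega>)) (pair_pmf p q)) \<subseteq> K"
    using assms by (auto simp: subset_iff)
  ultimately have 1: "pent (map_pmf (\<lambda>\<omega>. fst \<omega> \<otimes>\<^bsub>G'\<^esub> inv\<^bsub>G'\<^esub> (snd \<omega>)) (pair_pmf (map_pmf \<psi> p) (map_pmf \<psi> q))) =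
     pent (map_pmf (\<lambda>\<omega>. fst \<omega> \<otimes> inv (snd \<omega>)) (pair_pmf p q))"
    using pent_map_inj [OF inj_on_subset [OF \<psi>_inj], of "map_pmf (\<lambda>\<omega>. fst \<omega> \<otimes> inv (snd \<omega>)) (pair_pmf p q)"] sub
    by simp
  have "pent (map_pmf \<psi> p) = pent p" "pent (map_pmf \<psi> q) = pent q"
    by (intro pent_map_inj inj_on_subset [OF \<psi>_inj] assms)+
  then show ?thesis using 1 by (simp add: gdist_def)
qed

text \<open>The subgroup \<open>H'\<close> is pulled back along \<open>\<psi>\<close>. It lies in an
  iterated sumset of the image of \<open>T\<close>, hence in the image of \<open>K\<close>, so its
  preimage is mapped bijectively onto it and the uniform distributions correspond.\<close>

lemma marton_law_image:
  assumes T: "T \<subseteq> K" "T \<subseteq> S" and pq: "set_pmf p \<subseteq> T" "set_pmf q \<subseteq> T"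
    and law: "marton_law C m G' (map_pmf \<psi> p) (map_pmf \<psi> q) (\<psi> ` T)"
  shows "marton_law C m G p q S"
proof -
  have pK: "set_pmf p \<subseteq> K" "set_pmf q \<subseteq> K" using T pq by auto
  obtain H' l where H': "subgroup H' G'" "finite H'" "l > 0" "H' \<subseteq> iterated_sumset G' l (\<psi> ` T)"
    "gdist G' (map_pmf \<psi> p) (pmf_of_set H') \<le> C * real m ^ 3 * gdist G p q"
    "gdist G' (map_pmf \<psi> q) (pmf_of_set H') \<le> C * real m ^ 3 * gdist G p q"
    "real l \<le> C * (2 + real m * gdist G p q) powr (C * real m ^ 3 * ln (real m))"
    using law unfolding marton_law_def gdist_image [OF pK] by blast
  interpret H': subgroup H' G' by (rule H'(1))
  define H where "H = {x \<in> K. \<psi> x \<in> H'}"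
  have H'ne: "H' \<noteq> {}" using H'.one_closed by blast
  have HK: "H \<subseteq> K" by (auto simp: H_def)
  have img: "\<psi> ` H = H'"
    using H'(4) iterated_sumset_K [OF T(1), of l] unfolding iterated_sumset_image [OF T(1)] by (auto simp: H_def)
  have injH: "inj_on \<psi> H" by (rule inj_on_subset [OF \<psi>_inj HK])
  have finH: "finite H" using H'(2) img injH finite_imageD by blast
  have sub: "subgroup H G"
  proof (rule G.subgroupI)
    show "H \<subseteq> carrier G" using HK K.subset by auto
    show "H \<noteq> {}" using img H'ne by auto
    show "inv x \<in> H" if "x \<in> H" for x using that by (auto simp: H_def \<psi>_inv)
    show "x \<otimes> y \<in> H" if "x \<in> H" "y \<in> H" for x y using that by (auto simp: H_def \<psi>_mult)
  qed
  have ne: "H \<noteq> {}" using img H'ne by auto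
  have u: "pmf_of_set H' = map_pmf \<psi> (pmf_of_set H)"
    unfolding img [symmetric] by (rule map_pmf_of_set_inj [OF injH ne finH, symmetric])
  have uK: "set_pmf (pmf_of_set H) \<subseteq> K" using HK finH ne by simp
  have "H \<subseteq> iterated_sumset G l T"
  proof
    fix h assume h: "h \<in> H"
    then have "\<psi> h \<in> \<psi> ` iterated_sumset G l T" using img H'(4) unfolding iterated_sumset_image [OF T(1)] by auto
    then show "h \<in> iterated_sumset G l T"
      using h HK iterated_sumset_K [OF T(1), of l] \<psi>_inj by (auto simp: inj_on_def subset_iff)
  qed
  then have "H \<subseteq> iterated_sumset G l S" using iterated_sumset_mono [OF T(2)] by blast
  then show ?thesis
    unfolding marton_law_def using sub finH H'(3,5,6,7) unfolding u gdist_image [OF pK(1) uK] gdist_image [OF pK(2) uK] by blast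
qed

end

section \<open>Types of class \<open>ab_group_add\<close> as groups with carrier\<close>

definition type_group :: "'g::ab_group_add monoid" where
  "type_group = \<lparr>carrier = UNIV, mult = (+), one = 0\<rparr>"

lemma type_group_simps [simp]: "carrier type_group = UNIV" "x \<otimes>\<^bsub>type_group\<^esub> y = x + y" "\<one>\<^bsub>type_group\<^esub> = 0"
  by (simp_all add: type_group_def)

lemma comm_group_type_group: "comm_group (type_group :: 'g::ab_group_add monoid)"
proof (rule comm_groupI)
  show "\<exists>y\<in>carrier type_group. y \<otimes>\<^bsub>type_group\<^esub> x = \<one>\<^bsub>type_group\<^esub>" for x :: 'g
    by (rule bexI [of _ "- x"]) auto
qed (auto simp: add_ac)

lemma inv_type_group [simp]: "inv\<^bsub>type_group\<^esub> x = - (x :: 'g::ab_group_add)"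
proof -
  interpret comm_group "type_group :: 'g monoid" by (rule comm_group_type_group)
  show ?thesis by (rule inv_equality) auto
qed

lemma gdist_type_group: "gdist type_group p q = rdist p (q :: 'g::ab_group_add pmf)"
  using conv_map_pair [of "\<lambda>x. x" p uminus q] by (simp add: gdist_def rdist_def neg_def)

lemma iterated_sumset_type_group: "iterated_sumset type_group l S = sums_of l (S :: 'g::ab_group_add set)"
  by (induction l) (auto simp: set_mult_def)

lemma subgroup_type_group: "add_subgroup H \<Longrightarrow> subgroup H (type_group :: 'g::ab_group_add monoid)"
proof -
  assume H: "add_subgroup H"
  interpret comm_group "type_group :: 'g monoid" by (rule comm_group_type_group)
  show ?thesis
    by (rule subgroupI) (use H add_subgroup_add [OF H] add_subgroup_uminus [OF H] in \<open>auto simp: add_subgroup_def\<close>)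
qed

lemma marton_law_type_group:
  fixes p q :: "'g::ab_group_add pmf"
  assumes m: "m \<ge> 2" and fin: "finite (set_pmf p)" "finite (set_pmf q)"
    and S: "0 \<in> S" "uminus ` S = S" "set_pmf p \<subseteq> S" "set_pmf q \<subseteq> S"
    and tor: "\<And>x. x \<in> S \<Longrightarrow> smul m x = 0"
  shows "marton_law marton_const m type_group p q S"
  using entropic_marton [OF m fin S] tor subgroup_type_group
  unfolding marton_law_def gdist_type_group iterated_sumset_type_group by metis

text \<open>
  A finitely generated abelian group of bounded exponent is finite, so only finite groups matter.
\<close>

lemma marton_data_finite_subgroup:
  assumes "marton_data m G p q S"
  obtains K where "subgroup K G" "finite K" "set_pmf p \<subseteq> S \<inter> K" "set_pmf q \<subseteq> S \<inter> K"
    "\<one>\<^bsub>G\<^esub> \<in> S \<inter> K" "(\<lambda>x. inv\<^bsub>G\<^esub> x) ` (S \<inter> K) = S \<inter> K"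
proof -
  interpret comm_group G using assms by (simp add: marton_data_def)
  have d: "m \<ge> 2" "\<forall>g\<in>carrier G. g [^]\<^bsub>G\<^esub> m = \<one>\<^bsub>G\<^esub>" "finite (set_pmf p)" "finite (set_pmf q)" "S \<subseteq> carrier G"
    "(\<lambda>x. inv\<^bsub>G\<^esub> x) ` S = S" "\<one>\<^bsub>G\<^esub> \<in> S" "set_pmf p \<subseteq> S" "set_pmf q \<subseteq> S"
    using assms by (auto simp: marton_data_def set_inv_eq_image)
  have "finite (set_pmf p \<union> set_pmf q)" "set_pmf p \<union> set_pmf q \<subseteq> carrier G" "m > 0" using d by auto
  then obtain K where K: "subgroup K G" "finite K" "set_pmf p \<union> set_pmf q \<subseteq> K"
    using finite_subgroup_containing [OF _ _ d(2)] by blast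
  interpret K: subgroup K G by (rule K(1))
  have "(\<lambda>x. inv\<^bsub>G\<^esub> x) ` (S \<inter> K) = S \<inter> K"
  proof (intro equalityI subsetI)
    fix x assume x: "x \<in> S \<inter> K"
    then have "inv\<^bsub>G\<^esub> x \<in> S \<inter> K" using d(6) by auto
    moreover have "x = inv\<^bsub>G\<^esub> (inv\<^bsub>G\<^esub> x)" using x d(5) by auto
    ultimately show "x \<in> (\<lambda>x. inv\<^bsub>G\<^esub> x) ` (S \<inter> K)" by blast
  next
    fix x assume "x \<in> (\<lambda>x. inv\<^bsub>G\<^esub> x) ` (S \<inter> K)"
    then show "x \<in> S \<inter> K" using d(6) by auto
  qed
  then show thesis using that [OF K(1,2)] K(3) d by auto
qed

text \<open>The data live in a finite subgroup, which embeds into \<open>universal_group\<close>,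
  where \<open>entropic_marton\<close> applies. The constant is therefore the same for all groups of
  all types.\<close>

theorem marton_law_universal:
  assumes data: "marton_data m G p q S"
  shows "marton_law marton_const m G p q S"
proof -
  interpret comm_group G using data by (simp add: marton_data_def)
  obtain K where K: "subgroup K G" "finite K" "set_pmf p \<subseteq> S \<inter> K" "set_pmf q \<subseteq> S \<inter> K"
    "\<one>\<^bsub>G\<^esub> \<in> S \<inter> K" "(\<lambda>x. inv\<^bsub>G\<^esub> x) ` (S \<inter> K) = S \<inter> K"
    using marton_data_finite_subgroup [OF data] .
  have comm: "comm_group (G\<lparr>carrier := K\<rparr>)"
  proof (rule group.group_comm_groupI)
    show "group (G\<lparr>carrier := K\<rparr>)" by (rule subgroup_imp_group [OF K(1)])
    show "x \<otimes>\<^bsub>G\<lparr>carrier := K\<rparr>\<^esub> y = y \<otimes>\<^bsub>G\<lparr>carrier := K\<rparr>\<^esub> x"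
      if "x \<in> carrier (G\<lparr>carrier := K\<rparr>)" "y \<in> carrier (G\<lparr>carrier := K\<rparr>)" for x y
      using that subgroup.subset [OF K(1)] by (auto intro: m_comm)
  qed
  obtain \<iota> :: "'a \<Rightarrow> universal_group" where \<iota>: "inj_on \<iota> K" "\<And>x y. x \<in> K \<Longrightarrow> y \<in> K \<Longrightarrow> \<iota> (x \<otimes>\<^bsub>G\<^esub> y) = \<iota> x + \<iota> y"
    using finite_comm_group_embeds [OF comm] K(2) by auto
  interpret T: comm_group "type_group :: universal_group monoid" by (rule comm_group_type_group)
  interpret K: subgroup K G by (rule K(1))
  interpret subgroup_embedding G type_group K \<iota>
    by unfold_locales (use \<iota> in auto)
  have pow: "\<iota> (x [^]\<^bsub>G\<^esub> n) = smul n (\<iota> x)" if "x \<in> K" for x and n :: nat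
  proof (induction n)
    case (Suc n)
    have "x [^]\<^bsub>G\<^esub> n \<in> K" using that by (induction n) auto
    then show ?case using Suc \<iota>(2) that by (simp add: add.commute)
  qed (use \<psi>_one in simp)
  show ?thesis
  proof (rule marton_law_image [of "S \<inter> K"])
    show "marton_law marton_const m type_group (map_pmf \<iota> p) (map_pmf \<iota> q) (\<iota> ` (S \<inter> K))"
    proof (rule marton_law_type_group)
      show "m \<ge> 2" "finite (set_pmf (map_pmf \<iota> p))" "finite (set_pmf (map_pmf \<iota> q))"
        using data by (auto simp: marton_data_def)
      show "0 \<in> \<iota> ` (S \<inter> K)" using K(5) \<psi>_one by force
      show "set_pmf (map_pmf \<iota> p) \<subseteq> \<iota> ` (S \<inter> K)" "set_pmf (map_pmf \<iota> q) \<subseteq> \<iota> ` (S \<inter> K)" using K(3,4) by auto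
      have "uminus ` \<iota> ` (S \<inter> K) = \<iota> ` (\<lambda>x. inv\<^bsub>G\<^esub> x) ` (S \<inter> K)"
        unfolding image_image by (rule image_cong) (use \<psi>_inv in auto)
      then show "uminus ` \<iota> ` (S \<inter> K) = \<iota> ` (S \<inter> K)" by (simp only: K(6))
      show "smul m x = 0" if x: "x \<in> \<iota> ` (S \<inter> K)" for x
      proof -
        obtain y where y: "x = \<iota> y" "y \<in> K" "y \<in> S" using x by auto
        then have "y [^]\<^bsub>G\<^esub> m = \<one>\<^bsub>G\<^esub>" using data by (auto simp: marton_data_def)
        then show ?thesis using pow [OF y(2), of m] \<psi>_one y(1) by simp
      qed
    qed
  qed (use K in auto)
qed

text \<open>A finite subgroup has a copy whose elements are natural numbers. The constant is left
  untouched, so this works for every \<open>C\<close> and not only for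
  \<open>marton_const\<close>.\<close>

theorem marton_law_nat_transfer:
  assumes nat: "\<And>(G :: nat monoid) p q S. marton_data m G p q S \<Longrightarrow> marton_law C m G p q S"
    and data: "marton_data m G p q S"
  shows "marton_law C m G p q S"
proof -
  interpret comm_group G using data by (simp add: marton_data_def)
  obtain K where K: "subgroup K G" "finite K" "set_pmf p \<subseteq> S \<inter> K" "set_pmf q \<subseteq> S \<inter> K"
    "\<one>\<^bsub>G\<^esub> \<in> S \<inter> K" "(\<lambda>x. inv\<^bsub>G\<^esub> x) ` (S \<inter> K) = S \<inter> K"
    using marton_data_finite_subgroup [OF data] .
  interpret K: subgroup K G by (rule K(1))
  obtain f :: "'a \<Rightarrow> nat" where f: "inj_on f K"
    using finite_imp_inj_to_nat_seg [OF K(2)] by blast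
  define g where "g = the_inv_into K f"
  have gf: "g (f x) = x" if "x \<in> K" for x unfolding g_def by (rule the_inv_into_f_f [OF f that])
  define N :: "nat monoid" where "N = \<lparr>carrier = f ` K, mult = (\<lambda>x y. f (g x \<otimes>\<^bsub>G\<^esub> g y)), one = f \<one>\<^bsub>G\<^esub>\<rparr>"
  have N: "carrier N = f ` K" "\<one>\<^bsub>N\<^esub> = f \<one>\<^bsub>G\<^esub>" "x \<otimes>\<^bsub>N\<^esub> y = f (g x \<otimes>\<^bsub>G\<^esub> g y)" for x y
    by (simp_all add: N_def)
  have comm: "comm_group N"
  proof (rule comm_groupI)
    fix x assume "x \<in> carrier N"
    then obtain a where a: "x = f a" "a \<in> K" by (auto simp: N)
    then show "\<exists>y\<in>carrier N. y \<otimes>\<^bsub>N\<^esub> x = \<one>\<^bsub>N\<^esub>"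
      by (intro bexI [of _ "f (inv\<^bsub>G\<^esub> a)"]) (auto simp: N gf)
  qed (auto simp: N gf m_ac)
  interpret N: comm_group N by (rule comm)
  interpret subgroup_embedding G N K f
    by unfold_locales (use f in \<open>auto simp: N gf\<close>)
  have pow: "f (x [^]\<^bsub>G\<^esub> n) = f x [^]\<^bsub>N\<^esub> n" if "x \<in> K" for x and n :: nat
  proof (induction n)
    case (Suc n)
    have "x [^]\<^bsub>G\<^esub> n \<in> K" using that by (induction n) auto
    then show ?case using Suc \<psi>_mult that by simp
  qed (use \<psi>_one in simp)
  show ?thesis
  proof (rule marton_law_image [of "S \<inter> K"])
    have "marton_data m N (map_pmf f p) (map_pmf f q) (f ` (S \<inter> K))"
      unfolding marton_data_def set_inv_eq_image
    proof (intro conjI)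
      show "m \<ge> 2" "finite (set_pmf (map_pmf f p))" "finite (set_pmf (map_pmf f q))"
        using data by (auto simp: marton_data_def)
      show "comm_group N" by (rule comm)
      show "\<forall>g\<in>carrier N. g [^]\<^bsub>N\<^esub> m = \<one>\<^bsub>N\<^esub>"
      proof
        fix x assume "x \<in> carrier N"
        then obtain a where a: "x = f a" "a \<in> K" by (auto simp: N(1))
        then have "a [^]\<^bsub>G\<^esub> m = \<one>\<^bsub>G\<^esub>" using data K.subset by (auto simp: marton_data_def)
        then show "x [^]\<^bsub>N\<^esub> m = \<one>\<^bsub>N\<^esub>" using pow [OF a(2), of m] a(1) by (simp add: N(2))
      qed
      show "f ` (S \<inter> K) \<subseteq> carrier N" by (auto simp: N(1))
      show "\<one>\<^bsub>N\<^esub> \<in> f ` (S \<inter> K)" using K(5) by (auto simp: N(2))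
      show "set_pmf (map_pmf f p) \<subseteq> f ` (S \<inter> K)" "set_pmf (map_pmf f q) \<subseteq> f ` (S \<inter> K)" using K(3,4) by auto
      have "(\<lambda>x. inv\<^bsub>N\<^esub> x) ` f ` (S \<inter> K) = f ` (\<lambda>x. inv\<^bsub>G\<^esub> x) ` (S \<inter> K)"
        unfolding image_image by (rule image_cong) (use \<psi>_inv in auto)
      then show "(\<lambda>x. inv\<^bsub>N\<^esub> x) ` f ` (S \<inter> K) = f ` (S \<inter> K)" by (simp only: K(6))
    qed
    then show "marton_law C m N (map_pmf f p) (map_pmf f q) (f ` (S \<inter> K))" by (rule nat)
  qed (use K in auto)
qed

section \<open>Random variables and their distributions\<close>

text \<open>Built from the masses of level sets, which \<open>simple_function\<close> makes
  measurable; no \<sigma>-algebra on the values is involved.\<close>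

definition rv_law :: "'b measure \<Rightarrow> ('b \<Rightarrow> 'a) \<Rightarrow> 'a pmf" where
  "rv_law M X = embed_pmf (\<lambda>x. measure M {\<omega> \<in> space M. X \<omega> = x})"

lemma level_set_measurable: "simple_function M X \<Longrightarrow> {\<omega> \<in> space M. X \<omega> = x} \<in> sets M"
proof -
  assume "simple_function M X"
  then have "X -` {x} \<inter> space M \<in> sets M" by (rule simple_functionD)
  then show ?thesis by (simp add: vimage_def Int_def conj_commute)
qed

lemma pmf_rv_law:
  assumes "prob_space M" "simple_function M X"
  shows "pmf (rv_law M X) x = measure M {\<omega> \<in> space M. X \<omega> = x}"
proof -
  interpret prob_space M by fact
  let ?f = "\<lambda>x. measure M {\<omega> \<in> space M. X \<omega> = x}"
  have fin: "finite (X ` space M)" using assms(2) by (rule simple_functionD)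
  have "(\<integral>\<^sup>+x. ennreal (?f x) \<partial>count_space UNIV) = (\<Sum>x\<in>X ` space M. ennreal (?f x))"
  proof (rule nn_integral_count_space' [OF fin])
    fix x assume "x \<notin> X ` space M"
    then have "{\<omega> \<in> space M. X \<omega> = x} = {}" by auto
    then show "ennreal (?f x) = 0" by (simp only: measure_empty ennreal_0)
  qed simp
  also have "\<dots> = ennreal (\<Sum>x\<in>X ` space M. ?f x)" by simp
  also have "(\<Sum>x\<in>X ` space M. ?f x) = measure M (\<Union>x\<in>X ` space M. {\<omega> \<in> space M. X \<omega> = x})"
    by (rule finite_measure_finite_Union [symmetric])
      (use fin level_set_measurable [OF assms(2)] in \<open>auto simp: disjoint_family_on_def\<close>)
  also have "(\<Union>x\<in>X ` space M. {\<omega> \<in> space M. X \<omega> = x}) = space M" by auto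
  finally show ?thesis
    unfolding rv_law_def by (intro pmf_embed_pmf) (auto simp: prob_space)
qed

lemma set_rv_law:
  assumes "prob_space M" "simple_function M X"
  shows "set_pmf (rv_law M X) \<subseteq> X ` space M"
proof
  fix x assume "x \<in> set_pmf (rv_law M X)"
  then have "measure M {\<omega> \<in> space M. X \<omega> = x} \<noteq> 0" using assms by (simp add: set_pmf_iff pmf_rv_law)
  then have "{\<omega> \<in> space M. X \<omega> = x} \<noteq> {}" by (metis measure_empty)
  then show "x \<in> X ` space M" by auto
qed

lemma finite_rv_law:
  assumes "prob_space M" "simple_function M X"
  shows "finite (set_pmf (rv_law M X))"
  by (rule finite_subset [OF set_rv_law [OF assms]]) (rule simple_functionD [OF assms(2)])

lemma shannon_entropy_rv_law:
  assumes "prob_space M" "simple_function M X"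
  shows "shannon_entropy M X = pent (rv_law M X)"
proof -
  let ?p = "rv_law M X"
  have "shannon_entropy M X = (\<Sum>x\<in>X ` space M. pmf ?p x * - ln (pmf ?p x))"
    unfolding shannon_entropy_def
  proof (rule sum.cong [OF refl])
    fix x
    show "measure M {\<omega> \<in> space M. X \<omega> = x} * ln (1 / measure M {\<omega> \<in> space M. X \<omega> = x}) = pmf ?p x * - ln (pmf ?p x)"
      unfolding pmf_rv_law [OF assms]
      by (cases "measure M {\<omega> \<in> space M. X \<omega> = x} = 0") (simp_all add: ln_div)
  qed
  also have "\<dots> = pent ?p"
    unfolding pent_def
    by (rule sum.mono_neutral_right) (use simple_functionD(1) [OF assms(2)] set_rv_law [OF assms] in \<open>auto simp: set_pmf_iff\<close>)
  finally show ?thesis .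
qed

lemma rv_law_eqI:
  assumes "prob_space M" "simple_function M X" "\<And>x. measure M {\<omega> \<in> space M. X \<omega> = x} = pmf p x"
  shows "rv_law M X = p"
  by (rule pmf_eqI) (simp add: pmf_rv_law assms)

text \<open>The level sets of the combined variable are finite disjoint unions of rectangles, whose
  measures factor.\<close>

lemma rv_law_pair:
  fixes f :: "'a \<Rightarrow> 'b \<Rightarrow> 'c"
  assumes M: "prob_space M" "simple_function M X" and N: "prob_space N" "simple_function N Y"
  defines "Z \<equiv> \<lambda>\<omega>. f (X (fst \<omega>)) (Y (snd \<omega>))"
  shows "prob_space (M \<Otimes>\<^sub>M N)" "simple_function (M \<Otimes>\<^sub>M N) Z"
    "rv_law (M \<Otimes>\<^sub>M N) Z = map_pmf (\<lambda>\<omega>. f (fst \<omega>) (snd \<omega>)) (pair_pmf (rv_law M X) (rv_law N Y))"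
proof -
  interpret M: prob_space M by fact
  interpret N: prob_space N by fact
  interpret P: pair_prob_space M N ..
  show prob: "prob_space (M \<Otimes>\<^sub>M N)" by unfold_locales
  let ?A = "\<lambda>x. {\<omega> \<in> space M. X \<omega> = x}" and ?B = "\<lambda>y. {\<omega> \<in> space N. Y \<omega> = y}"
  define I where "I = (\<lambda>z. {xy \<in> X ` space M \<times> Y ` space N. f (fst xy) (snd xy) = z})"
  have finI: "finite (I z)" for z
    unfolding I_def using simple_functionD(1) [OF M(2)] simple_functionD(1) [OF N(2)] by auto
  have AB: "?A x \<times> ?B y \<in> sets (M \<Otimes>\<^sub>M N)" for x y
    by (intro pair_measureI level_set_measurable M N)
  have level: "{\<omega> \<in> space (M \<Otimes>\<^sub>M N). Z \<omega> = z} = (\<Union>xy\<in>I z. ?A (fst xy) \<times> ?B (snd xy))" for z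
    unfolding I_def Z_def space_pair_measure by force
  have meas: "{\<omega> \<in> space (M \<Otimes>\<^sub>M N). Z \<omega> = z} \<in> sets (M \<Otimes>\<^sub>M N)" for z
    unfolding level by (intro sets.finite_UN finI AB)
  show simp_f: "simple_function (M \<Otimes>\<^sub>M N) Z"
    unfolding simple_function_def
  proof (intro conjI ballI)
    have "Z ` space (M \<Otimes>\<^sub>M N) \<subseteq> (\<lambda>xy. f (fst xy) (snd xy)) ` (X ` space M \<times> Y ` space N)"
      unfolding Z_def space_pair_measure by force
    then show "finite (Z ` space (M \<Otimes>\<^sub>M N))"
      by (rule finite_subset) (use simple_functionD(1) [OF M(2)] simple_functionD(1) [OF N(2)] in auto)
    have "Z -` {z} \<inter> space (M \<Otimes>\<^sub>M N) = {\<omega> \<in> space (M \<Otimes>\<^sub>M N). Z \<omega> = z}" for z by auto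
    then show "Z -` {z} \<inter> space (M \<Otimes>\<^sub>M N) \<in> sets (M \<Otimes>\<^sub>M N)" for z using meas by simp
  qed
  show "rv_law (M \<Otimes>\<^sub>M N) Z = map_pmf (\<lambda>\<omega>. f (fst \<omega>) (snd \<omega>)) (pair_pmf (rv_law M X) (rv_law N Y))"
  proof (rule rv_law_eqI [OF prob simp_f])
    fix z
    let ?pq = "pair_pmf (rv_law M X) (rv_law N Y)"
    have "measure (M \<Otimes>\<^sub>M N) {\<omega> \<in> space (M \<Otimes>\<^sub>M N). Z \<omega> = z} = (\<Sum>xy\<in>I z. measure (M \<Otimes>\<^sub>M N) (?A (fst xy) \<times> ?B (snd xy)))"
      unfolding level
      by (rule P.finite_measure_finite_Union) (use finI AB in \<open>auto simp: disjoint_family_on_def prod_eq_iff\<close>)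
    also have "\<dots> = (\<Sum>xy\<in>I z. pmf ?pq xy)"
    proof (rule sum.cong [OF refl])
      fix xy
      have "emeasure (M \<Otimes>\<^sub>M N) (?A (fst xy) \<times> ?B (snd xy)) = emeasure M (?A (fst xy)) * emeasure N (?B (snd xy))"
        by (intro N.emeasure_pair_measure_Times level_set_measurable M N)
      then have "measure (M \<Otimes>\<^sub>M N) (?A (fst xy) \<times> ?B (snd xy)) = measure M (?A (fst xy)) * measure N (?B (snd xy))"
        by (simp add: measure_def enn2real_mult)
      then show "measure (M \<Otimes>\<^sub>M N) (?A (fst xy) \<times> ?B (snd xy)) = pmf ?pq xy"
        by (cases xy) (simp add: pmf_pair pmf_rv_law [OF M] pmf_rv_law [OF N])
    qed
    also have "\<dots> = (\<Sum>\<omega> | \<omega> \<in> set_pmf ?pq \<and> f (fst \<omega>) (snd \<omega>) = z. pmf ?pq \<omega>)"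
    proof (rule sum.mono_neutral_right [OF finI])
      show "{\<omega> \<in> set_pmf ?pq. f (fst \<omega>) (snd \<omega>) = z} \<subseteq> I z"
        using set_rv_law [OF M] set_rv_law [OF N] unfolding I_def by auto
      show "\<forall>i\<in>I z - {\<omega> \<in> set_pmf ?pq. f (fst \<omega>) (snd \<omega>) = z}. pmf ?pq i = 0"
        unfolding I_def by (auto simp: set_pmf_iff pmf_pair)
    qed
    also have "\<dots> = pmf (map_pmf (\<lambda>\<omega>. f (fst \<omega>) (snd \<omega>)) ?pq) z"
      by (rule pmf_map_sum [symmetric]) (simp add: finite_rv_law M N)
    finally show "measure (M \<Otimes>\<^sub>M N) {\<omega> \<in> space (M \<Otimes>\<^sub>M N). Z \<omega> = z} = pmf (map_pmf (\<lambda>\<omega>. f (fst \<omega>) (snd \<omega>)) ?pq) z" .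
  qed
qed

lemma ruzsa_dist_rv_law:
  assumes "prob_space M" "simple_function M X" "prob_space N" "simple_function N Y"
  shows "ruzsa_dist G M X N Y = gdist G (rv_law M X) (rv_law N Y)"
  using rv_law_pair(2,3) [OF assms, of "\<lambda>x y. x \<otimes>\<^bsub>G\<^esub> inv\<^bsub>G\<^esub> y"] rv_law_pair(1) [OF assms]
  by (simp add: ruzsa_dist_def gdist_def case_prod_unfold shannon_entropy_rv_law assms)

lemma ruzsa_dist_subgroup_rv_law:
  assumes M: "prob_space M" "simple_function M X" and H: "finite H" "H \<noteq> {}"
  shows "ruzsa_dist_subgroup G M X H = gdist G (rv_law M X) (pmf_of_set H)"
proof -
  have prob: "prob_space (uniform_count_measure H)" by (rule prob_space_uniform_count_measure [OF H])
  have simp_f: "simple_function (uniform_count_measure H) (\<lambda>h. h)"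
    using H by (auto simp: simple_function_def space_uniform_count_measure sets_uniform_count_measure)
  have "rv_law (uniform_count_measure H) (\<lambda>h. h) = pmf_of_set H"
  proof (rule rv_law_eqI [OF prob simp_f])
    fix x
    have "{h \<in> space (uniform_count_measure H). h = x} = (if x \<in> H then {x} else {})"
      by (auto simp: space_uniform_count_measure)
    then show "measure (uniform_count_measure H) {h \<in> space (uniform_count_measure H). h = x} = pmf (pmf_of_set H) x"
      using H by (simp add: measure_uniform_count_measure)
  qed
  then show ?thesis
    unfolding ruzsa_dist_subgroup_def by (simp add: ruzsa_dist_rv_law [OF M prob simp_f])
qed

lemma subgroup_near_both_rv_law:
  assumes "prob_space M" "simple_function M X" "prob_space N" "simple_function N Y"
  shows "subgroup_near_both C m G M X N Y H \<longleftrightarrow> subgroup H G \<and> finite H \<and>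
     gdist G (rv_law M X) (pmf_of_set H) \<le> C * real m ^ 3 * gdist G (rv_law M X) (rv_law N Y) \<and>
     gdist G (rv_law N Y) (pmf_of_set H) \<le> C * real m ^ 3 * gdist G (rv_law M X) (rv_law N Y)"
proof (cases "subgroup H G \<and> finite H")
  case True
  then have "H \<noteq> {}" using subgroup.one_closed by fastforce
  then show ?thesis
    using True assms by (simp add: subgroup_near_both_def ruzsa_dist_rv_law ruzsa_dist_subgroup_rv_law)
qed (auto simp: subgroup_near_both_def)

section \<open>The theorem for random variables\<close>

lemma marton_with_constantI:
  assumes law: "\<And>m (G :: 'a monoid) p q S. marton_data m G p q S \<Longrightarrow> marton_law C m G p q S"
  shows "marton_with_constant TYPE('a \<times> 'b \<times> 'c) C"
  unfolding marton_with_constant_def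
proof (intro allI impI)
  fix m :: nat and G :: "'a monoid" and M :: "'b measure" and X :: "'b \<Rightarrow> 'a" and N :: "'c measure" and Y :: "'c \<Rightarrow> 'a"
  assume m: "m \<ge> 2" and *: "comm_group G \<and> (\<forall>g\<in>carrier G. g [^]\<^bsub>G\<^esub> m = \<one>\<^bsub>G\<^esub>) \<and> group_valued_rv G M X \<and> group_valued_rv G N Y"
  then have MN: "prob_space M" "simple_function M X" "prob_space N" "simple_function N Y"
    and range: "X ` space M \<subseteq> carrier G" "Y ` space N \<subseteq> carrier G" by (simp_all add: group_valued_rv_def)
  interpret comm_group G using * by simp
  have main: "\<exists>H l. subgroup_near_both C m G M X N Y H \<and> l > 0 \<and> H \<subseteq> iterated_sumset G l S \<and>
      real l \<le> C * (2 + real m * ruzsa_dist G M X N Y) powr (C * real m ^ 3 * ln (real m))"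
    if S: "S \<subseteq> carrier G" "set_inv\<^bsub>G\<^esub> S = S" "\<one>\<^bsub>G\<^esub> \<in> S" "X ` space M \<subseteq> S" "Y ` space N \<subseteq> S" for S
  proof -
    have "marton_data m G (rv_law M X) (rv_law N Y) S"
      unfolding marton_data_def
    proof (intro conjI)
      show "set_pmf (rv_law M X) \<subseteq> S" using set_rv_law [OF MN(1,2)] S(4) by (rule subset_trans)
      show "set_pmf (rv_law N Y) \<subseteq> S" using set_rv_law [OF MN(3,4)] S(5) by (rule subset_trans)
    qed (use m * S MN in \<open>simp_all add: finite_rv_law\<close>)
    from law [OF this] show ?thesis
      unfolding marton_law_def subgroup_near_both_rv_law [OF MN] ruzsa_dist_rv_law [OF MN] by blast
  qed
  have "set_inv\<^bsub>G\<^esub> (carrier G) = carrier G"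
  proof
    show "carrier G \<subseteq> set_inv\<^bsub>G\<^esub> (carrier G)"
    proof
      fix x assume "x \<in> carrier G"
      then have "x = inv\<^bsub>G\<^esub> (inv\<^bsub>G\<^esub> x)" "inv\<^bsub>G\<^esub> x \<in> carrier G" by simp_all
      then show "x \<in> set_inv\<^bsub>G\<^esub> (carrier G)" unfolding SET_INV_def by blast
    qed
  qed (auto simp: SET_INV_def)
  then have "\<exists>H. subgroup_near_both C m G M X N Y H" using main [of "carrier G"] range one_closed by blast
  then show "(\<exists>H. subgroup_near_both C m G M X N Y H) \<and>
    (\<forall>S. S \<subseteq> carrier G \<and> set_inv\<^bsub>G\<^esub> S = S \<and> \<one>\<^bsub>G\<^esub> \<in> S \<and> X ` space M \<subseteq> S \<and> Y ` space N \<subseteq> S \<longrightarrow>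
      (\<exists>H l. subgroup_near_both C m G M X N Y H \<and> l > 0 \<and> H \<subseteq> iterated_sumset G l S \<and>
        real l \<le> C * (2 + real m * ruzsa_dist G M X N Y) powr (C * real m ^ 3 * ln (real m))))"
    using main by blast
qed

text \<open>On the whole sample space the identity may take infinitely many values although its
  distribution has finite support; points outside the support are therefore sent to a fixed point of
  it.\<close>

lemma measure_pmf_rv:
  fixes p :: "'a pmf"
  assumes "finite (set_pmf p)"
  obtains X where "X ` UNIV \<subseteq> set_pmf p" "simple_function (measure_pmf p) X" "rv_law (measure_pmf p) X = p"
proof -
  obtain x0 where x0: "x0 \<in> set_pmf p" using set_pmf_not_empty [of p] by blast
  define X where "X x = (if x \<in> set_pmf p then x else x0)" for x
  have sub: "X ` UNIV \<subseteq> set_pmf p" using x0 by (auto simp: X_def)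
  have simp_f: "simple_function (measure_pmf p) X"
    using finite_subset [OF sub assms] by (simp add: simple_function_def)
  have "rv_law (measure_pmf p) X = map_pmf X p"
    by (rule rv_law_eqI [OF measure_pmf.prob_space_axioms simp_f]) (simp add: pmf_map vimage_def)
  also have "\<dots> = p" by (rule map_pmf_idI) (simp add: X_def)
  finally show thesis using that sub simp_f by blast
qed

text \<open>Realised on \<open>measure_pmf\<close>, distributions on a type use this type for both
  sample spaces as well; for \<open>nat\<close> this gives the closed type of the theorem.\<close>

lemma marton_with_constantD:
  fixes G :: "'a monoid"
  assumes C: "marton_with_constant TYPE('a \<times> 'a \<times> 'a) C" and data: "marton_data m G p q S"
  shows "marton_law C m G p q S"
proof -
  have d: "m \<ge> 2" "comm_group G" "\<forall>g\<in>carrier G. g [^]\<^bsub>G\<^esub> m = \<one>\<^bsub>G\<^esub>" "finite (set_pmf p)" "finite (set_pmf q)" "S \<subseteq> carrier G"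
    "set_inv\<^bsub>G\<^esub> S = S" "\<one>\<^bsub>G\<^esub> \<in> S" "set_pmf p \<subseteq> S" "set_pmf q \<subseteq> S"
    using data unfolding marton_data_def by blast+
  obtain X where X: "X ` UNIV \<subseteq> set_pmf p" "simple_function (measure_pmf p) X" "rv_law (measure_pmf p) X = p"
    using measure_pmf_rv [OF d(4)] .
  obtain Y where Y: "Y ` UNIV \<subseteq> set_pmf q" "simple_function (measure_pmf q) Y" "rv_law (measure_pmf q) Y = q"
    using measure_pmf_rv [OF d(5)] .
  note rv = measure_pmf.prob_space_axioms [of p] X(2) measure_pmf.prob_space_axioms [of q] Y(2)
  have sub: "X ` space (measure_pmf p) \<subseteq> S" "Y ` space (measure_pmf q) \<subseteq> S"
    using subset_trans [OF X(1) d(9)] subset_trans [OF Y(1) d(10)] by simp_all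
  have gv: "group_valued_rv G (measure_pmf p) X" "group_valued_rv G (measure_pmf q) Y"
    unfolding group_valued_rv_def
    using rv subset_trans [OF sub(1) d(6)] subset_trans [OF sub(2) d(6)] by simp_all
  have "\<exists>H l. subgroup_near_both C m G (measure_pmf p) X (measure_pmf q) Y H \<and> l > 0 \<and> H \<subseteq> iterated_sumset G l S \<and>
      real l \<le> C * (2 + real m * ruzsa_dist G (measure_pmf p) X (measure_pmf q) Y) powr (C * real m ^ 3 * ln (real m))"
    using C [unfolded marton_with_constant_def, rule_format, OF d(1) conjI [OF d(2) conjI [OF d(3) conjI [OF gv]]]]
      d(6,7,8) sub by blast
  then show ?thesis
    unfolding marton_law_def subgroup_near_both_rv_law [OF rv] ruzsa_dist_rv_law [OF rv] X(3) Y(3) by blast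
qed

theorem theorem1p3:
  shows "(\<exists>C>0. marton_with_constant TYPE(nat \<times> nat \<times> nat) C) \<and>
         (\<forall>C>0. marton_with_constant TYPE(nat \<times> nat \<times> nat) C \<longrightarrow>
                marton_with_constant TYPE('a \<times> 'b \<times> 'c) C)"
proof (intro conjI allI impI)
  have "marton_with_constant TYPE(nat \<times> nat \<times> nat) marton_const"
    by (rule marton_with_constantI) (rule marton_law_universal)
  then show "\<exists>C>0. marton_with_constant TYPE(nat \<times> nat \<times> nat) C"
    by (intro exI [of _ marton_const]) (simp add: marton_const_def)
next
  fix C :: real
  assume "marton_with_constant TYPE(nat \<times> nat \<times> nat) C"
  \<comment> \<open>The given \<open>C\<close> is carried from random variables over
    \<open>nat\<close> to distributions over \<open>nat\<close>, then to distributions over any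
    type, and back to random variables.\<close>
  from marton_with_constantD [OF this] show "marton_with_constant TYPE('a \<times> 'b \<times> 'c) C"
    by (intro marton_with_constantI) (rule marton_law_nat_transfer)
qed

end
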